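(* Let $u$ be a variational solution in $\Omega$, let $x^0\in\Sigma^u$ and $\delta:=\mathrm{dist}(x^0,\partial\Omega)/2$. Define for $r\in(0,\delta)$ \[F_{x^0,u}(r):=r\frac{\int_{B_r(x^0)}\big(|\nabla u|^2+x_n^+(\chi_{\{u>0\}}-1)\big)}{\int_{\partial B_r(x^0)}u^2\,d\mathcal H^{n-1}}.\] Then for a.e. $r\in(0,\delta)$, \begin{align*}\frac{d}{dr}F_{x^0,u}(r)=&\ \frac2r\Big(\int_{\partial B_r(x^0)}u^2\Big)^{-2}\Big[\int_{\partial B_r(x^0)}(\nabla u\cdot(x-x^0))^2\int_{\partial B_r(x^0)}u^2-\Big(\int_{\partial B_r(x^0)}u\,\nabla u\cdot(x-x^0)\Big)^2\Big]\\&+2\frac{\int_{B_r(x^0)}x_n^+(1-\chi_{\{u>0\}})}{\int_{\partial B_r(x^0)}u^2}\Big(r\frac{\int_{B_r(x^0)}|\nabla u|^2}{\int_{\partial B_r(x^0)}u^2}-\frac32\Big),\end{align*} (all boundary integrals with respect to $\mathcal H^{n-1}$). The function $r\mapsto F_{x^0,u}(r)$ is non-decreasing on $(0,\delta)$, and the limit $F_{x^0,u}(0+):=\lim_{r\searrow0}F_{x^0,u}(r)$ exists and lies in $[3/2,\infty)$.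
   Context: Let $n\ge2$, $\Omega\subset\mathbb{R}^n$ a bounded domain meeting $\{x_n=0\}$; $a^+=\max(a,0)$; $\chi_A$ characteristic function. Variational solution: $u\in W^{1,2}_{\mathrm{loc}}(\Omega)\cap C^0(\Omega)\cap C^2(\Omega\cap\{u>0\})$, $u\ge0$, $u\equiv0$ in $\Omega\cap\{x_n\le0\}$, and $\int_\Omega(|\nabla u|^2\mathrm{div}\phi-2\nabla u D\phi\nabla u+x_n\chi_{\{u>0\}}\mathrm{div}\phi+\chi_{\{u>0\}}\phi_n)=0$ for all $\phi\in C^1_0(\Omega;\mathbb{R}^n)$. $S^u:=\{x\in\Omega:x_n=0,\ x\in\partial\{u>0\}\}$. For $x^0_n=0$ and $0<r<\mathrm{dist}(x^0,\partial\Omega)/2$: $\Phi^{\mathrm{bound}}_{x^0,u}(r):=r^{-n-1}\int_{B_r(x^0)}(|\nabla u|^2+x_n\chi_{\{u>0\}})-\tfrac32r^{-n-2}\int_{\partial B_r(x^0)}u^2d\mathcal H^{n-1}$, $\Phi^{\mathrm{bound}}_{x^0,u}(0+)$ its limit as $r\searrow0$ (which exists). $\Sigma^u:=\{x^0\in S^u:\Phi^{\mathrm{bound}}_{x^0,u}(0+)=\int_{B_1}x_n^+\}$. *)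

theory Defs
  imports "HOL-Analysis.Analysis"
begin

text \<open>Points of R^n are vectors of type real^'n; n = CARD('n).
  The distinguished coordinate x_n is x $ k for a fixed index k.\<close>

definition tsupp :: "('a::real_normed_vector \<Rightarrow> 'b::zero) \<Rightarrow> 'a set" where
  "tsupp f = closure {x. f x \<noteq> 0}"

definition C1c_scalar :: "(real^'n) set \<Rightarrow> (real^'n \<Rightarrow> real) \<Rightarrow> bool" where
  "C1c_scalar \<Omega> \<psi> \<longleftrightarrow>
     (\<exists>D. (\<forall>x. (\<psi> has_derivative D x) (at x)) \<and>
          (\<forall>j. continuous_on UNIV (\<lambda>x. D x (axis j 1)))) \<and>
     compact (tsupp \<psi>) \<and> tsupp \<psi> \<subseteq> \<Omega>"

definition C1c_field :: "(real^'n) set \<Rightarrow> (real^'n \<Rightarrow> real^'n) \<Rightarrow> bool" where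
  "C1c_field \<Omega> \<phi> \<longleftrightarrow>
     (\<exists>D. (\<forall>x. (\<phi> has_derivative D x) (at x)) \<and>
          (\<forall>i j. continuous_on UNIV (\<lambda>x. D x (axis j 1) $ i))) \<and>
     compact (tsupp \<phi>) \<and> tsupp \<phi> \<subseteq> \<Omega>"

definition C2_on :: "(real^'n) set \<Rightarrow> (real^'n \<Rightarrow> real) \<Rightarrow> bool" where
  "C2_on S f \<longleftrightarrow>
     (\<exists>g H. (\<forall>x\<in>S. (f has_derivative (\<lambda>h. g x \<bullet> h)) (at x)) \<and>
            (\<forall>x\<in>S. (g has_derivative H x) (at x)) \<and>
            (\<forall>i j. continuous_on S (\<lambda>x. H x (axis j 1) $ i)))"

definition W12loc_grad ::
  "(real^'n) set \<Rightarrow> (real^'n \<Rightarrow> real) \<Rightarrow> (real^'n \<Rightarrow> real^'n) \<Rightarrow> bool" where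
  "W12loc_grad \<Omega> u Du \<longleftrightarrow>
     u \<in> borel_measurable borel \<and> Du \<in> borel_measurable borel \<and>
     (\<forall>K. compact K \<and> K \<subseteq> \<Omega> \<longrightarrow>
        set_integrable lebesgue K (\<lambda>x. (u x)\<^sup>2) \<and>
        set_integrable lebesgue K (\<lambda>x. (norm (Du x))\<^sup>2)) \<and>
     (\<forall>\<psi> i. C1c_scalar \<Omega> \<psi> \<longrightarrow>
        (LINT x:\<Omega>|lebesgue. u x * frechet_derivative \<psi> (at x) (axis i 1))
        = - (LINT x:\<Omega>|lebesgue. Du x $ i * \<psi> x))"

definition chi_pos :: "(real^'n \<Rightarrow> real) \<Rightarrow> real^'n \<Rightarrow> real" where
  "chi_pos u x = (if u x > 0 then 1 else 0)"

definition divg :: "(real^'n \<Rightarrow> real^'n) \<Rightarrow> real^'n \<Rightarrow> real" where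
  "divg \<phi> x = (\<Sum>i\<in>UNIV. frechet_derivative \<phi> (at x) (axis i 1) $ i)"

definition variational_solution ::
  "'n \<Rightarrow> (real^'n) set \<Rightarrow> (real^'n \<Rightarrow> real) \<Rightarrow> (real^'n \<Rightarrow> real^'n) \<Rightarrow> bool" where
  "variational_solution k \<Omega> u Du \<longleftrightarrow>
     W12loc_grad \<Omega> u Du \<and> continuous_on \<Omega> u \<and>
     C2_on {x\<in>\<Omega>. u x > 0} u \<and>
     (\<forall>x\<in>\<Omega>. u x \<ge> 0) \<and> (\<forall>x\<in>\<Omega>. x $ k \<le> 0 \<longrightarrow> u x = 0) \<and>
     (\<forall>\<phi>. C1c_field \<Omega> \<phi> \<longrightarrow>
        (LINT x:\<Omega>|lebesgue.
            (norm (Du x))\<^sup>2 * divg \<phi> x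
          - 2 * (Du x \<bullet> frechet_derivative \<phi> (at x) (Du x))
          + x $ k * chi_pos u x * divg \<phi> x
          + chi_pos u x * \<phi> x $ k) = 0)"

text \<open>Surface integral over the sphere \<partial>B_r(x0) w.r.t. H^{n-1}, via the
  standard polar-coordinate identity
  int_{\<partial>B_r(x0)} f dH^{n-1} = n r^{n-1} int_{B_1(0)} f(x0 + r z/|z|) dz
  (H^{n-1} on the unit sphere equals n times the cone measure).\<close>
definition sphere_int :: "real^'n \<Rightarrow> real \<Rightarrow> (real^'n \<Rightarrow> real) \<Rightarrow> real" where
  "sphere_int x0 r f = real CARD('n) * r ^ (CARD('n) - 1) *
     (LINT z:ball 0 1|lebesgue. f (x0 + (r / norm z) *\<^sub>R z))"

definition S_set :: "'n \<Rightarrow> (real^'n) set \<Rightarrow> (real^'n \<Rightarrow> real) \<Rightarrow> (real^'n) set" where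
  "S_set k \<Omega> u = {x\<in>\<Omega>. x $ k = 0 \<and> x \<in> frontier {y\<in>\<Omega>. u y > 0}}"

definition Phi_bound ::
  "'n \<Rightarrow> (real^'n \<Rightarrow> real) \<Rightarrow> (real^'n \<Rightarrow> real^'n) \<Rightarrow> real^'n \<Rightarrow> real \<Rightarrow> real" where
  "Phi_bound k u Du x0 r =
     r powr (- real CARD('n) - 1) *
       (LINT x:ball x0 r|lebesgue. (norm (Du x))\<^sup>2 + x $ k * chi_pos u x)
     - 3/2 * r powr (- real CARD('n) - 2) * sphere_int x0 r (\<lambda>x. (u x)\<^sup>2)"

definition Sigma_set ::
  "'n \<Rightarrow> (real^'n) set \<Rightarrow> (real^'n \<Rightarrow> real) \<Rightarrow> (real^'n \<Rightarrow> real^'n) \<Rightarrow> (real^'n) set" where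
  "Sigma_set k \<Omega> u Du = {x0\<in>S_set k \<Omega> u.
     ((Phi_bound k u Du x0) \<longlongrightarrow> (LINT x:ball 0 1|lebesgue. max (x $ k) 0)) (at_right 0)}"

definition F_freq ::
  "'n \<Rightarrow> (real^'n \<Rightarrow> real) \<Rightarrow> (real^'n \<Rightarrow> real^'n) \<Rightarrow> real^'n \<Rightarrow> real \<Rightarrow> real" where
  "F_freq k u Du x0 r =
     r * (LINT x:ball x0 r|lebesgue. (norm (Du x))\<^sup>2 + max (x $ k) 0 * (chi_pos u x - 1))
       / sphere_int x0 r (\<lambda>x. (u x)\<^sup>2)"

end

theory Submission
  imports Defs
begin

text \<open>Write \<open>D\<close>, \<open>V\<close> for the integrals of \<open>|Du|^2\<close> and \<open>x_n^+ (1 - chi)\<close> over the ball of radius \<open>r\<close>, and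
  \<open>H\<close>, \<open>M\<close>, \<open>N\<close> for the sphere integrals of \<open>u^2\<close>, \<open>u (Du . y)\<close> and \<open>(Du . y)^2\<close>, with \<open>y = x - x0\<close>. Domain
  variations supported in the positivity set show that \<open>u\<close> is harmonic there; truncating \<open>u\<close> away from its
  zero set then gives \<open>Du = 0\<close> almost everywhere on \<open>{u = 0}\<close>, the energy identity \<open>M = r D\<close> and
  \<open>r H' = (n - 1) H + 2 r D\<close>. The domain variation with a radial field gives the derivative of the ball
  integrals for almost every \<open>r\<close>. These identities express the derivative of the boundary functional as a
  sphere integral of \<open>2 (Du . y - 3/2 u)^2\<close>, so the functional lies above its limit at \<open>0\<close>; at a point of
  the set Sigma this says \<open>r (D - V) \<ge> 3/2 H\<close>. The formula for the derivative of \<open>F = r (D - V) / H\<close> is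
  algebra at Lebesgue points, and its two terms are nonnegative by Cauchy-Schwarz and by this inequality.
  Moreover \<open>H > 0\<close>, because \<open>r^(1-n) H\<close> is nondecreasing and \<open>u\<close> does not vanish near \<open>x0\<close>.\<close>

section \<open>Primitives of integrable functions\<close>

text \<open>Two obstacles shape the proof. Nothing is known about the free boundary, so no boundary
  terms on it can be written down; and \<open>Du\<close> is only locally square integrable, so its
  sphere integrals are meaningful for almost every radius only. Every identity is therefore first
  proved against test functions and then read off for almost every \<open>r\<close>. Since a
  derivative that exists almost everywhere does not control increments, monotone quantities are kept
  in the form \<alpha> times a primitive plus \<beta>, with \<alpha> and \<beta> of class C^1. For
  this \<open>H\<close> itself must be C^1, which holds because the energy identity exchanges the
  flux \<open>M\<close> for the continuous \<open>r D\<close>. The equation for \<open>u\<close> is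
  not given: domain variations only yield that gradient times Laplacian is 0, and the C^2 hypothesis
  removes the gradient factor. The number 3/2 is half of (n + 1) - (n - 2), the coefficients that a
  dilation produces in the height term and in the Dirichlet term; it is the degree of homogeneity of
  \<open>u\<close> at which both terms scale alike.\<close>

definition prim :: "(real \<Rightarrow> real) \<Rightarrow> real \<Rightarrow> real" where
  "prim a y = (LINT x:{..y}|lborel. a x)"

lemma set_integrable_of_integrable:
  fixes f :: "'a \<Rightarrow> real"
  assumes "integrable M f" "A \<in> sets M"
  shows "set_integrable M A f"
  unfolding set_integrable_def by (rule integrable_mult_indicator[OF assms(2,1)])

lemma prim_diff:
  assumes "integrable lborel a" "s \<le> t"
  shows "prim a t - prim a s = (LINT x:{s<..t}|lborel. a x)"
proof -
  have "{..t} = {..s} \<union> {s<..t}" using assms by auto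
  moreover have "set_integrable lborel A a" if "A \<in> sets borel" for A
    using assms that by (intro set_integrable_of_integrable) auto
  ultimately show ?thesis
    unfolding prim_def by (simp add: set_integral_Un disjoint_iff)
qed

section \<open>Lebesgue differentiation on the real line\<close>

text \<open>The difference quotient is the mean of \<open>a\<close> over the interval between
  \<open>x\<close> and \<open>x + h\<close>, for either sign of \<open>h\<close>. Enlarging that
  interval to a ball centred at \<open>x\<close> prepares the Vitali covering and costs only a
  constant factor; the radius 2 |h| makes the open ball contain the endpoint
  \<open>x + h\<close>.\<close>

lemma difference_quotient_le_average:
  assumes a: "integrable lborel a" and "h \<noteq> 0" and q: "(prim a (x + h) - prim a x) / h > q" and "p < q"
    and g: "integrable lborel g" "\<And>x. g x \<ge> 0" "\<And>t. t \<in> ball x (2 * \<bar>h\<bar>) \<Longrightarrow> a t - p \<le> g t"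
  shows "(q - p) * \<bar>h\<bar> \<le> (LINT t:ball x (2 * \<bar>h\<bar>)|lborel. g t)"
proof -
  define I where "I = {min x (x+h)<..max x (x+h)}"
  have I: "I \<in> sets borel" "I \<subseteq> ball x (2*\<bar>h\<bar>)" using \<open>h \<noteq> 0\<close>
    unfolding I_def by (auto simp: dist_real_def)
  have mI: "measure lborel I = \<bar>h\<bar>" "emeasure lborel I < \<infinity>"
    unfolding I_def by auto
  have si: "set_integrable lborel A b" if "A \<in> sets borel" "integrable lborel b" for A and b :: "real \<Rightarrow> real"
    using that by (intro set_integrable_of_integrable) auto
  have eq: "(prim a (x + h) - prim a x) / h * \<bar>h\<bar> = (LINT t:I|lborel. a t)"
  proof (cases "h > 0")
    case True
    then show ?thesis using prim_diff[OF a, of x "x+h"] by (simp add: I_def)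
  next
    case False
    then have "h < 0" using \<open>h \<noteq> 0\<close> by simp
    then show ?thesis using prim_diff[OF a, of "x+h" x] by (simp add: I_def)
  qed
  have c: "set_integrable lborel I (\<lambda>t. p)"
    using mI I by (auto simp: set_integrable_def)
  have "q * \<bar>h\<bar> \<le> (LINT t:I|lborel. a t)"
    using eq q \<open>h \<noteq> 0\<close> by (metis abs_ge_zero less_imp_le mult_right_mono)
  moreover have "(LINT t:I|lborel. p) = p * \<bar>h\<bar>"
    using mI I by (simp add: set_integral_const)
  moreover have "(LINT t:I|lborel. a t - p) = (LINT t:I|lborel. a t) - (LINT t:I|lborel. p)"
    by (rule set_integral_diff(2)[OF si[OF I(1) a] c])
  moreover have "(LINT t:I|lborel. a t - p) \<le> (LINT t:I|lborel. g t)"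
    by (rule set_integral_mono[OF set_integral_diff(1)[OF si[OF I(1) a] c] si[OF I(1) g(1)]])
       (use I g(3) in auto)
  moreover have "(LINT t:I|lborel. g t) \<le> (LINT t:ball x (2 * \<bar>h\<bar>)|lborel. g t)"
    unfolding set_lebesgue_integral_def
    using si[OF I(1) g(1)] si[of "ball x (2 * \<bar>h\<bar>)", OF _ g(1)] I(2) g(2)
    by (intro integral_mono) (auto simp: set_integrable_def split: split_indicator)
  ultimately show ?thesis by (simp add: algebra_simps)
qed

text \<open>The excess of the density over the level \<open>p\<close> vanishes where the density is below \<open>p\<close>, so outer
  regularity gives an open neighbourhood of small excess; Vitali's theorem fills the exceptional set with
  disjoint balls, each of which carries excess proportional to its length.\<close>

lemma negligible_large_upper_quotient:
  assumes a: "integrable lborel a" and "p < q"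
  shows "negligible {x \<in> ball 0 m. a x < p \<and>
     (\<forall>d>0. \<exists>h. 0 < \<bar>h\<bar> \<and> \<bar>h\<bar> < d \<and> (prim a (x + h) - prim a x) / h > q)}" (is "negligible ?S")
proof -
  define S where "S = ?S"
  have "negligible S"
  proof (rule negligible_outer_le[THEN iffD2], intro allI impI)
  fix e :: real assume "e > 0"
  have am[measurable]: "a \<in> borel_measurable borel" using a by auto
  define g where "g = (\<lambda>x. indicator (ball 0 m) x * max 0 (a x - p))"
  have gm[measurable]: "g \<in> borel_measurable borel" unfolding g_def
    by (intro borel_measurable_times borel_measurable_indicator borel_measurable_max borel_measurable_diff) auto
  have "integrable lborel (\<lambda>x. indicator (ball 0 m) x * a x - p * indicator (ball 0 m) x)"
    using integrable_mult_indicator[OF _ a, of "ball 0 m"]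
    by (intro Bochner_Integration.integrable_diff)
       (auto intro!: integrable_mult_right integrable_real_indicator emeasure_lborel_ball_finite[unfolded infinity_ennreal_def])
  then have g: "integrable lborel g"
    by (rule Bochner_Integration.integrable_bound) (auto simp: g_def indicator_def)
  have g0: "g x \<ge> 0" for x by (simp add: g_def)
  define M where "M = density lborel g"
  have sM: "sets M = sets borel" by (simp add: M_def)
  have eM: "emeasure M A = ennreal (LINT t:A|lborel. g t)" if "A \<in> sets borel" for A
  proof -
    have "emeasure M A = (\<integral>\<^sup>+ x. ennreal (indicator A x * g x) \<partial>lborel)"
      unfolding M_def using that by (subst emeasure_density) (auto intro!: nn_integral_cong simp: indicator_def)
    also have "\<dots> = ennreal (LINT t:A|lborel. g t)"
      unfolding set_lebesgue_integral_def real_scaleR_def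
      using integrable_mult_indicator[OF _ g, of A] that
      by (intro nn_integral_eq_integral) (auto simp: g0)
    finally show ?thesis .
  qed
  have fin: "emeasure M (space M) \<noteq> \<infinity>" 
    using eM[of UNIV] by (simp add: M_def)
  define B where "B = {x \<in> ball 0 m. a x < p}"
  have B[measurable]: "B \<in> sets borel" unfolding B_def by measurable
  have "(\<lambda>x. indicator B x * g x) = (\<lambda>x. 0)" by (auto simp: B_def g_def indicator_def)
  then have "emeasure M B = 0" using eM[OF B] unfolding set_lebesgue_integral_def real_scaleR_def by simp
  then have "(INF U\<in>{U. B \<subseteq> U \<and> open U}. emeasure M U) < ennreal (e * (q - p) / 4)"
    using outer_regular[OF sM fin B] \<open>e > 0\<close> \<open>p < q\<close> by simp
  then obtain U where U: "B \<subseteq> U" "open U" "emeasure M U < ennreal (e * (q - p) / 4)"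
    by (auto simp: INF_less_iff)
  define V where "V = U \<inter> ball 0 m"
  have V: "B \<subseteq> V" "open V" "emeasure M V < ennreal (e * (q - p) / 4)"
  proof -
    have "emeasure M V \<le> emeasure M U" using U by (intro emeasure_mono) (auto simp: V_def sM)
    then show "emeasure M V < ennreal (e * (q - p) / 4)" using U by (meson le_less_trans)
  qed (use U in \<open>auto simp: V_def B_def\<close>)
  \<comment> \<open>With \<rho> = 2 |h| the excess (q - p) |h| reads (q - p) / 2 * \<rho>. The
    length 2 \<rho> of such a ball is at most 4 / (q - p) times its mass under \<open>M\<close>,
    which explains the bound e (q - p) / 4 chosen for the mass of \<open>V\<close>.\<close>
  define K where "K = {(x::real, \<rho>::real). ball x \<rho> \<subseteq> V \<and> \<rho> > 0 \<and> (q - p) / 2 * \<rho> \<le> (LINT t:ball x \<rho>|lborel. g t)}"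
  have cov: "\<exists>i. i \<in> K \<and> x \<in> ball (fst i) (snd i) \<and> snd i < d" if x: "x \<in> S" and "d > 0" for x d
  proof -
    have "x \<in> V" using V x by (auto simp: B_def S_def)
    then obtain e' where e': "e' > 0" "ball x e' \<subseteq> V" using V(2) open_contains_ball by blast
    then have "min e' d / 2 > 0" using \<open>d > 0\<close> by auto
    then obtain h where h: "0 < \<bar>h\<bar>" "\<bar>h\<bar> < min e' d / 2" "(prim a (x + h) - prim a x) / h > q"
      using x unfolding S_def by blast
    have sub: "ball x (2 * \<bar>h\<bar>) \<subseteq> V" using e' h subset_ball[of "2 * \<bar>h\<bar>" e' x] by auto
    have "(q - p) * \<bar>h\<bar> \<le> (LINT t:ball x (2 * \<bar>h\<bar>)|lborel. g t)"
      by (rule difference_quotient_le_average[OF a _ h(3) \<open>p < q\<close> g g0]) (use h sub in \<open>auto simp: g_def V_def\<close>)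
    then have "(x, 2 * \<bar>h\<bar>) \<in> K" using sub h by (auto simp: K_def)
    then show ?thesis using h by (intro exI[of _ "(x, 2 * \<bar>h\<bar>)"]) auto
  qed
  obtain C where C: "countable C" "C \<subseteq> K"
     "pairwise (\<lambda>i j. disjnt (ball (fst i) (snd i)) (ball (fst j) (snd j))) C"
     "negligible(S - (\<Union>i \<in> C. ball (fst i) (snd i)))"
    by (rule Vitali_covering_theorem_balls[OF cov])
  define W where "W = (\<Union>i \<in> C. ball (fst i) (snd i))"
  have disj: "disjoint_family_on (\<lambda>i. ball (fst i) (snd i)) C"
    using C(3) by (auto simp: disjoint_family_on_def pairwise_def disjnt_def)
  have "emeasure lborel W = (\<integral>\<^sup>+ i. emeasure lborel (ball (fst i) (snd i)) \<partial>count_space C)"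
    unfolding W_def by (rule emeasure_UN_countable[OF _ C(1) disj]) auto
  also have "\<dots> \<le> (\<integral>\<^sup>+ i. ennreal (4 / (q - p)) * emeasure M (ball (fst i) (snd i)) \<partial>count_space C)"
  proof (rule nn_integral_mono)
    fix i assume "i \<in> space (count_space C)"
    then have i: "i \<in> K" using C by auto
    obtain x \<rho> where ix: "i = (x,\<rho>)" by force
    have \<rho>: "\<rho> > 0" and *: "(q - p) / 2 * \<rho> \<le> (LINT t:ball x \<rho>|lborel. g t)" using i ix by (auto simp: K_def)
    have "ball x \<rho> = {x - \<rho><..<x+\<rho>}" by (auto simp: dist_real_def)
    then have "emeasure lborel (ball x \<rho>) = ennreal (2 * \<rho>)" using \<rho> by simp
    also have "\<dots> \<le> ennreal (4 / (q - p) * (LINT t:ball x \<rho>|lborel. g t))"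
      using * \<open>p < q\<close> by (intro ennreal_leI) (simp add: field_simps)
    also have "\<dots> = ennreal (4 / (q - p)) * emeasure M (ball x \<rho>)"
      using \<open>p < q\<close> by (subst eM) (auto simp flip: ennreal_mult')
    finally show "emeasure lborel (ball (fst i) (snd i)) \<le> ennreal (4 / (q - p)) * emeasure M (ball (fst i) (snd i))"
      by (simp add: ix)
  qed
  also have "\<dots> = ennreal (4 / (q - p)) * (\<integral>\<^sup>+ i. emeasure M (ball (fst i) (snd i)) \<partial>count_space C)"
    by (rule nn_integral_cmult) auto
  also have "(\<integral>\<^sup>+ i. emeasure M (ball (fst i) (snd i)) \<partial>count_space C) = emeasure M W"
    unfolding W_def by (rule emeasure_UN_countable[OF _ C(1) disj, symmetric]) (auto simp: sM)
  also have "emeasure M W \<le> emeasure M V"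
  proof (rule emeasure_mono)
    have "ball (fst i) (snd i) \<subseteq> V" if "i \<in> C" for i
    proof -
      have "i \<in> K" using that C(2) by auto
      then show ?thesis by (simp add: K_def case_prod_beta)
    qed
    then show "W \<subseteq> V" by (auto simp: W_def)
  qed (use V(2) sM in auto)
  also have "\<dots> \<le> ennreal (e * (q - p) / 4)" using V(3) by simp
  finally have W: "emeasure lborel W \<le> ennreal e" using \<open>p < q\<close> \<open>e > 0\<close>
    by (simp add: ennreal_mult'[symmetric] mult_left_mono)
  have oW: "open W" by (auto simp: W_def)
  have Wl: "W \<in> lmeasurable" using W oW
    by (auto simp: fmeasurable_def intro: le_less_trans)
  have mW: "measure lebesgue W \<le> e" using W oW \<open>e > 0\<close>
    by (simp add: measure_def enn2real_leI)
  have neg: "negligible (S - W)" using C(4) by (simp add: W_def)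
  show "\<exists>T. S \<subseteq> T \<and> T \<in> lmeasurable \<and> measure lebesgue T \<le> e"
  proof (intro exI conjI)
    show "W \<union> (S - W) \<in> lmeasurable" by (rule fmeasurable.Un[OF Wl negligible_imp_measurable[OF neg]])
    have "measure lebesgue (W \<union> (S - W)) \<le> measure lebesgue W + measure lebesgue (S - W)"
      using Wl neg by (intro measure_Un_le) (auto simp: negligible_imp_sets)
    then show "measure lebesgue (W \<union> (S - W)) \<le> e"
      using mW neg by (simp add: negligible_imp_measure0)
  qed auto
qed
  then show ?thesis by (simp add: S_def)
qed

text \<open>For one pair of levels and one ball the exceptional set is negligible. Rational levels
  squeezed between \<open>a x\<close> and \<open>q\<close> reduce all levels to countably many such
  sets.\<close>

lemma AE_upper_quotient_le:
  assumes a: "integrable lborel a"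
  shows "AE x in lborel. \<forall>q>a x. \<exists>d>0. \<forall>h. 0 < \<bar>h\<bar> \<and> \<bar>h\<bar> < d \<longrightarrow> (prim a (x + h) - prim a x) / h \<le> q"
proof -
  let ?S = "\<lambda>p q m. {x \<in> ball 0 (real m). a x < p \<and>
     (\<forall>d>0. \<exists>h. 0 < \<bar>h\<bar> \<and> \<bar>h\<bar> < d \<and> (prim a (x + h) - prim a x) / h > q)}"
  have "AE x in lebesgue. \<forall>p\<in>\<rat>. \<forall>q\<in>\<rat>. \<forall>m. p < q \<longrightarrow> x \<notin> ?S p q m"
  proof -
    have 1: "AE x in lebesgue. p < q \<longrightarrow> x \<notin> ?S p q m" for p q m
    proof (cases "p < q")
      case True
      then have "?S p q m \<in> null_sets lebesgue"
        using negligible_large_upper_quotient[OF a True] by (simp add: negligible_iff_null_sets)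
      then show ?thesis by (auto dest!: AE_not_in)
    qed auto
    show ?thesis
      using 1 countable_rat by (intro AE_ball_countable[THEN iffD2] ballI AE_all_countable[THEN iffD2] allI) auto
  qed
  then have "AE x in lborel. \<forall>p\<in>\<rat>. \<forall>q\<in>\<rat>. \<forall>m. p < q \<longrightarrow> x \<notin> ?S p q m"
    by (simp add: AE_completion_iff)
  then show ?thesis
  proof (rule AE_mp, intro AE_I2 impI allI)
    fix x q assume S: "\<forall>p\<in>\<rat>. \<forall>q\<in>\<rat>. \<forall>m. p < q \<longrightarrow> x \<notin> ?S p q m" and "a x < q"
    obtain p where p: "p \<in> \<rat>" "a x < p" "p < q" using Rats_dense_in_real \<open>a x < q\<close> by blast
    obtain q' where q': "q' \<in> \<rat>" "p < q'" "q' < q" using Rats_dense_in_real \<open>p < q\<close> by blast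
    obtain m :: nat where m: "\<bar>x\<bar> < m" using reals_Archimedean2 by blast
    have "x \<notin> ?S p q' m" using S p q' by blast
    then obtain d where "d > 0" "\<And>h. 0 < \<bar>h\<bar> \<Longrightarrow> \<bar>h\<bar> < d \<Longrightarrow> (prim a (x + h) - prim a x) / h \<le> q'"
      using p m by (auto simp: not_less) (metis not_less)
    then show "\<exists>d>0. \<forall>h. 0 < \<bar>h\<bar> \<and> \<bar>h\<bar> < d \<longrightarrow> (prim a (x + h) - prim a x) / h \<le> q"
      using q' by (meson less_imp_le order_trans)
  qed
qed

text \<open>The upper bound for difference quotients, applied to \<open>a\<close> and to
  \<open>- a\<close>, confines the quotient from both sides.\<close>

theorem lebesgue_differentiation_real:
  assumes a: "integrable lborel a"
  shows "AE x in lborel. (prim a has_real_derivative a x) (at x)"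
proof -
  have m: "prim (\<lambda>x. - a x) y = - prim a y" for y
    unfolding prim_def set_lebesgue_integral_def by simp
  have "AE x in lborel. (\<forall>q>a x. \<exists>d>0. \<forall>h. 0 < \<bar>h\<bar> \<and> \<bar>h\<bar> < d \<longrightarrow> (prim a (x + h) - prim a x) / h \<le> q) \<and>
     (\<forall>q>- a x. \<exists>d>0. \<forall>h. 0 < \<bar>h\<bar> \<and> \<bar>h\<bar> < d \<longrightarrow> (prim (\<lambda>x. - a x) (x + h) - prim (\<lambda>x. - a x) x) / h \<le> q)"
    using AE_upper_quotient_le[OF a] AE_upper_quotient_le[of "\<lambda>x. - a x"] a by auto
  then show ?thesis
  proof (rule AE_mp, intro AE_I2 impI)
    fix x assume *: "(\<forall>q>a x. \<exists>d>0. \<forall>h. 0 < \<bar>h\<bar> \<and> \<bar>h\<bar> < d \<longrightarrow> (prim a (x + h) - prim a x) / h \<le> q) \<and>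
     (\<forall>q>- a x. \<exists>d>0. \<forall>h. 0 < \<bar>h\<bar> \<and> \<bar>h\<bar> < d \<longrightarrow> (prim (\<lambda>x. - a x) (x + h) - prim (\<lambda>x. - a x) x) / h \<le> q)"
    show "(prim a has_real_derivative a x) (at x)"
      unfolding DERIV_def LIM_eq
    proof (intro allI impI)
      fix r :: real assume "r > 0"
      obtain d1 where d1: "d1 > 0" "\<And>h. 0 < \<bar>h\<bar> \<Longrightarrow> \<bar>h\<bar> < d1 \<Longrightarrow> (prim a (x + h) - prim a x) / h \<le> a x + r/2"
        using *[THEN conjunct1, rule_format, of "a x + r/2"] \<open>r > 0\<close> by auto
      obtain d2 where d2: "d2 > 0" "\<And>h. 0 < \<bar>h\<bar> \<Longrightarrow> \<bar>h\<bar> < d2 \<Longrightarrow> (prim (\<lambda>x. - a x) (x + h) - prim (\<lambda>x. - a x) x) / h \<le> - a x + r/2"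
        using *[THEN conjunct2, rule_format, of "- a x + r/2"] \<open>r > 0\<close> by auto
      have "norm ((prim a (x + h) - prim a x) / h - a x) < r" if "h \<noteq> 0" "\<bar>h\<bar> < min d1 d2" for h
      proof -
        have "(prim (\<lambda>x. - a x) (x + h) - prim (\<lambda>x. - a x) x) / h = - ((prim a (x + h) - prim a x) / h)"
          by (simp add: m field_simps) (use that in \<open>simp add: field_simps\<close>)?
        then show ?thesis using d1(2)[of h] d2(2)[of h] that \<open>r > 0\<close> by (auto simp: abs_less_iff)
      qed
      then show "\<exists>s>0. \<forall>h. h \<noteq> 0 \<and> norm (h - 0) < s \<longrightarrow> norm ((prim a (x + h) - prim a x) / h - a x) < r"
        using d1(1) d2(1) by (intro exI[of _ "min d1 d2"]) auto
    qed
  qed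
qed

section \<open>Integration by parts and monotonicity for primitives\<close>

lemma prim_eq_integral_if: "prim a y = (LINT x|lborel. (if x \<le> y then a x else 0))"
  unfolding prim_def set_lebesgue_integral_def by (intro Bochner_Integration.integral_cong) (auto simp: indicator_def)

lemma borel_measurable_prim[measurable]:
  assumes [measurable]: "a \<in> borel_measurable borel"
  shows "prim a \<in> borel_measurable borel"
proof -
  have "prim a = (\<lambda>y. LINT x|lborel. (if x \<le> y then a x else 0))"
    by (rule ext) (rule prim_eq_integral_if)
  also have "\<dots> \<in> borel_measurable borel"
    by measurable
  finally show ?thesis .
qed

lemma abs_prim_le:
  assumes "integrable lborel a"
  shows "\<bar>prim a y\<bar> \<le> (LINT x|lborel. \<bar>a x\<bar>)"
proof -
  have "\<bar>prim a y\<bar> \<le> (LINT x|lborel. \<bar>if x \<le> y then a x else 0\<bar>)"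
    unfolding prim_eq_integral_if by (rule integral_abs_bound)
  also have "\<dots> \<le> (LINT x|lborel. \<bar>a x\<bar>)"
    using assms by (intro Bochner_Integration.integral_mono' integrable_abs) auto
  finally show ?thesis .
qed

lemma set_integrable_continuous_mult:
  fixes \<alpha> a :: "real \<Rightarrow> real"
  assumes a: "integrable lborel a" and c: "continuous_on {s..t} \<alpha>"
  shows "set_integrable lborel {s..t} (\<lambda>x. \<alpha> x * a x)"
proof -
  have "bounded (\<alpha> ` {s..t})" using c by (intro compact_imp_bounded compact_continuous_image) auto
  then obtain B where B: "\<And>x. x \<in> {s..t} \<Longrightarrow> \<bar>\<alpha> x\<bar> \<le> B" unfolding bounded_iff by fastforce
  have m: "(\<lambda>x. indicator {s..t} x *\<^sub>R \<alpha> x) \<in> borel_measurable borel"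
    by (rule borel_measurable_continuous_on_indicator[OF _ c]) auto
  have am[measurable]: "a \<in> borel_measurable borel" using a by auto
  show ?thesis unfolding set_integrable_def
  proof (rule Bochner_Integration.integrable_bound)
    show "integrable lborel (\<lambda>x. B * a x)" using a by simp
    have "(\<lambda>x. (indicator {s..t} x *\<^sub>R \<alpha> x) * a x) \<in> borel_measurable borel"
      using m am by (rule borel_measurable_times)
    then show "(\<lambda>x. indicator {s..t} x *\<^sub>R (\<alpha> x * a x)) \<in> borel_measurable lborel" by (simp add: mult.assoc)
    show "AE x in lborel. norm (indicator {s..t} x *\<^sub>R (\<alpha> x * a x)) \<le> norm (B * a x)"
      using B by (intro AE_I2) (auto simp: indicator_def abs_mult intro!: mult_right_mono intro: order_trans[OF _ abs_ge_self])
  qed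
qed

lemma set_integrable_continuous_mult_prim:
  assumes a: "integrable lborel a" and c: "continuous_on {s..t} \<alpha>"
  shows "set_integrable lborel {s..t} (\<lambda>x. \<alpha> x * prim a x)"
proof -
  have am[measurable]: "a \<in> borel_measurable borel" using a by auto
  have "integrable lborel (\<lambda>x. indicator {s..t} x * prim a x)"
  proof (rule Bochner_Integration.integrable_bound)
    show "integrable lborel (\<lambda>x. (LINT x|lborel. \<bar>a x\<bar>) * indicator {s..t} x)"
      by (intro integrable_mult_right integrable_real_indicator) (auto simp: emeasure_lborel_Icc_eq)
    show "AE x in lborel. norm (indicator {s..t} x * prim a x) \<le> norm ((LINT x|lborel. \<bar>a x\<bar>) * indicator {s..t} x)"
      using abs_prim_le[OF a] by (intro AE_I2) (auto simp: indicator_def)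
  qed measurable
  from set_integrable_continuous_mult[OF this c]
  show ?thesis unfolding set_integrable_def
    by (rule Bochner_Integration.integrable_cong[THEN iffD1, rotated 2]) (auto simp: indicator_def)
qed

text \<open>Only \<alpha> is differentiated classically. The integral of
  \<open>\<alpha>' * prim a\<close> is a double integral over the triangle \<open>x \<le> y\<close>;
  after Fubini the inner integral of \<open>\<alpha>'\<close> is evaluated by the fundamental
  theorem.\<close>

lemma prim_by_parts:
  assumes a: "integrable lborel a" and "s \<le> t"
    and D: "\<And>x. x \<in> {s..t} \<Longrightarrow> (\<alpha> has_real_derivative \<alpha>' x) (at x)"
    and c: "continuous_on {s..t} \<alpha>'"
  shows "\<alpha> t * prim a t - \<alpha> s * prim a s = (LINT x:{s..t}|lborel. \<alpha> x * a x + \<alpha>' x * prim a x)"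
proof -
  have am[measurable]: "a \<in> borel_measurable borel" using a by auto
  have c\<alpha>: "continuous_on {s..t} \<alpha>" using D by (intro continuous_at_imp_continuous_on ballI DERIV_isCont) auto
  define b where "b = (\<lambda>y. indicator {s..t} y *\<^sub>R \<alpha>' y)"
  have b: "integrable lborel b" unfolding b_def using c by (intro borel_integrable_compact) auto
  have bm[measurable]: "b \<in> borel_measurable borel" using b by auto
  \<comment> \<open>\<open>b\<close> vanishes below \<open>s\<close>, so for \<open>x < s\<close>
    the integration effectively starts at \<open>s\<close>. These \<open>x\<close> produce the
    boundary term at \<open>s\<close>.\<close>
  have ftc: "(LINT y|lborel. (if x \<le> y then b y else 0)) = \<alpha> t - \<alpha> (max s x)" if "x \<le> t" for x
  proof -
    have "(LINT y|lborel. (if x \<le> y then b y else 0)) = (LINT y|lborel. indicator {max s x..t} y *\<^sub>R \<alpha>' y)"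
      by (intro Bochner_Integration.integral_cong) (auto simp: b_def indicator_def)
    also have "\<dots> = \<alpha> t - \<alpha> (max s x)"
    proof (rule integral_FTC_Icc)
      show "max s x \<le> t" using that \<open>s \<le> t\<close> by simp
      show "continuous_on {max s x..t} \<alpha>'" by (rule continuous_on_subset[OF c]) auto
      show "(\<alpha> has_vector_derivative \<alpha>' y) (at y within {max s x..t})" if "max s x \<le> y" "y \<le> t" for y
        using D[of y] that
        by (auto simp: has_real_derivative_iff_has_vector_derivative intro: has_vector_derivative_at_within)
    qed
    finally show ?thesis .
  qed
  have ftc0: "(if x \<le> y then b y else 0) = 0" if "x > t" for x y using that by (auto simp: b_def)
  have int: "integrable (lborel \<Otimes>\<^sub>M lborel) (\<lambda>(x, y). if x \<le> y then a x * b y else 0)"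
  proof (rule Bochner_Integration.integrable_bound)
    show "integrable (lborel \<Otimes>\<^sub>M lborel) (\<lambda>(x, y). a x * b y)"
    proof (rule lborel_pair.Fubini_integrable)
      show "integrable lborel (\<lambda>x. LINT y|lborel. norm (case (x, y) of (x, y) \<Rightarrow> a x * b y))"
        using a by (simp add: abs_mult)
    qed (use b in auto)
    show "(\<lambda>(x, y). if x \<le> y then a x * b y else 0) \<in> borel_measurable (lborel \<Otimes>\<^sub>M lborel)" by measurable
  qed auto
  have "(LINT y|lborel. b y * prim a y) = (LINT y|lborel. (LINT x|lborel. (if x \<le> y then a x * b y else 0)))"
    unfolding prim_eq_integral_if integral_mult_right_zero[symmetric]
    by (intro Bochner_Integration.integral_cong refl) auto
  also have "\<dots> = (LINT x|lborel. (LINT y|lborel. (if x \<le> y then a x * b y else 0)))"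
    using lborel_pair.Fubini_integral[OF int] by simp
  also have "\<dots> = (LINT x|lborel. a x * (LINT y|lborel. (if x \<le> y then b y else 0)))"
    unfolding integral_mult_right_zero[symmetric]
    by (intro Bochner_Integration.integral_cong refl) auto
  \<comment> \<open>The conditions \<open>x \<le> s\<close> and \<open>x \<in> {s..t}\<close>
    overlap in the point \<open>s\<close>; the term with the indicator of \<open>{s}\<close> removes
    the double count.\<close>
  also have "\<dots> = (LINT x|lborel. (if x \<le> t then a x else 0) * \<alpha> t
      - ((if x \<le> s then a x else 0) * \<alpha> s + (indicator {s..t} x *\<^sub>R (\<alpha> x * a x) - indicator {s} x * (\<alpha> s * a s))))"
  proof (intro Bochner_Integration.integral_cong refl)
    fix x
    show "a x * (LINT y|lborel. (if x \<le> y then b y else 0)) = (if x \<le> t then a x else 0) * \<alpha> t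
      - ((if x \<le> s then a x else 0) * \<alpha> s + (indicator {s..t} x *\<^sub>R (\<alpha> x * a x) - indicator {s} x * (\<alpha> s * a s)))"
    proof (cases "x \<le> t")
      case True
      then show ?thesis using \<open>s \<le> t\<close> by (auto simp: ftc indicator_def algebra_simps max_def)
    next
      case False
      then show ?thesis using ftc0[of x] \<open>s \<le> t\<close> by (simp add: indicator_def)
    qed
  qed
  also have "\<dots> = prim a t * \<alpha> t - (prim a s * \<alpha> s + ((LINT x:{s..t}|lborel. \<alpha> x * a x) - 0))"
  proof -
    have i1: "integrable lborel (\<lambda>x. (if x \<le> y then a x else 0) * z)" for y z
    proof -
      have "(\<lambda>x. if x \<le> y then a x else 0) = (\<lambda>x. indicator {..y} x *\<^sub>R a x)" by (auto simp: indicator_def)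
      then have "integrable lborel (\<lambda>x. if x \<le> y then a x else 0)"
        using set_integrable_of_integrable[OF a, of "{..y}"] by (simp only: set_integrable_def) simp
      then show ?thesis by (rule integrable_mult_left)
    qed
    have i2: "integrable lborel (\<lambda>x. indicator {s..t} x *\<^sub>R (\<alpha> x * a x))"
      using set_integrable_continuous_mult[OF a c\<alpha>] unfolding set_integrable_def .
    have i3: "integrable lborel (\<lambda>x. indicator {s} x * (\<alpha> s * a s))"
      by (intro integrable_mult_left integrable_real_indicator) auto
    show ?thesis
      using i1 i2 i3 by (simp add: prim_eq_integral_if set_lebesgue_integral_def)
  qed
  finally have "(LINT x:{s..t}|lborel. \<alpha>' x * prim a x) = prim a t * \<alpha> t - prim a s * \<alpha> s - (LINT x:{s..t}|lborel. \<alpha> x * a x)"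
    by (simp add: set_lebesgue_integral_def b_def mult.assoc)
  moreover have "(LINT x:{s..t}|lborel. \<alpha> x * a x + \<alpha>' x * prim a x) =
     (LINT x:{s..t}|lborel. \<alpha> x * a x) + (LINT x:{s..t}|lborel. \<alpha>' x * prim a x)"
    by (intro set_integral_add set_integrable_continuous_mult set_integrable_continuous_mult_prim a c\<alpha> c)
  ultimately show ?thesis by (simp add: mult.commute)
qed

text \<open>A nonnegative derivative almost everywhere does not imply monotonicity in general. For
  this combination it does, because the increment is the integral of the derivative. The form covers
  both the boundary functional and the frequency.\<close>

lemma mono_on_prim_combination:
  assumes a: "integrable lborel a"
    and \<alpha>: "\<And>x. x \<in> {u<..<v} \<Longrightarrow> (\<alpha> has_real_derivative \<alpha>' x) (at x)" "continuous_on {u<..<v} \<alpha>'"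
    and \<beta>: "\<And>x. x \<in> {u<..<v} \<Longrightarrow> (\<beta> has_real_derivative \<beta>' x) (at x)" "continuous_on {u<..<v} \<beta>'"
    and pos: "AE x in lborel. x \<in> {u<..<v} \<longrightarrow> \<alpha> x * a x + \<alpha>' x * prim a x + \<beta>' x \<ge> 0"
  shows "mono_on {u<..<v} (\<lambda>x. \<alpha> x * prim a x + \<beta> x)"
proof (rule mono_onI)
  fix s t assume st: "s \<in> {u<..<v}" "t \<in> {u<..<v}" "s \<le> t"
  then have sub: "{s..t} \<subseteq> {u<..<v}" by auto
  have "continuous_on {s..t} \<alpha>"
    using sub by (intro continuous_at_imp_continuous_on ballI DERIV_isCont[OF \<alpha>(1)]) auto
  note c = continuous_on_subset[OF \<alpha>(2) sub] continuous_on_subset[OF \<beta>(2) sub] this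
  have "\<beta> t - \<beta> s = (LINT x:{s..t}|lborel. \<beta>' x)"
    unfolding set_lebesgue_integral_def
  proof (rule integral_FTC_Icc[symmetric, OF \<open>s \<le> t\<close> _ c(2)])
    fix x assume "s \<le> x" "x \<le> t"
    then have "(\<beta> has_real_derivative \<beta>' x) (at x)" using \<beta>(1) sub by auto
    then show "(\<beta> has_vector_derivative \<beta>' x) (at x within {s..t})"
      by (simp add: has_real_derivative_iff_has_vector_derivative has_vector_derivative_at_within)
  qed
  moreover have "\<alpha> t * prim a t - \<alpha> s * prim a s = (LINT x:{s..t}|lborel. \<alpha> x * a x + \<alpha>' x * prim a x)"
    by (rule prim_by_parts[OF a \<open>s \<le> t\<close> _ c(1)]) (use \<alpha>(1) sub in auto)
  moreover have "(LINT x:{s..t}|lborel. (\<alpha> x * a x + \<alpha>' x * prim a x) + \<beta>' x) =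
     (LINT x:{s..t}|lborel. \<alpha> x * a x + \<alpha>' x * prim a x) + (LINT x:{s..t}|lborel. \<beta>' x)"
  proof (rule set_integral_add(2))
    show "set_integrable lborel {s..t} (\<lambda>x. \<alpha> x * a x + \<alpha>' x * prim a x)"
      by (rule set_integral_add(1)[OF set_integrable_continuous_mult[OF a c(3)] set_integrable_continuous_mult_prim[OF a c(1)]])
    show "set_integrable lborel {s..t} \<beta>'"
      unfolding set_integrable_def using c(2) by (intro borel_integrable_compact) auto
  qed
  moreover have "(LINT x:{s..t}|lborel. (\<alpha> x * a x + \<alpha>' x * prim a x) + \<beta>' x) \<ge> 0"
    unfolding set_lebesgue_integral_def
  proof (rule integral_nonneg_AE)
    show "AE x in lborel. 0 \<le> indicat_real {s..t} x *\<^sub>R (\<alpha> x * a x + \<alpha>' x * prim a x + \<beta>' x)"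
      using pos by eventually_elim (use sub in \<open>auto simp: indicator_def\<close>)
  qed
  ultimately show "\<alpha> s * prim a s + \<beta> s \<le> \<alpha> t * prim a t + \<beta> t" by linarith
qed

section \<open>Continuously differentiable test functions\<close>

text \<open>Continuity of the derivative is required direction by direction, in the manner of
  \<open>C1c_scalar\<close>, which avoids a topology on linear maps; in finite dimension the two
  notions agree.\<close>

definition C1_fun :: "('a::euclidean_space \<Rightarrow> real) \<Rightarrow> bool" where
  "C1_fun f \<longleftrightarrow> (\<exists>D. (\<forall>x. (f has_derivative D x) (at x)) \<and> (\<forall>h. continuous_on UNIV (\<lambda>x. D x h)))"

lemma C1_fun_continuous: "C1_fun f \<Longrightarrow> continuous_on UNIV f"
  unfolding C1_fun_def by (meson continuous_at_imp_continuous_on has_derivative_continuous)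

lemma C1_fun_const: "C1_fun (\<lambda>x. c)"
  unfolding C1_fun_def by (rule exI[of _ "\<lambda>x h. 0"]) auto

lemma C1_fun_mult:
  assumes "C1_fun f" "C1_fun g"
  shows "C1_fun (\<lambda>x. f x * g x)"
proof -
  obtain D E where D: "\<And>x. (f has_derivative D x) (at x)" "\<And>h. continuous_on UNIV (\<lambda>x. D x h)"
    and E: "\<And>x. (g has_derivative E x) (at x)" "\<And>h. continuous_on UNIV (\<lambda>x. E x h)"
    using assms unfolding C1_fun_def by blast
  show ?thesis unfolding C1_fun_def
    using C1_fun_continuous[OF assms(1)] C1_fun_continuous[OF assms(2)]
    by (intro exI[of _ "\<lambda>x h. f x * E x h + D x h * g x"] conjI allI has_derivative_mult D E continuous_intros)
qed

lemma C1_fun_compose: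
  assumes "C1_fun f" "\<And>t. (\<phi> has_real_derivative \<phi>' t) (at t)" "continuous_on UNIV \<phi>'"
  shows "C1_fun (\<lambda>x. \<phi> (f x))"
proof -
  obtain D where D: "\<And>x. (f has_derivative D x) (at x)" "\<And>h. continuous_on UNIV (\<lambda>x. D x h)"
    using assms unfolding C1_fun_def by blast
  have "((\<lambda>x. \<phi> (f x)) has_derivative (\<lambda>h. \<phi>' (f x) * D x h)) (at x)" for x
    using has_derivative_compose[OF D(1)[of x], of \<phi> "\<lambda>h. \<phi>' (f x) * h"] assms(2)[of "f x"]
    by (simp add: has_field_derivative_def)
  then show ?thesis unfolding C1_fun_def
    using continuous_on_compose2[OF assms(3) C1_fun_continuous[OF assms(1)]] D(2)
    by (intro exI[of _ "\<lambda>x h. \<phi>' (f x) * D x h"] conjI allI continuous_on_mult) auto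
qed

lemma C1_fun_inner_affine: "C1_fun (\<lambda>x. c * (x \<bullet> b) + d)"
  unfolding C1_fun_def
  by (rule exI[of _ "\<lambda>x h. c * (h \<bullet> b)"]) (auto intro!: derivative_eq_intros)

lemma C1_fun_prod:
  assumes "finite A" "\<And>i. i \<in> A \<Longrightarrow> C1_fun (f i)"
  shows "C1_fun (\<lambda>x. \<Prod>i\<in>A. f i x)"
  using assms by (induction A rule: finite_induct) (auto intro: C1_fun_const C1_fun_mult)

text \<open>Squaring removes the kink of the positive part at 0. This is the one-dimensional
  building block of the bump functions on boxes and of the truncation near the free
  boundary.\<close>

lemma DERIV_max_0_squared:
  "((\<lambda>t. (max 0 t)\<^sup>2) has_real_derivative 2 * max 0 t) (at t)" for t :: real
proof (cases "t = 0")
  case True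
  have "((\<lambda>h. (max 0 (0 + h))\<^sup>2 / h) \<longlongrightarrow> 0) (at (0::real))"
  proof (rule Lim_null_comparison)
    show "\<forall>\<^sub>F h::real in at 0. norm ((max 0 (0 + h))\<^sup>2 / h) \<le> \<bar>h\<bar>"
      by (auto simp: eventually_at power2_eq_square max_def intro!: exI[of _ 1])
    show "((\<lambda>h::real. \<bar>h\<bar>) \<longlongrightarrow> 0) (at 0)" by (auto intro!: tendsto_eq_intros)
  qed
  then show ?thesis using True by (simp add: DERIV_def)
next
  case False
  show ?thesis
  proof (cases "t > 0")
    case True
    have "((\<lambda>t. t\<^sup>2) has_real_derivative 2 * max 0 t) (at t)"
      using True by (auto intro!: derivative_eq_intros)
    then show ?thesis
      by (rule has_field_derivative_transform_within_open[where S="{0<..}"]) (use True in auto)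
  next
    case False
    with \<open>t \<noteq> 0\<close> have "t < 0" by simp
    have "((\<lambda>t. 0) has_real_derivative 2 * max 0 t) (at t)"
      using \<open>t < 0\<close> by (auto intro!: derivative_eq_intros)
    then show ?thesis
      by (rule has_field_derivative_transform_within_open[where S="{..<0}"]) (use \<open>t < 0\<close> in auto)
  qed
qed

section \<open>Bump functions on boxes and the fundamental lemma of the calculus of
  variations\<close>

lemma exists_C1_fun_box: "\<exists>p. C1_fun p \<and> {x. p x \<noteq> 0} = box l (u :: 'a::euclidean_space)"
proof -
  define p where "p x = (\<Prod>b\<in>Basis. (max 0 (1 * (x \<bullet> b) + - (l \<bullet> b)))\<^sup>2 * (max 0 (-1 * (x \<bullet> b) + u \<bullet> b))\<^sup>2)" for x
  have "C1_fun p" unfolding p_def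
    by (intro C1_fun_prod C1_fun_mult C1_fun_compose[OF C1_fun_inner_affine DERIV_max_0_squared] finite_Basis continuous_intros)
  moreover have "p x \<noteq> 0 \<longleftrightarrow> x \<in> box l u" for x
    unfolding p_def mem_box prod_zero_iff[OF finite_Basis] by (auto simp: max_def)
  ultimately show ?thesis by auto
qed

text \<open>The profile is 0 at 0, takes values in [0, 1), and tends to 1 elsewhere as
  \<open>m\<close> grows. Applied to a bump it approximates the indicator of the open box from
  inside by admissible test functions.\<close>

lemma smooth_saturation:
  assumes "C1_fun p"
  shows "C1_fun (\<lambda>x. real m * (p x)\<^sup>2 / (1 + real m * (p x)\<^sup>2))"
proof (rule C1_fun_compose[OF assms, where \<phi>' = "\<lambda>t. 2 * real m * t / (1 + real m * t\<^sup>2)\<^sup>2"])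
  have *: "1 + real m * t\<^sup>2 > 0" for t :: real by (intro add_pos_nonneg) auto
  then have ne: "1 + real m * t\<^sup>2 \<noteq> 0" for t by (metis less_irrefl)
  show "((\<lambda>t. real m * t\<^sup>2 / (1 + real m * t\<^sup>2)) has_real_derivative 2 * real m * t / (1 + real m * t\<^sup>2)\<^sup>2) (at t)" for t
    using ne[of t] by (auto intro!: derivative_eq_intros simp: power2_eq_square algebra_simps)
  show "continuous_on UNIV (\<lambda>t. 2 * real m * t / (1 + real m * t\<^sup>2)\<^sup>2)"
    using ne by (intro continuous_intros) auto
qed

lemma integral_box_eq_0:
  fixes f :: "'a::euclidean_space \<Rightarrow> real"
  assumes fm[measurable]: "f \<in> borel_measurable borel" and fi: "set_integrable lborel (cbox c d) f"
    and test: "\<And>\<psi>. C1_fun \<psi> \<Longrightarrow> (\<And>x. x \<notin> cbox c d \<Longrightarrow> \<psi> x = 0) \<Longrightarrow> (LINT x|lborel. f x * \<psi> x) = 0"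
    and sub: "box l u \<subseteq> cbox c d"
  shows "(LINT x:box l u|lborel. f x) = 0"
proof -
  obtain p where p: "C1_fun p" "{x. p x \<noteq> 0} = box l u" using exists_C1_fun_box by blast
  define \<psi> where "\<psi> = (\<lambda>m x. real m * (p x)\<^sup>2 / (1 + real m * (p x)\<^sup>2))"
  have C1: "C1_fun (\<psi> m)" for m unfolding \<psi>_def using smooth_saturation[OF p(1)] .
  have z: "\<psi> m x = 0" if "x \<notin> box l u" for m x using p(2) that by (auto simp: \<psi>_def)
  have b: "0 \<le> \<psi> m x" "\<psi> m x \<le> 1" for m x
  proof -
    have "1 + real m * (p x)\<^sup>2 > 0" by (intro add_pos_nonneg) auto
    then show "0 \<le> \<psi> m x" "\<psi> m x \<le> 1" by (auto simp: \<psi>_def divide_le_eq)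
  qed
  have "(\<lambda>m. LINT x|lborel. f x * \<psi> m x) \<longlonglongrightarrow> (LINT x|lborel. indicator (box l u) x *\<^sub>R f x)"
  proof (rule integral_dominated_convergence)
    show "integrable lborel (\<lambda>x. indicator (cbox c d) x *\<^sub>R \<bar>f x\<bar>)"
      using set_integrable_abs[OF fi] by (simp add: set_integrable_def)
    show "(\<lambda>x. f x * \<psi> m x) \<in> borel_measurable lborel" for m
      using borel_measurable_continuous_onI[OF C1_fun_continuous[OF C1[of m]]] by simp
    show "AE x in lborel. norm (f x * \<psi> m x) \<le> indicator (cbox c d) x *\<^sub>R \<bar>f x\<bar>" for m
    proof (rule AE_I2)
      fix x show "norm (f x * \<psi> m x) \<le> indicator (cbox c d) x *\<^sub>R \<bar>f x\<bar>"
        using z[of x m] b[of m x] sub by (cases "x \<in> box l u") (auto simp: abs_mult mult_left_le subset_iff)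
    qed
    show "AE x in lborel. (\<lambda>m. f x * \<psi> m x) \<longlonglongrightarrow> indicator (box l u) x *\<^sub>R f x"
    proof (rule AE_I2)
      fix x
      show "(\<lambda>m. f x * \<psi> m x) \<longlonglongrightarrow> indicator (box l u) x *\<^sub>R f x"
      proof (cases "x \<in> box l u")
        case True
        then have px: "p x \<noteq> 0" using p(2) by auto
        have eq: "\<psi> m x = 1 - 1 / (1 + real m * (p x)\<^sup>2)" for m
        proof -
          have "1 + real m * (p x)\<^sup>2 > 0" by (intro add_pos_nonneg) auto
          then show ?thesis by (simp add: \<psi>_def field_simps)
        qed
        have "filterlim (\<lambda>m. 1 + real m * (p x)\<^sup>2) at_top sequentially"
          using px by (intro filterlim_tendsto_add_at_top[OF tendsto_const]
            filterlim_at_top_mult_tendsto_pos[OF tendsto_const] filterlim_real_sequentially) auto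
        then have "(\<lambda>m. 1 / (1 + real m * (p x)\<^sup>2)) \<longlonglongrightarrow> 0"
          by (intro tendsto_divide_0[OF tendsto_const] filterlim_at_top_imp_at_infinity)
        then have "(\<lambda>m. f x * \<psi> m x) \<longlonglongrightarrow> f x * (1 - 0)"
          unfolding eq by (intro tendsto_intros)
        then show ?thesis using True by simp
      qed (simp add: z)
    qed
  qed simp
  moreover have "(LINT x|lborel. f x * \<psi> m x) = 0" for m
    using test[OF C1[of m]] z sub by blast
  ultimately show ?thesis unfolding set_lebesgue_integral_def
    by (simp add: LIMSEQ_const_iff)
qed

text \<open>Integrals over boxes vanish, and boxes form an intersection-stable generator of the
  Borel sets. Hence the integral over every Borel set vanishes, and a density is determined by these
  integrals up to a null set.\<close>

lemma AE_eq_0_on_box: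
  fixes f :: "'a::euclidean_space \<Rightarrow> real"
  assumes fm[measurable]: "f \<in> borel_measurable borel" and fi: "set_integrable lborel (cbox c d) f"
    and test: "\<And>\<psi>. C1_fun \<psi> \<Longrightarrow> (\<And>x. x \<notin> cbox c d \<Longrightarrow> \<psi> x = 0) \<Longrightarrow> (LINT x|lborel. f x * \<psi> x) = 0"
  shows "AE x in lborel. x \<in> box c d \<longrightarrow> f x = 0"
proof -
  define g where "g = (\<lambda>x. indicator (box c d) x * f x)"
  have g: "integrable lborel g"
    unfolding g_def using set_integrable_subset[OF fi, of "box c d"] by (simp add: set_integrable_def box_subset_cbox)
  have gs: "set_integrable lborel A g" if "A \<in> sets borel" for A
    using g that by (intro set_integrable_of_integrable) auto
  have I0: "(LINT x:box l u|lborel. g x) = 0" for l u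
  proof -
    obtain l' u' where lu: "box l u \<inter> box c d = box l' u'" unfolding box_Int_box by blast
    have "(LINT x:box l u|lborel. g x) = (LINT x:box l' u'|lborel. f x)"
      unfolding set_lebesgue_integral_def g_def lu[symmetric]
      by (intro Bochner_Integration.integral_cong) (auto simp: indicator_def)
    also have "\<dots> = 0"
      by (rule integral_box_eq_0[OF fm fi test]) (use lu box_subset_cbox[of c d] in auto)
    finally show ?thesis .
  qed
  have Ig: "(LINT x|lborel. g x) = 0"
  proof -
    have "(LINT x|lborel. g x) = (LINT x:box c d|lborel. g x)"
      unfolding set_lebesgue_integral_def g_def
      by (intro Bochner_Integration.integral_cong) (auto simp: indicator_def)
    then show ?thesis by (simp add: I0)
  qed
  have "(LINT x:A|lborel. g x) = 0" if "A \<in> sets borel" for A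
  proof -
    let ?E = "range (\<lambda>(a, b). box a b :: 'a set)"
    have "Int_stable ?E" 
    proof (rule Int_stableI)
      fix A B assume "A \<in> ?E" "B \<in> ?E"
      then obtain a b a' b' where "A = box a b" "B = box a' b'" by auto
      then show "A \<inter> B \<in> ?E" by (auto simp: box_Int_box)
    qed
    moreover have "?E \<subseteq> Pow UNIV" by auto
    moreover have "A \<in> sigma_sets UNIV ?E" using that by (simp add: borel_eq_box)
    ultimately show ?thesis
    proof (induction rule: sigma_sets_induct_disjoint)
      case (basic A)
      then show ?case using I0 by auto
    next
      case empty
      then show ?case by (simp add: set_lebesgue_integral_def)
    next
      case (compl A)
      then have A: "A \<in> sets borel" by (simp add: borel_eq_box)
      have "(LINT x:A \<union> (UNIV - A)|lborel. g x) = (LINT x:A|lborel. g x) + (LINT x:UNIV - A|lborel. g x)"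
        using A by (intro set_integral_Un gs) auto
      then show ?case using compl Ig by (simp add: set_lebesgue_integral_def)
    next
      case (union A)
      have A: "A i \<in> sets borel" for i using union(2) by (auto simp: borel_eq_box)
      have "(LINT x:(\<Union>i. A i)|lborel. g x) = (\<Sum>i. LINT x:A i|lborel. g x)"
        using A union(1) by (intro lebesgue_integral_countable_add gs) (auto simp: disjoint_family_on_def)
      then show ?case using union(3) by simp
    qed
  qed
  then have "AE x in lborel. g x = (\<lambda>x. 0) x"
    by (intro density_unique_real[OF g]) (auto simp: set_lebesgue_integral_def)
  then show ?thesis by eventually_elim (auto simp: g_def indicator_def)
qed

text \<open>An open set is a countable union of closed boxes contained in it, and the boundary of a
  box is null, so the statement for open boxes suffices.\<close>

lemma fundamental_lemma_calculus_of_variations: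
  fixes f :: "'a::euclidean_space \<Rightarrow> real"
  assumes S: "open S" and fm: "f \<in> borel_measurable borel"
    and fi: "\<And>K. compact K \<Longrightarrow> K \<subseteq> S \<Longrightarrow> set_integrable lborel K f"
    and test: "\<And>\<psi> K. C1_fun \<psi> \<Longrightarrow> compact K \<Longrightarrow> K \<subseteq> S \<Longrightarrow> (\<And>x. x \<notin> K \<Longrightarrow> \<psi> x = 0) \<Longrightarrow> (LINT x|lborel. f x * \<psi> x) = 0"
  shows "AE x in lborel. x \<in> S \<longrightarrow> f x = 0"
proof -
  obtain \<D> where D: "countable \<D>" "\<D> \<subseteq> Pow S" "\<And>X. X \<in> \<D> \<Longrightarrow> \<exists>a b. X = cbox a b" "\<Union>\<D> = S"
    using open_countable_Union_open_cbox[OF S] by metis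
  have "AE x in lborel. \<forall>X\<in>\<D>. x \<in> X \<longrightarrow> f x = 0"
  proof (rule AE_ball_countable[THEN iffD2, OF D(1)], rule ballI)
    fix X assume X: "X \<in> \<D>"
    then obtain a b where ab: "X = cbox a b" using D by blast
    then have sub: "cbox a b \<subseteq> S" using X D by auto
    have "AE x in lborel. x \<in> box a b \<longrightarrow> f x = 0"
      by (rule AE_eq_0_on_box[OF fm fi[OF compact_cbox sub] test[OF _ compact_cbox sub]]) auto
    moreover have "AE x in lborel. x \<notin> cbox a b - box a b"
    proof -
      have "AE x in lebesgue. x \<notin> cbox a b - box a b"
        using negligible_frontier_interval[of a b] unfolding negligible_iff_null_sets by (rule AE_not_in)
      then show ?thesis unfolding AE_completion_iff .
    qed
    ultimately show "AE x in lborel. x \<in> X \<longrightarrow> f x = 0"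
      by eventually_elim (auto simp: ab)
  qed
  then show ?thesis by eventually_elim (use D(4) in auto)
qed

section \<open>Integrals of directional derivatives\<close>

lemma integral_translate_lborel:
  fixes f :: "'a::euclidean_space \<Rightarrow> real"
  assumes "f \<in> borel_measurable borel"
  shows "(LINT x|lborel. f (x + c)) = (LINT x|lborel. f x)"
proof -
  have "(LINT x|lborel. f x) = (LINT x|distr lborel borel ((+) c). f x)" by (simp add: lborel_distr_plus)
  also have "\<dots> = (LINT x|lborel. f (c + x))" using assms by (subst integral_distr) auto
  finally show ?thesis by (simp add: add.commute)
qed

lemma integrable_continuous_compact_support:
  fixes f :: "'a::euclidean_space \<Rightarrow> real"
  assumes "continuous_on UNIV f" "compact K" "\<And>x. x \<notin> K \<Longrightarrow> f x = 0"
  shows "integrable lborel f"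
proof -
  have "integrable lborel (\<lambda>x. indicator K x *\<^sub>R f x)"
    using assms by (intro borel_integrable_compact) (auto intro: continuous_on_subset)
  moreover have "(\<lambda>x. indicator K x *\<^sub>R f x) = f" 
  proof
    fix x show "indicator K x *\<^sub>R f x = f x" using assms(3)[of x] by (cases "x \<in> K") auto
  qed
  ultimately show ?thesis by simp
qed

text \<open>By translation invariance the integral of every difference quotient of \<open>f\<close>
  is zero, and dominated convergence passes this on to the derivative.\<close>

lemma integral_directional_derivative_eq_0_global:
  fixes f :: "'a::euclidean_space \<Rightarrow> real"
  assumes K: "compact K" and f0: "\<And>x. x \<notin> K \<Longrightarrow> f x = 0"
    and D: "\<And>x. (f has_derivative D x) (at x)" and c: "continuous_on UNIV (\<lambda>x. D x h)"
  shows "(LINT x|lborel. D x h) = 0"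
proof -
  have cf: "continuous_on UNIV f" using D by (meson continuous_at_imp_continuous_on has_derivative_continuous)
  have D0: "D x h = 0" if "x \<notin> K" for x
  proof -
    have "((\<lambda>x. 0) has_derivative D x) (at x)"
      by (rule has_derivative_transform_within_open[OF D, of "- K"]) (use that f0 K in \<open>auto simp: compact_imp_closed\<close>)
    then have "D x = (\<lambda>h. 0)" by (rule has_derivative_unique) simp
    then show ?thesis by simp
  qed
  have "bounded ((\<lambda>x. D x h) ` K)"
    using c K by (intro compact_imp_bounded compact_continuous_image) (auto intro: continuous_on_subset)
  then obtain B where "\<forall>y \<in> (\<lambda>x. D x h) ` K. norm y \<le> B" unfolding bounded_iff by blast
  then have BK: "\<bar>D x h\<bar> \<le> max B 0" for x using D0[of x] by (cases "x \<in> K") force+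
  define B' where "B' = max B 0"
  have B: "\<bar>D x h\<bar> \<le> B'" for x using BK by (simp add: B'_def)
  obtain \<rho> where \<rho>: "\<And>x. x \<in> K \<Longrightarrow> norm x \<le> \<rho>" using K compact_imp_bounded bounded_iff by metis
  have deriv: "((\<lambda>s. f (x + s *\<^sub>R h)) has_real_derivative D (x + s *\<^sub>R h) h) (at s)" for x s
  proof -
    have "((\<lambda>s. x + s *\<^sub>R h) has_derivative (\<lambda>s. s *\<^sub>R h)) (at s)" by (auto intro!: derivative_eq_intros)
    from has_derivative_compose[OF this D]
    have "((\<lambda>s. f (x + s *\<^sub>R h)) has_derivative (\<lambda>t. D (x + s *\<^sub>R h) (t *\<^sub>R h))) (at s)" .
    moreover have "D (x + s *\<^sub>R h) (t *\<^sub>R h) = D (x + s *\<^sub>R h) h * t" for t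
      using linear_cmul[OF has_derivative_linear[OF D]] by simp
    ultimately show ?thesis by (simp add: has_field_derivative_def)
  qed
  define t where "t = (\<lambda>n. 1 / real (Suc n))"
  have t: "t n > 0" "t n \<le> 1" for n by (auto simp: t_def)
  have tlim: "t \<longlonglongrightarrow> 0" unfolding t_def using LIMSEQ_Suc[OF lim_1_over_n] by simp
  have int: "integrable lborel f" by (rule integrable_continuous_compact_support[OF cf K f0])
  have fm[measurable]: "f \<in> borel_measurable borel" using cf by (rule borel_measurable_continuous_onI)
  have "(\<lambda>n. LINT x|lborel. (f (x + t n *\<^sub>R h) - f x) / t n) \<longlonglongrightarrow> (LINT x|lborel. D x h)"
  proof (rule integral_dominated_convergence)
    show "(\<lambda>x. D x h) \<in> borel_measurable lborel" using borel_measurable_continuous_onI[OF c] by simp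
    \<comment> \<open>The step lengths are at most 1, so for \<open>norm x > \<rho> + norm h\<close>
      neither \<open>x\<close> nor \<open>x + t n *\<^sub>R h\<close> lies in
      \<open>K\<close>.\<close>
    show "integrable lborel (\<lambda>x. B' * indicator (cball 0 (\<rho> + norm h)) x)"
      by (intro integrable_mult_right integrable_real_indicator) (auto intro: emeasure_lborel_cball_finite[unfolded infinity_ennreal_def])
    show "AE x in lborel. norm ((f (x + t n *\<^sub>R h) - f x) / t n) \<le> B' * indicator (cball 0 (\<rho> + norm h)) x" for n
    proof (rule AE_I2)
      fix x
      show "norm ((f (x + t n *\<^sub>R h) - f x) / t n) \<le> B' * indicator (cball 0 (\<rho> + norm h)) x"
      proof (cases "x \<in> cball 0 (\<rho> + norm h)")
        case True
        obtain z where "f (x + t n *\<^sub>R h) - f (x + 0 *\<^sub>R h) = (t n - 0) * D (x + z *\<^sub>R h) h"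
          using MVT2[OF t(1)[of n] deriv[of x]] by blast
        then have "(f (x + t n *\<^sub>R h) - f x) / t n = D (x + z *\<^sub>R h) h" using t(1)[of n] by simp
        then show ?thesis using True B by simp
      next
        case False
        then have "norm x > \<rho> + norm h" by simp
        moreover have "norm (t n *\<^sub>R h) \<le> norm h" using t[of n] by (simp add: mult_left_le_one_le)
        moreover have "norm x \<le> norm (x + t n *\<^sub>R h) + norm (t n *\<^sub>R h)"
          by (metis add_diff_cancel_right' norm_triangle_ineq4)
        ultimately have "norm x > \<rho>" "norm (x + t n *\<^sub>R h) > \<rho>" using norm_ge_zero[of h] by linarith+
        then have "f x = 0" "f (x + t n *\<^sub>R h) = 0" using \<rho> f0 by (meson not_le)+
        then show ?thesis using False by simp
      qed
    qed
    show "AE x in lborel. (\<lambda>n. (f (x + t n *\<^sub>R h) - f x) / t n) \<longlonglongrightarrow> D x h"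
    proof (rule AE_I2)
      fix x
      have "((\<lambda>s. (f (x + s *\<^sub>R h) - f x) / s) \<longlongrightarrow> D x h) (at 0)"
        using deriv[of x 0] by (simp add: DERIV_def)
      moreover have "filterlim t (at 0) sequentially"
        using tlim t by (auto simp: filterlim_at intro!: always_eventually) (metis less_irrefl)
      ultimately show "(\<lambda>n. (f (x + t n *\<^sub>R h) - f x) / t n) \<longlonglongrightarrow> D x h"
        by (rule filterlim_compose)
    qed
  qed measurable
  moreover have "(LINT x|lborel. (f (x + t n *\<^sub>R h) - f x) / t n) = 0" for n
  proof -
    have i2: "integrable lborel (\<lambda>x. f (x + t n *\<^sub>R h))"
    proof -
      have "integrable (distr lborel borel ((+) (t n *\<^sub>R h))) f" using int by (simp add: lborel_distr_plus)
      from integrable_distr[OF _ this] show ?thesis by (simp add: add.commute)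
    qed
    show ?thesis using i2 int integral_translate_lborel[OF fm, of "t n *\<^sub>R h"] by simp
  qed
  ultimately have "(\<lambda>n. 0) \<longlonglongrightarrow> (LINT x|lborel. D x h)" by (simp only:)
  then show ?thesis by (simp add: LIMSEQ_const_iff)
qed

text \<open>Later \<open>f\<close> is built from \<open>u\<close> and its gradient and is
  differentiable on the positivity set only. Its extension by zero is differentiable everywhere,
  because the open sets \<open>S\<close> and \<open>- K\<close> cover the space.\<close>

lemma integral_directional_derivative_eq_0:
  fixes f :: "'a::euclidean_space \<Rightarrow> real"
  assumes S: "open S" and K: "compact K" "K \<subseteq> S" and f0: "\<And>x. x \<in> S \<Longrightarrow> x \<notin> K \<Longrightarrow> f x = 0"
    and D: "\<And>x. x \<in> S \<Longrightarrow> (f has_derivative D x) (at x)" and c: "continuous_on S (\<lambda>x. D x h)"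
  shows "set_integrable lborel S (\<lambda>x. D x h)" "(LINT x:S|lborel. D x h) = 0"
proof -
  define F where "F x = (if x \<in> S then f x else 0)" for x
  define G where "G x v = (if x \<in> S then D x v else 0)" for x v
  have F0: "F x = 0" if "x \<notin> K" for x using that f0 by (auto simp: F_def)
  have oK: "open (- K)" using K compact_imp_closed by blast
  have z: "((\<lambda>x. 0) has_derivative (\<lambda>v. 0)) (at x)" for x :: 'a by simp
  have G0: "G x = (\<lambda>v. 0)" if "x \<notin> K" for x
  proof (cases "x \<in> S")
    case True
    have "((\<lambda>x. 0) has_derivative D x) (at x)"
      by (rule has_derivative_transform_within_open[OF D[OF True], of "S - K"])
         (use that f0 S K True in \<open>auto simp: compact_imp_closed open_Diff\<close>)
    then have "D x = (\<lambda>h. 0)" by (rule has_derivative_unique) simp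
    then show ?thesis by (auto simp: G_def)
  qed (auto simp: G_def)
  have dF: "(F has_derivative G x) (at x)" for x
  proof (cases "x \<in> S")
    case True
    have "(F has_derivative D x) (at x)"
      by (rule has_derivative_transform_within_open[OF D[OF True] S]) (use True in \<open>auto simp: F_def\<close>)
    moreover have "G x = D x" using True by (auto simp: G_def)
    ultimately show ?thesis by simp
  next
    case False
    then have "x \<notin> K" using K by auto
    have "(F has_derivative (\<lambda>v. 0)) (at x)"
      by (rule has_derivative_transform_within_open[OF z oK]) (use \<open>x \<notin> K\<close> F0 in auto)
    then show ?thesis using G0[OF \<open>x \<notin> K\<close>] by simp
  qed
  have "continuous_on (S \<union> - K) (\<lambda>x. G x h)"
  proof (rule continuous_on_open_Un[OF S oK])
    show "continuous_on S (\<lambda>x. G x h)" using c by (rule continuous_on_eq) (auto simp: G_def)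
    show "continuous_on (- K) (\<lambda>x. G x h)" using continuous_on_const[of "-K" 0] by (rule continuous_on_eq) (auto simp: G0)
  qed
  moreover have "S \<union> - K = UNIV" using K by auto
  ultimately have cG: "continuous_on UNIV (\<lambda>x. G x h)" by simp
  have eq: "(\<lambda>x. indicator S x *\<^sub>R D x h) = (\<lambda>x. G x h)" by (auto simp: G_def indicator_def)
  show "(LINT x:S|lborel. D x h) = 0"
    unfolding set_lebesgue_integral_def eq
    by (rule integral_directional_derivative_eq_0_global[OF K(1) _ dF cG]) (rule F0)
  show "set_integrable lborel S (\<lambda>x. D x h)"
    unfolding set_integrable_def eq by (rule integrable_continuous_compact_support[OF cG K(1)]) (simp add: G0)
qed

section \<open>Symmetry of second derivatives\<close>

lemma second_difference_mean_value:
  fixes f :: "'a::real_inner \<Rightarrow> real"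
  assumes D: "\<And>y. y \<in> ball x \<epsilon> \<Longrightarrow> (f has_derivative (\<lambda>h. g y \<bullet> h)) (at y)"
    and E: "\<And>y. y \<in> ball x \<epsilon> \<Longrightarrow> (g has_derivative H y) (at y)"
    and ab: "norm a \<le> 1" "norm b \<le> 1" and t: "t > 0" "2 * t < \<epsilon>"
  shows "\<exists>y. dist x y \<le> 2 * t \<and> f (x + t *\<^sub>R a + t *\<^sub>R b) - f (x + t *\<^sub>R a) - f (x + t *\<^sub>R b) + f x = t\<^sup>2 * (H y b \<bullet> a)"
proof -
  have dist: "dist x (x + s *\<^sub>R a + r *\<^sub>R b) \<le> 2 * t" if "0 \<le> s" "s \<le> t" "0 \<le> r" "r \<le> t" for s r
  proof -
    have "norm (s *\<^sub>R a + r *\<^sub>R b) \<le> s * norm a + r * norm b"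
      using norm_triangle_ineq[of "s *\<^sub>R a" "r *\<^sub>R b"] that by simp
    also have "\<dots> \<le> t * 1 + t * 1" using that ab t by (intro add_mono mult_mono) auto
    finally have "norm (s *\<^sub>R a + r *\<^sub>R b) \<le> 2 * t" by simp
    moreover have "x - (x + s *\<^sub>R a + r *\<^sub>R b) = - (s *\<^sub>R a + r *\<^sub>R b)" by simp
    ultimately show ?thesis unfolding dist_norm by (simp only: norm_minus_cancel)
  qed
  have inb: "x + s *\<^sub>R a + r *\<^sub>R b \<in> ball x \<epsilon>" if "0 \<le> s" "s \<le> t" "0 \<le> r" "r \<le> t" for s r
    using dist[OF that] t by simp
  define \<phi> where "\<phi> s = f (x + s *\<^sub>R a + t *\<^sub>R b) - f (x + s *\<^sub>R a + 0 *\<^sub>R b)" for s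
  have df: "((\<lambda>s. f (x + s *\<^sub>R a + r *\<^sub>R b)) has_real_derivative g (x + s *\<^sub>R a + r *\<^sub>R b) \<bullet> a) (at s)"
    if "0 \<le> s" "s \<le> t" "0 \<le> r" "r \<le> t" for s r
  proof -
    have "((\<lambda>s. x + s *\<^sub>R a + r *\<^sub>R b) has_derivative (\<lambda>h. h *\<^sub>R a)) (at s)" by (auto intro!: derivative_eq_intros)
    from has_derivative_compose[OF this D[OF inb[OF that]]] show ?thesis
      unfolding has_field_derivative_def by (rule has_derivative_eq_rhs) (auto simp: fun_eq_iff)
  qed
  have d\<phi>: "(\<phi> has_real_derivative (g (x + s *\<^sub>R a + t *\<^sub>R b) - g (x + s *\<^sub>R a + 0 *\<^sub>R b)) \<bullet> a) (at s)" if "0 \<le> s" "s \<le> t" for s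
    unfolding \<phi>_def inner_diff_left using that t by (intro DERIV_diff df) auto
  obtain s where s: "0 < s" "s < t" "\<phi> t - \<phi> 0 = (t - 0) * ((g (x + s *\<^sub>R a + t *\<^sub>R b) - g (x + s *\<^sub>R a + 0 *\<^sub>R b)) \<bullet> a)"
    using MVT2[OF t(1) d\<phi>] by blast
  have dg: "((\<lambda>r. g (x + s *\<^sub>R a + r *\<^sub>R b) \<bullet> a) has_real_derivative H (x + s *\<^sub>R a + r *\<^sub>R b) b \<bullet> a) (at r)" if "0 \<le> r" "r \<le> t" for r
  proof -
    have i: "x + s *\<^sub>R a + r *\<^sub>R b \<in> ball x \<epsilon>" using inb s that by simp
    have "((\<lambda>r. x + s *\<^sub>R a + r *\<^sub>R b) has_derivative (\<lambda>h. h *\<^sub>R b)) (at r)" by (auto intro!: derivative_eq_intros)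
    from has_derivative_inner_left[OF has_derivative_compose[OF this E[OF i]], of a]
    show ?thesis unfolding has_field_derivative_def
      by (rule has_derivative_eq_rhs) (simp add: fun_eq_iff linear_cmul[OF has_derivative_linear[OF E[OF i]]])
  qed
  obtain r where r: "0 < r" "r < t"
    "g (x + s *\<^sub>R a + t *\<^sub>R b) \<bullet> a - g (x + s *\<^sub>R a + 0 *\<^sub>R b) \<bullet> a = (t - 0) * (H (x + s *\<^sub>R a + r *\<^sub>R b) b \<bullet> a)"
    using MVT2[OF t(1) dg] by blast
  show ?thesis
  proof (intro exI conjI)
    show "dist x (x + s *\<^sub>R a + r *\<^sub>R b) \<le> 2 * t" using dist s r by simp
    have "\<phi> t - \<phi> 0 = t\<^sup>2 * (H (x + s *\<^sub>R a + r *\<^sub>R b) b \<bullet> a)"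
      using s(3) r(3) by (simp add: inner_diff_left power2_eq_square)
    then show "f (x + t *\<^sub>R a + t *\<^sub>R b) - f (x + t *\<^sub>R a) - f (x + t *\<^sub>R b) + f x = t\<^sup>2 * (H (x + s *\<^sub>R a + r *\<^sub>R b) b \<bullet> a)"
      by (simp add: \<phi>_def)
  qed
qed

text \<open>The second difference does not change when \<open>a\<close> and \<open>b\<close> are
  exchanged, while two applications of the mean value theorem identify it with
  \<open>t\<^sup>2\<close> times either mixed derivative at a point near \<open>x\<close>.
  Continuity then compares the two at \<open>x\<close>.\<close>

lemma symmetric_second_derivative:
  fixes f :: "'a::real_inner \<Rightarrow> real"
  assumes S: "open S" "x \<in> S" and D: "\<And>y. y \<in> S \<Longrightarrow> (f has_derivative (\<lambda>h. g y \<bullet> h)) (at y)"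
    and E: "\<And>y. y \<in> S \<Longrightarrow> (g has_derivative H y) (at y)"
    and c: "continuous_on S (\<lambda>y. H y b \<bullet> a)" "continuous_on S (\<lambda>y. H y a \<bullet> b)"
    and ab: "norm a \<le> 1" "norm b \<le> 1"
  shows "H x b \<bullet> a = H x a \<bullet> b"
proof (rule ccontr)
  assume "H x b \<bullet> a \<noteq> H x a \<bullet> b"
  define e where "e = \<bar>H x b \<bullet> a - H x a \<bullet> b\<bar> / 2"
  have e: "e > 0" using \<open>H x b \<bullet> a \<noteq> H x a \<bullet> b\<close> by (simp add: e_def)
  obtain \<epsilon> where \<epsilon>: "\<epsilon> > 0" "ball x \<epsilon> \<subseteq> S" using S open_contains_ball by blast
  obtain d1 where d1: "d1 > 0" "\<And>y. y \<in> S \<Longrightarrow> dist y x < d1 \<Longrightarrow> dist (H y b \<bullet> a) (H x b \<bullet> a) < e"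
    using c(1) S(2) e unfolding continuous_on_iff by blast
  obtain d2 where d2: "d2 > 0" "\<And>y. y \<in> S \<Longrightarrow> dist y x < d2 \<Longrightarrow> dist (H y a \<bullet> b) (H x a \<bullet> b) < e"
    using c(2) S(2) e unfolding continuous_on_iff by blast
  define t where "t = min \<epsilon> (min d1 d2) / 4"
  have t: "t > 0" "2 * t < \<epsilon>" "2 * t < d1" "2 * t < d2" using \<epsilon> d1 d2 by (auto simp: t_def)
  have DD: "y \<in> ball x \<epsilon> \<Longrightarrow> (f has_derivative (\<lambda>h. g y \<bullet> h)) (at y)" 
   and EE: "y \<in> ball x \<epsilon> \<Longrightarrow> (g has_derivative H y) (at y)" for y using D E \<epsilon> by auto
  obtain y where y: "dist x y \<le> 2 * t" "f (x + t *\<^sub>R a + t *\<^sub>R b) - f (x + t *\<^sub>R a) - f (x + t *\<^sub>R b) + f x = t\<^sup>2 * (H y b \<bullet> a)"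
    using second_difference_mean_value[OF DD EE ab t(1,2)] by blast
  obtain z where z: "dist x z \<le> 2 * t" "f (x + t *\<^sub>R b + t *\<^sub>R a) - f (x + t *\<^sub>R b) - f (x + t *\<^sub>R a) + f x = t\<^sup>2 * (H z a \<bullet> b)"
    using second_difference_mean_value[OF DD EE ab(2,1) t(1,2)] by blast
  have "x + t *\<^sub>R b + t *\<^sub>R a = x + t *\<^sub>R a + t *\<^sub>R b" by simp
  then have "t\<^sup>2 * (H y b \<bullet> a) = t\<^sup>2 * (H z a \<bullet> b)" using y(2) z(2) by (simp only:)
  then have "H y b \<bullet> a = H z a \<bullet> b" using t(1) by simp
  moreover have "y \<in> S" "z \<in> S" using y(1) z(1) t(2) \<epsilon>(2) by auto
  ultimately have "\<bar>H z a \<bullet> b - H x b \<bullet> a\<bar> < e" "\<bar>H z a \<bullet> b - H x a \<bullet> b\<bar> < e"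
    using d1(2)[of y] d2(2)[of z] y(1) z(1) t by (auto simp: dist_real_def dist_commute)
  then have "\<bar>H x b \<bullet> a - H x a \<bullet> b\<bar> < 2 * e" by linarith
  then show False by (simp add: e_def)
qed

section \<open>Polar coordinates\<close>

text \<open>This is the \<open>t\<close>-integral left over in polar coordinates once the order of
  integration is exchanged; with \<open>c = norm x\<close> it cancels the weight
  \<open>norm x ^ n\<close>.\<close>

lemma nn_integral_inverse_power_tail:
  assumes "c > 0" "n > 0"
  shows "(\<integral>\<^sup>+ t. (if c < t then ennreal (real n / t ^ Suc n) else 0) \<partial>lborel) = ennreal (1 / c ^ n)"
proof -
  have "(\<integral>\<^sup>+ t. (if c < t then ennreal (real n / t ^ Suc n) else 0) \<partial>lborel)
      = (\<integral>\<^sup>+ t. ennreal (real n / t ^ Suc n) * indicator {c..} t \<partial>lborel)"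
  proof (rule nn_integral_cong_AE)
    have "AE t in lborel. t \<noteq> c" by (rule AE_lborel_singleton)
    then show "AE t in lborel. (if c < t then ennreal (real n / t ^ Suc n) else 0) = ennreal (real n / t ^ Suc n) * indicator {c..} t"
      by eventually_elim (auto simp: indicator_def)
  qed
  also have "\<dots> = ennreal (0 - (- (1 / c ^ n)))"
  proof (rule nn_integral_FTC_atLeast)
    show "((\<lambda>t. - (1 / t ^ n)) has_real_derivative real n / x ^ Suc n) (at x)" if "c \<le> x" for x
    proof -
      have "x > 0" using that assms by simp
      moreover have "x ^ n * x ^ n = x ^ Suc n * x ^ (n - 1)" using \<open>n > 0\<close> by (cases n) auto
      ultimately show ?thesis by (auto intro!: derivative_eq_intros simp: divide_simps)
    qed
    have "filterlim (\<lambda>t::real. t ^ n) at_top at_top" using \<open>n > 0\<close> by (intro filterlim_pow_at_top filterlim_ident) auto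
    then have "((\<lambda>t::real. 1 / t ^ n) \<longlongrightarrow> 0) at_top"
      by (intro tendsto_divide_0[OF tendsto_const] filterlim_at_top_imp_at_infinity)
    then show "((\<lambda>t::real. - (1 / t ^ n)) \<longlongrightarrow> 0) at_top" using tendsto_minus by fastforce
  qed (use assms in auto)
  finally show ?thesis by simp
qed

lemma nn_integral_lborel_scale:
  fixes g :: "'a::euclidean_space \<Rightarrow> ennreal"
  assumes [measurable]: "g \<in> borel_measurable borel" and t: "t > 0"
  shows "(\<integral>\<^sup>+ x. g x \<partial>lborel) = ennreal (t ^ DIM('a)) * (\<integral>\<^sup>+ z. g (c + t *\<^sub>R z) \<partial>lborel)"
  using t by (subst lborel_affine[of t c]) (auto simp: nn_integral_density nn_integral_distr nn_integral_cmult)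

text \<open>The substitutions \<open>r = t |z|\<close> and \<open>x = t z\<close> turn the left-hand side into the integral of
  \<open>f x |x|^n n / t^(n+1)\<close> over \<open>t > |x|\<close>.\<close>

lemma nn_integral_polar_0:
  fixes f :: "'a::euclidean_space \<Rightarrow> ennreal"
  assumes [measurable]: "f \<in> borel_measurable borel"
  shows "(\<integral>\<^sup>+ r. (\<integral>\<^sup>+ z. ennreal (indicator {0<..} r * (real DIM('a) * r ^ (DIM('a) - 1))) * indicator (ball 0 1) z * f ((r / norm z) *\<^sub>R z) \<partial>lborel) \<partial>lborel)
     = (\<integral>\<^sup>+ x. f x \<partial>lborel)"
proof -
  define n where "n = DIM('a)"
  have n: "n > 0" by (simp add: n_def)
  define w where "w r = indicator {0<..} r * (real n * r ^ (n - 1))" for r :: real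
  have w0: "w r \<ge> 0" for r by (auto simp: w_def indicator_def)
  have [measurable]: "w \<in> borel_measurable borel" unfolding w_def by measurable
  have [measurable]: "Measurable.pred borel (\<lambda>z::'a. z \<in> ball 0 1)" by simp
  have "(\<integral>\<^sup>+ r. (\<integral>\<^sup>+ z. ennreal (w r) * indicator (ball 0 1) z * f ((r / norm z) *\<^sub>R z) \<partial>lborel) \<partial>lborel)
      = (\<integral>\<^sup>+ z. (\<integral>\<^sup>+ r. ennreal (w r) * indicator (ball 0 1) z * f ((r / norm z) *\<^sub>R z) \<partial>lborel) \<partial>lborel)"
    by (rule lborel_pair.Fubini') measurable
  also have "\<dots> = (\<integral>\<^sup>+ z. (\<integral>\<^sup>+ t. ennreal (norm z * w (norm z * t)) * indicator (ball 0 1) z * f (t *\<^sub>R z) \<partial>lborel) \<partial>lborel)"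
  proof (rule nn_integral_cong_AE)
    have "AE z in lborel. z \<noteq> (0::'a)" by (rule AE_lborel_singleton)
    then show "AE z in lborel. (\<integral>\<^sup>+ r. ennreal (w r) * indicator (ball 0 1) z * f ((r / norm z) *\<^sub>R z) \<partial>lborel)
       = (\<integral>\<^sup>+ t. ennreal (norm z * w (norm z * t)) * indicator (ball 0 1) z * f (t *\<^sub>R z) \<partial>lborel)"
    proof eventually_elim
      fix z :: 'a assume z: "z \<noteq> 0"
      have "(\<integral>\<^sup>+ r. ennreal (w r) * indicator (ball 0 1) z * f ((r / norm z) *\<^sub>R z) \<partial>lborel)
         = ennreal \<bar>norm z\<bar> * (\<integral>\<^sup>+ t. ennreal (w (0 + norm z * t)) * indicator (ball 0 1) z * f (((0 + norm z * t) / norm z) *\<^sub>R z) \<partial>lborel)"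
        using z by (intro nn_integral_real_affine) auto
      also have "\<dots> = (\<integral>\<^sup>+ t. ennreal \<bar>norm z\<bar> * (ennreal (w (0 + norm z * t)) * indicator (ball 0 1) z * f (((0 + norm z * t) / norm z) *\<^sub>R z)) \<partial>lborel)"
        by (rule nn_integral_cmult[symmetric]) measurable
      also have "\<dots> = (\<integral>\<^sup>+ t. ennreal (norm z * w (norm z * t)) * indicator (ball 0 1) z * f (t *\<^sub>R z) \<partial>lborel)"
        using z w0 by (intro nn_integral_cong) (simp add: ennreal_mult' mult.assoc)
      finally show "(\<integral>\<^sup>+ r. ennreal (w r) * indicator (ball 0 1) z * f ((r / norm z) *\<^sub>R z) \<partial>lborel)
         = (\<integral>\<^sup>+ t. ennreal (norm z * w (norm z * t)) * indicator (ball 0 1) z * f (t *\<^sub>R z) \<partial>lborel)" .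
    qed
  qed
  also have "\<dots> = (\<integral>\<^sup>+ t. (\<integral>\<^sup>+ z. ennreal (norm z * w (norm z * t)) * indicator (ball 0 1) z * f (t *\<^sub>R z) \<partial>lborel) \<partial>lborel)"
    by (rule lborel_pair.Fubini') measurable
  also have "\<dots> = (\<integral>\<^sup>+ t. (\<integral>\<^sup>+ x. (if norm x < t then ennreal (real n / t ^ Suc n) else 0) * (ennreal (norm x ^ n) * f x) \<partial>lborel) \<partial>lborel)"
  proof (rule nn_integral_cong)
    fix t :: real
    show "(\<integral>\<^sup>+ z. ennreal (norm z * w (norm z * t)) * indicator (ball 0 1) z * f (t *\<^sub>R z) \<partial>lborel)
      = (\<integral>\<^sup>+ x. (if norm x < t then ennreal (real n / t ^ Suc n) else 0) * (ennreal (norm x ^ n) * f x) \<partial>lborel)"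
    proof (cases "t > 0")
      case False
      have z1: "norm z * w (norm z * t) = 0" for z :: 'a
        using False by (auto simp: w_def indicator_def mult_less_0_iff zero_less_mult_iff)
      have z2: "\<not> norm x < t" for x :: 'a using False by (meson le_less_trans norm_ge_zero)
      show ?thesis unfolding z1 using z2 by simp
    next
      case True
      have "(\<integral>\<^sup>+ x. (if norm x < t then ennreal (real n / t ^ Suc n) else 0) * (ennreal (norm x ^ n) * f x) \<partial>lborel)
         = ennreal (t ^ n) * (\<integral>\<^sup>+ z. (if norm (0 + t *\<^sub>R z) < t then ennreal (real n / t ^ Suc n) else 0) * (ennreal (norm (0 + t *\<^sub>R z) ^ n) * f (0 + t *\<^sub>R z)) \<partial>lborel)"
        unfolding n_def by (rule nn_integral_lborel_scale[OF _ True]) measurable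
      also have "\<dots> = (\<integral>\<^sup>+ z. ennreal (t ^ n) * ((if norm (0 + t *\<^sub>R z) < t then ennreal (real n / t ^ Suc n) else 0) * (ennreal (norm (0 + t *\<^sub>R z) ^ n) * f (0 + t *\<^sub>R z))) \<partial>lborel)"
        by (rule nn_integral_cmult[symmetric]) measurable
      also have "\<dots> = (\<integral>\<^sup>+ z. ennreal (norm z * w (norm z * t)) * indicator (ball 0 1) z * f (t *\<^sub>R z) \<partial>lborel)"
      proof (intro nn_integral_cong)
        fix z :: 'a
        show "ennreal (t ^ n) * ((if norm (0 + t *\<^sub>R z) < t then ennreal (real n / t ^ Suc n) else 0) * (ennreal (norm (0 + t *\<^sub>R z) ^ n) * f (0 + t *\<^sub>R z)))
          = ennreal (norm z * w (norm z * t)) * indicator (ball 0 1) z * f (t *\<^sub>R z)"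
        proof (cases "norm z < 1 \<and> z \<noteq> 0")
          case True
          have "t ^ n * (real n / t ^ Suc n) * norm (t *\<^sub>R z) ^ n = norm z * w (norm z * t)"
          proof -
            have "norm z * w (norm z * t) = real n * norm z ^ n * t ^ (n - 1)"
              using True \<open>t > 0\<close> n by (cases n) (auto simp: w_def power_mult_distrib)
            moreover have "t ^ n * (real n / t ^ Suc n) * norm (t *\<^sub>R z) ^ n = real n * norm z ^ n * t ^ (n - 1)"
              using \<open>t > 0\<close> n by (cases n) (auto simp: power_mult_distrib field_simps)
            ultimately show ?thesis by simp
          qed
          then have "ennreal (norm z * w (norm z * t)) = ennreal (t ^ n) * ennreal (real n / t ^ Suc n) * ennreal (norm (t *\<^sub>R z) ^ n)"
            using \<open>t > 0\<close> by (simp add: ennreal_mult'[symmetric] flip: power_Suc)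
          then show ?thesis using True \<open>t > 0\<close> by (simp add: mult.assoc)
        next
          case False
          then consider "z = 0" | "norm z \<ge> 1" by force
          then show ?thesis
          proof cases
            case 1
            then show ?thesis using n by (simp add: zero_power)
          next
            case 2
            then show ?thesis using \<open>t > 0\<close> by simp
          qed
        qed
      qed
      finally show ?thesis by simp
    qed
  qed
  also have "\<dots> = (\<integral>\<^sup>+ x. (\<integral>\<^sup>+ t. (if norm x < t then ennreal (real n / t ^ Suc n) else 0) * (ennreal (norm x ^ n) * f x) \<partial>lborel) \<partial>lborel)"
    by (rule lborel_pair.Fubini') measurable
  also have "\<dots> = (\<integral>\<^sup>+ x. f x \<partial>lborel)"
  proof (rule nn_integral_cong_AE)
    have "AE x in lborel. x \<noteq> (0::'a)" by (rule AE_lborel_singleton)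
    then show "AE x in lborel. (\<integral>\<^sup>+ t. (if norm x < t then ennreal (real n / t ^ Suc n) else 0) * (ennreal (norm x ^ n) * f x) \<partial>lborel) = f x"
    proof eventually_elim
      fix x :: 'a assume x: "x \<noteq> 0"
      have "(\<integral>\<^sup>+ t. (if norm x < t then ennreal (real n / t ^ Suc n) else 0) * (ennreal (norm x ^ n) * f x) \<partial>lborel)
        = (\<integral>\<^sup>+ t. (if norm x < t then ennreal (real n / t ^ Suc n) else 0) \<partial>lborel) * (ennreal (norm x ^ n) * f x)"
        by (rule nn_integral_multc) measurable
      also have "\<dots> = ennreal (1 / norm x ^ n) * (ennreal (norm x ^ n) * f x)"
        using x n by (subst nn_integral_inverse_power_tail) auto
      also have "\<dots> = ennreal (1 / norm x ^ n * norm x ^ n) * f x"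
        by (subst ennreal_mult') (auto simp: mult.assoc)
      also have "\<dots> = f x" using x by simp
      finally show "(\<integral>\<^sup>+ t. (if norm x < t then ennreal (real n / t ^ Suc n) else 0) * (ennreal (norm x ^ n) * f x) \<partial>lborel) = f x" .
    qed
  qed
  finally show ?thesis unfolding w_def n_def .
qed

lemma nn_integral_polar:
  fixes f :: "'a::euclidean_space \<Rightarrow> ennreal"
  assumes [measurable]: "f \<in> borel_measurable borel"
  shows "(\<integral>\<^sup>+ r. (\<integral>\<^sup>+ z. ennreal (indicator {0<..} r * (real DIM('a) * r ^ (DIM('a) - 1))) * indicator (ball 0 1) z * f (x0 + (r / norm z) *\<^sub>R z) \<partial>lborel) \<partial>lborel)
     = (\<integral>\<^sup>+ x. f x \<partial>lborel)"
proof -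
  have "(\<integral>\<^sup>+ x. f x \<partial>lborel) = (\<integral>\<^sup>+ x. f (x0 + x) \<partial>lborel)"
    using nn_integral_lborel_scale[of f 1 x0] by simp
  then show ?thesis using nn_integral_polar_0[of "\<lambda>x. f (x0 + x)"] by simp
qed

section \<open>Integrals over spheres\<close>

text \<open>A function that fails this has sphere integral 0 by default, so additivity of
  \<open>sphere_int\<close> needs it as a premise. For integrands involving \<open>Du\<close> it is
  available at almost every radius only.\<close>

definition sph_integrable :: "real^'n \<Rightarrow> real \<Rightarrow> (real^'n \<Rightarrow> real) \<Rightarrow> bool" where
  "sph_integrable x0 r f \<longleftrightarrow> set_integrable lborel (ball 0 1) (\<lambda>z. f (x0 + (r / norm z) *\<^sub>R z))"

text \<open>The definitions of the problem integrate against the completed measure, whereas the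
  proof works with \<open>lborel\<close> for the sake of Fubini. On Borel functions the two
  agree.\<close>

lemma set_lebesgue_integral_lebesgue_eq_lborel:
  fixes f :: "'a::euclidean_space \<Rightarrow> real"
  assumes [measurable]: "f \<in> borel_measurable borel" "A \<in> sets borel"
  shows "(LINT x:A|lebesgue. f x) = (LINT x:A|lborel. f x)"
  unfolding set_lebesgue_integral_def by (rule integral_completion) measurable

lemma set_integrable_lebesgue_eq_lborel:
  fixes f :: "'a::euclidean_space \<Rightarrow> real"
  assumes [measurable]: "f \<in> borel_measurable borel" "A \<in> sets borel"
  shows "set_integrable lebesgue A f \<longleftrightarrow> set_integrable lborel A f"
  unfolding set_integrable_def by (rule integrable_completion) measurable

lemma borel_measurable_radial_projection[measurable]:
  fixes f :: "real^'n \<Rightarrow> real"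
  assumes [measurable]: "f \<in> borel_measurable borel"
  shows "(\<lambda>z. f (x0 + (r / norm z) *\<^sub>R z)) \<in> borel_measurable borel"
  by measurable

lemma borel_measurable_radial_projection_indicator[measurable]:
  fixes f :: "real^'n \<Rightarrow> real"
  assumes "f \<in> borel_measurable borel"
  shows "(\<lambda>z. indicator (ball 0 1) z * f (x0 + (r / norm z) *\<^sub>R z)) \<in> borel_measurable borel"
  using assms by (intro borel_measurable_times borel_measurable_indicator borel_measurable_radial_projection) auto

lemma sphere_int_lborel:
  fixes f :: "real^'n \<Rightarrow> real"
  assumes [measurable]: "f \<in> borel_measurable borel"
  shows "sphere_int x0 r f = real CARD('n) * r ^ (CARD('n) - 1) * (LINT z:ball 0 1|lborel. f (x0 + (r / norm z) *\<^sub>R z))"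
  unfolding sphere_int_def by (subst set_lebesgue_integral_lebesgue_eq_lborel) auto

lemma polar_coordinates_integrable:
  fixes f :: "real^'n \<Rightarrow> real" and x0 :: "real^'n"
  assumes f: "integrable lborel f"
  defines "w \<equiv> \<lambda>r. indicator {0<..} r * (real CARD('n) * r ^ (CARD('n) - 1))"
  defines "G \<equiv> \<lambda>(r, z). w r * indicator (ball 0 1) z * f (x0 + (r / norm z) *\<^sub>R z)"
  shows "integrable (lborel \<Otimes>\<^sub>M lborel) G" "integral\<^sup>L (lborel \<Otimes>\<^sub>M lborel) G = (LINT x|lborel. f x)"
proof -
  have fm[measurable]: "f \<in> borel_measurable borel" using f by auto
  have [measurable]: "Measurable.pred borel (\<lambda>z::real^'n. z \<in> ball 0 1)" by simp
  have [measurable]: "w \<in> borel_measurable borel" unfolding w_def by measurable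
  have Gm[measurable]: "G \<in> borel_measurable (lborel \<Otimes>\<^sub>M lborel)" unfolding G_def by measurable
  have w0: "w r \<ge> 0" for r by (auto simp: w_def indicator_def)
  \<comment> \<open>Positive homogeneity of \<phi> lets the nonnegative weight be pulled out. The
    norm gives integrability; the identity and the negation give the positive and negative parts,
    since \<open>ennreal\<close> truncates at 0.\<close>
  have nn: "(\<integral>\<^sup>+ p. ennreal (\<phi> (G p)) \<partial>(lborel \<Otimes>\<^sub>M lborel)) = (\<integral>\<^sup>+ x. ennreal (\<phi> (f x)) \<partial>lborel)"
    if \<phi>: "\<phi> \<in> borel_measurable borel" "\<And>a b. a \<ge> 0 \<Longrightarrow> \<phi> (a * b) = a * \<phi> b" for \<phi> :: "real \<Rightarrow> real"
  proof -
    note \<phi>(1)[measurable]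
    have "(\<integral>\<^sup>+ p. ennreal (\<phi> (G p)) \<partial>(lborel \<Otimes>\<^sub>M lborel)) = (\<integral>\<^sup>+ r. (\<integral>\<^sup>+ z. ennreal (\<phi> (G (r, z))) \<partial>lborel) \<partial>lborel)"
      by (rule lborel.nn_integral_fst[symmetric]) measurable
    also have "\<dots> = (\<integral>\<^sup>+ r. (\<integral>\<^sup>+ z. ennreal (w r) * indicator (ball 0 1) z * ennreal (\<phi> (f (x0 + (r / norm z) *\<^sub>R z))) \<partial>lborel) \<partial>lborel)"
    proof (intro nn_integral_cong)
      fix r and z :: "real^'n"
      have "\<phi> (G (r, z)) = (w r * indicator (ball 0 1) z) * \<phi> (f (x0 + (r / norm z) *\<^sub>R z))"
        unfolding G_def prod.case by (rule \<phi>(2)) (simp add: w0)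
      moreover have "ennreal (indicator (ball 0 1) z) = indicator (ball 0 1) z" by (auto simp: indicator_def)
      ultimately show "ennreal (\<phi> (G (r, z))) = ennreal (w r) * indicator (ball 0 1) z * ennreal (\<phi> (f (x0 + (r / norm z) *\<^sub>R z)))"
        using w0[of r] by (simp add: ennreal_mult')
    qed
    also have "\<dots> = (\<integral>\<^sup>+ x. ennreal (\<phi> (f x)) \<partial>lborel)"
      using nn_integral_polar[of "\<lambda>x. ennreal (\<phi> (f x))" x0] by (simp add: w_def)
    finally show ?thesis .
  qed
  have "(\<integral>\<^sup>+ p. ennreal (norm (G p)) \<partial>(lborel \<Otimes>\<^sub>M lborel)) = (\<integral>\<^sup>+ x. ennreal (norm (f x)) \<partial>lborel)"
    by (rule nn) (auto simp: abs_mult)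
  then show int: "integrable (lborel \<Otimes>\<^sub>M lborel) G" using f by (auto simp: integrable_iff_bounded)
  show "integral\<^sup>L (lborel \<Otimes>\<^sub>M lborel) G = (LINT x|lborel. f x)"
    unfolding real_lebesgue_integral_def[OF int] real_lebesgue_integral_def[OF f]
    using nn[of "\<lambda>x. x"] nn[of "\<lambda>x. - x"] by simp
qed

lemma polar_coordinates:
  fixes f :: "real^'n \<Rightarrow> real"
  assumes f: "integrable lborel f"
  shows "AE r in lborel. r > 0 \<longrightarrow> sph_integrable x0 r f"
    and "set_integrable lborel {0<..} (\<lambda>r. sphere_int x0 r f)"
    and "(LINT x|lborel. f x) = (LINT r:{0<..}|lborel. sphere_int x0 r f)"
proof -
  define w where "w \<equiv> \<lambda>r::real. indicator {0<..} r * (real CARD('n) * r ^ (CARD('n) - 1))"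
  define G where "G \<equiv> \<lambda>(r, z). w r * indicator (ball 0 1) z * f (x0 + (r / norm z) *\<^sub>R z)"
  have G: "integrable (lborel \<Otimes>\<^sub>M lborel) G" "integral\<^sup>L (lborel \<Otimes>\<^sub>M lborel) G = (LINT x|lborel. f x)"
    unfolding G_def w_def by (rule polar_coordinates_integrable[OF f])+
  have fm[measurable]: "f \<in> borel_measurable borel" using f by auto
  have "AE r in lborel. integrable lborel (\<lambda>z. G (r, z))" by (rule lborel_pair.AE_integrable_fst'[OF G(1)])
  then show "AE r in lborel. r > 0 \<longrightarrow> sph_integrable x0 r f"
  proof eventually_elim
    fix r assume i: "integrable lborel (\<lambda>z. G (r, z))"
    show "r > 0 \<longrightarrow> sph_integrable x0 r f"
    proof
      assume "r > 0"
      then have w: "w r \<noteq> 0" by (simp add: w_def)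
      have "integrable lborel (\<lambda>z. (1 / w r) * G (r, z))" using i by simp
      moreover have "(\<lambda>z. (1 / w r) * G (r, z)) = (\<lambda>z. indicator (ball 0 1) z *\<^sub>R f (x0 + (r / norm z) *\<^sub>R z))"
        using w by (auto simp: G_def)
      ultimately show "sph_integrable x0 r f" by (simp add: sph_integrable_def set_integrable_def)
    qed
  qed
  have eq: "(LINT z|lborel. G (r, z)) = indicator {0<..} r *\<^sub>R sphere_int x0 r f" for r
    by (simp add: G_def w_def sphere_int_lborel set_lebesgue_integral_def mult.assoc)
  show "set_integrable lborel {0<..} (\<lambda>r. sphere_int x0 r f)"
    using lborel_pair.integrable_fst'[OF G(1)] by (simp only: eq set_integrable_def)
  show "(LINT x|lborel. f x) = (LINT r:{0<..}|lborel. sphere_int x0 r f)"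
    using lborel_pair.integral_fst'[OF G(1)] G(2) by (simp only: eq set_lebesgue_integral_def)
qed

text \<open>At \<open>z = 0\<close> division by zero sends the point to \<open>x0\<close>, off the
  sphere; this one point is null.\<close>

lemma AE_radial_projection_eq:
  fixes f g :: "real^'n \<Rightarrow> real"
  assumes "\<And>x. norm (x - x0) = r \<Longrightarrow> f x = g x" "r > 0"
  shows "AE z in lborel. f (x0 + (r / norm z) *\<^sub>R z) = g (x0 + (r / norm z) *\<^sub>R z)"
proof -
  have "AE z in lborel. z \<noteq> (0::real^'n)" by (rule AE_lborel_singleton)
  then show ?thesis by eventually_elim (use assms in auto)
qed

lemma sphere_int_cong:
  fixes f g :: "real^'n \<Rightarrow> real"
  assumes [measurable]: "f \<in> borel_measurable borel" "g \<in> borel_measurable borel"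
    and "\<And>x. norm (x - x0) = r \<Longrightarrow> f x = g x" "r > 0"
  shows "sphere_int x0 r f = sphere_int x0 r g"
proof -
  have ae: "AE z in lborel. f (x0 + (r / norm z) *\<^sub>R z) = g (x0 + (r / norm z) *\<^sub>R z)"
    by (rule AE_radial_projection_eq[OF assms(3,4)])
  have "(LINT z:ball 0 1|lborel. f (x0 + (r / norm z) *\<^sub>R z)) = (LINT z:ball 0 1|lborel. g (x0 + (r / norm z) *\<^sub>R z))"
    unfolding set_lebesgue_integral_def
    by (rule integral_cong_AE) (use ae in \<open>auto elim: eventually_mono\<close>)
  then show ?thesis by (simp add: sphere_int_lborel)
qed

lemma sph_integrable_cong:
  fixes f g :: "real^'n \<Rightarrow> real"
  assumes [measurable]: "f \<in> borel_measurable borel" "g \<in> borel_measurable borel"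
    and "\<And>x. norm (x - x0) = r \<Longrightarrow> f x = g x" "r > 0"
  shows "sph_integrable x0 r f = sph_integrable x0 r g"
proof -
  have ae: "AE z in lborel. f (x0 + (r / norm z) *\<^sub>R z) = g (x0 + (r / norm z) *\<^sub>R z)"
    by (rule AE_radial_projection_eq[OF assms(3,4)])
  then show ?thesis unfolding sph_integrable_def set_integrable_def
    by (intro integrable_cong_AE) (auto elim: eventually_mono)
qed

lemma polar_coordinates_ball:
  fixes f :: "real^'n \<Rightarrow> real"
  assumes fm[measurable]: "f \<in> borel_measurable borel" and f: "set_integrable lborel (ball x0 R) f"
  shows "AE r in lborel. r \<in> {0<..<R} \<longrightarrow> sph_integrable x0 r f"
    and "set_integrable lborel {0<..<R} (\<lambda>r. sphere_int x0 r f)"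
    and "(LINT x:ball x0 R|lborel. f x) = (LINT r:{0<..<R}|lborel. sphere_int x0 r f)"
proof -
  define F where "F x = indicator (ball x0 R) x *\<^sub>R f x" for x
  have F: "integrable lborel F" using f by (simp add: set_integrable_def F_def[abs_def])
  have Fm[measurable]: "F \<in> borel_measurable borel" using F by auto
  have 1: "sphere_int x0 r F = indicator {0<..<R} r *\<^sub>R sphere_int x0 r f" if "r > 0" for r
  proof (cases "r < R")
    case True
    have "sphere_int x0 r F = sphere_int x0 r f"
      by (rule sphere_int_cong) (use True that in \<open>auto simp: F_def dist_norm norm_minus_commute\<close>)
    then show ?thesis using True that by simp
  next
    case False
    have "sphere_int x0 r F = sphere_int x0 r (\<lambda>x. 0)"
      by (rule sphere_int_cong) (use False that in \<open>auto simp: F_def dist_norm norm_minus_commute\<close>)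
    then show ?thesis using False that by (simp add: sphere_int_def set_lebesgue_integral_def)
  qed
  have eq: "indicator {0<..} r *\<^sub>R sphere_int x0 r F = indicator {0<..<R} r *\<^sub>R sphere_int x0 r f" for r
    using 1[of r] by (cases "r > 0") auto
  show "set_integrable lborel {0<..<R} (\<lambda>r. sphere_int x0 r f)"
    using polar_coordinates(2)[OF F, of x0] by (simp only: eq set_integrable_def)
  show "(LINT x:ball x0 R|lborel. f x) = (LINT r:{0<..<R}|lborel. sphere_int x0 r f)"
    using polar_coordinates(3)[OF F, of x0] by (simp only: eq set_lebesgue_integral_def F_def)
  show "AE r in lborel. r \<in> {0<..<R} \<longrightarrow> sph_integrable x0 r f"
    using polar_coordinates(1)[OF F, of x0]
  proof eventually_elim
    case (elim r)
    have "sph_integrable x0 r F = sph_integrable x0 r f" if "r \<in> {0<..<R}"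
      by (rule sph_integrable_cong) (use that in \<open>auto simp: F_def dist_norm norm_minus_commute\<close>)
    then show ?case using elim by auto
  qed
qed

lemma sph_integrable_add: "sph_integrable x0 r f \<Longrightarrow> sph_integrable x0 r g \<Longrightarrow> sph_integrable x0 r (\<lambda>x. f x + g x)"
  and sph_integrable_cmult: "sph_integrable x0 r f \<Longrightarrow> sph_integrable x0 r (\<lambda>x. c * f x)"
  unfolding sph_integrable_def by (auto intro: set_integral_add)

lemma sphere_int_add:
  fixes f g :: "real^'n \<Rightarrow> real"
  assumes [measurable]: "f \<in> borel_measurable borel" "g \<in> borel_measurable borel"
    and "sph_integrable x0 r f" "sph_integrable x0 r g"
  shows "sphere_int x0 r (\<lambda>x. f x + g x) = sphere_int x0 r f + sphere_int x0 r g"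
  using set_integral_add(2)[OF assms(3,4)[unfolded sph_integrable_def]]
  by (simp add: sphere_int_lborel algebra_simps)

lemma sphere_int_cmult: "sphere_int x0 r (\<lambda>x. c * f x) = c * sphere_int x0 r f"
  unfolding sphere_int_def by simp

lemma sphere_int_nonneg:
  assumes "\<And>x. f x \<ge> 0" "r \<ge> 0"
  shows "sphere_int x0 r f \<ge> 0"
  unfolding sphere_int_def set_lebesgue_integral_def using assms
  by (intro mult_nonneg_nonneg integral_nonneg) auto

text \<open>The expansion serves twice: with sphere integrals as coefficients in the Cauchy-Schwarz
  inequality, and with coefficients 1 and 3/2 in the monotonicity of the boundary
  functional.\<close>

lemma sphere_int_square:
  fixes u v :: "real^'n \<Rightarrow> real"
  assumes [measurable]: "u \<in> borel_measurable borel" "v \<in> borel_measurable borel"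
    and "sph_integrable x0 r (\<lambda>x. (u x)\<^sup>2)" "sph_integrable x0 r (\<lambda>x. (v x)\<^sup>2)" "sph_integrable x0 r (\<lambda>x. u x * v x)"
  shows "sphere_int x0 r (\<lambda>x. (a * v x - b * u x)\<^sup>2) =
     a\<^sup>2 * sphere_int x0 r (\<lambda>x. (v x)\<^sup>2) - 2 * a * b * sphere_int x0 r (\<lambda>x. u x * v x) + b\<^sup>2 * sphere_int x0 r (\<lambda>x. (u x)\<^sup>2)"
proof -
  define c where "c = - 2 * a * b"
  have "(\<lambda>x. (a * v x - b * u x)\<^sup>2) = (\<lambda>x. (a\<^sup>2 * (v x)\<^sup>2 + c * (u x * v x)) + b\<^sup>2 * (u x)\<^sup>2)"
    by (auto simp: power2_eq_square algebra_simps c_def)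
  moreover have "sphere_int x0 r (\<lambda>x. (a\<^sup>2 * (v x)\<^sup>2 + c * (u x * v x)) + b\<^sup>2 * (u x)\<^sup>2) =
      sphere_int x0 r (\<lambda>x. a\<^sup>2 * (v x)\<^sup>2 + c * (u x * v x)) + sphere_int x0 r (\<lambda>x. b\<^sup>2 * (u x)\<^sup>2)"
    by (intro sphere_int_add sph_integrable_add sph_integrable_cmult assms(3-5)) measurable
  moreover have "sphere_int x0 r (\<lambda>x. a\<^sup>2 * (v x)\<^sup>2 + c * (u x * v x)) =
      sphere_int x0 r (\<lambda>x. a\<^sup>2 * (v x)\<^sup>2) + sphere_int x0 r (\<lambda>x. c * (u x * v x))"
    by (intro sphere_int_add sph_integrable_add sph_integrable_cmult assms(3-5)) measurable
  ultimately show ?thesis by (simp only: sphere_int_cmult) (simp add: c_def)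
qed

text \<open>Choosing the coefficients \<open>H\<close> and \<open>M\<close> makes the integral of
  the square equal to \<open>H\<close> times the Cauchy-Schwarz defect, and \<open>H\<close> is
  positive.\<close>

lemma sphere_int_Cauchy_Schwarz:
  fixes u v :: "real^'n \<Rightarrow> real"
  assumes "u \<in> borel_measurable borel" "v \<in> borel_measurable borel"
    and "sph_integrable x0 r (\<lambda>x. (u x)\<^sup>2)" "sph_integrable x0 r (\<lambda>x. (v x)\<^sup>2)" "sph_integrable x0 r (\<lambda>x. u x * v x)"
    and pos: "sphere_int x0 r (\<lambda>x. (u x)\<^sup>2) > 0" and "r \<ge> 0"
  shows "(sphere_int x0 r (\<lambda>x. u x * v x))\<^sup>2 \<le> sphere_int x0 r (\<lambda>x. (v x)\<^sup>2) * sphere_int x0 r (\<lambda>x. (u x)\<^sup>2)"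
proof -
  define H where "H = sphere_int x0 r (\<lambda>x. (u x)\<^sup>2)"
  define M where "M = sphere_int x0 r (\<lambda>x. u x * v x)"
  define N where "N = sphere_int x0 r (\<lambda>x. (v x)\<^sup>2)"
  have "0 \<le> H\<^sup>2 * N - 2 * H * M * M + M\<^sup>2 * H"
    using sphere_int_square[OF assms(1-5), of H M] sphere_int_nonneg[of "\<lambda>x. (H * v x - M * u x)\<^sup>2" r x0] \<open>r \<ge> 0\<close>
    by (simp add: H_def M_def N_def)
  also have "\<dots> = H * (N * H - M\<^sup>2)" by (simp add: power2_eq_square algebra_simps)
  finally have "N * H - M\<^sup>2 \<ge> 0" using pos unfolding H_def[symmetric] by (simp add: zero_le_mult_iff)
  then show ?thesis by (simp add: H_def M_def N_def)
qed

text \<open>For continuous integrands no radius is exceptional, in contrast to those involving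
  \<open>Du\<close>: they are bounded on the closed ball, and dominated convergence on the unit ball
  gives continuity in \<open>r\<close>.\<close>

lemma continuous_on_sphere_int:
  fixes f :: "real^'n \<Rightarrow> real"
  assumes fm[measurable]: "f \<in> borel_measurable borel" and c: "continuous_on (cball x0 R) f"
  shows "continuous_on {0<..<R} (\<lambda>r. sphere_int x0 r f)"
    and "r \<in> {0<..<R} \<Longrightarrow> sph_integrable x0 r f"
proof -
  have "bounded (f ` cball x0 R)" using c by (intro compact_imp_bounded compact_continuous_image) auto
  then obtain B where B0: "\<forall>y\<in>f ` cball x0 R. norm y \<le> B" unfolding bounded_iff by blast
  have in_ball: "x0 + (r / norm z) *\<^sub>R z \<in> cball x0 R" if "r \<in> {0<..<R}" for r and z :: "real^'n"
    using that by (cases "z = 0") (auto simp: dist_norm)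
  have B: "\<bar>f (x0 + (r / norm z) *\<^sub>R z)\<bar> \<le> B" if "r \<in> {0<..<R}" for r z
    using B0 in_ball[OF that] by auto
  have iB: "integrable lborel (\<lambda>z::real^'n. B * indicator (ball 0 1) z)"
    by (intro integrable_mult_right integrable_real_indicator)
       (auto intro: emeasure_lborel_ball_finite[unfolded infinity_ennreal_def])
  show "sph_integrable x0 r f" if r: "r \<in> {0<..<R}" for r
    unfolding sph_integrable_def set_integrable_def
    by (rule Bochner_Integration.integrable_bound[OF iB]) (use B[OF r] in \<open>auto simp: indicator_def intro: order_trans[OF _ abs_ge_self]\<close>)
  have "continuous_on {0<..<R} (\<lambda>r. LINT z:ball 0 1|lborel. f (x0 + (r / norm z) *\<^sub>R z))"
    unfolding continuous_on_sequentially
  proof (intro allI ballI impI, elim conjE)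
    fix X r assume r: "r \<in> {0<..<R}" and X: "\<forall>n. X n \<in> {0<..<R}" "X \<longlonglongrightarrow> r"
    show "((\<lambda>r. LINT z:ball 0 1|lborel. f (x0 + (r / norm z) *\<^sub>R z)) \<circ> X) \<longlonglongrightarrow> (LINT z:ball 0 1|lborel. f (x0 + (r / norm z) *\<^sub>R z))"
      unfolding comp_def set_lebesgue_integral_def
    proof (rule integral_dominated_convergence[OF _ _ iB])
      show "AE z in lborel. norm (indicat_real (ball 0 1) z *\<^sub>R f (x0 + (X i / norm z) *\<^sub>R z)) \<le> B * indicat_real (ball 0 1) z" for i
        using B[of "X i"] X(1) by (intro AE_I2) (auto simp: indicator_def)
      show "AE z in lborel. (\<lambda>i. indicat_real (ball 0 1) z *\<^sub>R f (x0 + (X i / norm z) *\<^sub>R z)) \<longlonglongrightarrow> indicat_real (ball 0 1) z *\<^sub>R f (x0 + (r / norm z) *\<^sub>R z)"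
      proof (rule AE_I2)
        fix z :: "real^'n"
        have "(\<lambda>i. x0 + (X i / norm z) *\<^sub>R z) \<longlonglongrightarrow> x0 + (r / norm z) *\<^sub>R z"
          unfolding divide_inverse by (intro tendsto_intros X(2))
        then have "(\<lambda>i. f (x0 + (X i / norm z) *\<^sub>R z)) \<longlonglongrightarrow> f (x0 + (r / norm z) *\<^sub>R z)"
          using X(1) r by (intro continuous_on_tendsto_compose[OF c]) (auto intro!: in_ball always_eventually simp del: mem_cball)
        then show "(\<lambda>i. indicat_real (ball 0 1) z *\<^sub>R f (x0 + (X i / norm z) *\<^sub>R z)) \<longlonglongrightarrow> indicat_real (ball 0 1) z *\<^sub>R f (x0 + (r / norm z) *\<^sub>R z)"
          by (intro tendsto_intros)
      qed
    qed auto
  qed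
  then show "continuous_on {0<..<R} (\<lambda>r. sphere_int x0 r f)"
    unfolding sphere_int_lborel[OF fm] by (intro continuous_intros)
qed

section \<open>From radial test functions to identities at almost every radius\<close>

text \<open>Supplies a radial profile with prescribed derivative that vanishes beyond a given
  radius, as needed for compact support.\<close>

lemma exists_antiderivative_vanishing:
  fixes \<Theta> :: "real \<Rightarrow> real"
  assumes c: "continuous_on UNIV \<Theta>" and z: "\<And>t. t \<le> 0 \<Longrightarrow> \<Theta> t = 0" "\<And>t. t \<ge> c \<Longrightarrow> \<Theta> t = 0"
  shows "\<exists>\<kappa>. (\<forall>t. (\<kappa> has_real_derivative \<Theta> t) (at t)) \<and> (\<forall>t\<ge>c. \<kappa> t = 0)"
proof -
  \<comment> \<open>The base point -1 lies inside the region where \<Theta> vanishes, so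
    \<open>\<kappa>0\<close> is identically 0 left of 0, also where the interval of integration is
    empty.\<close>
  define \<kappa>0 where "\<kappa>0 t = integral {-1..t} \<Theta>" for t
  have d: "(\<kappa>0 has_real_derivative \<Theta> t) (at t)" for t
  proof (cases "t > -1")
    case True
    have "((\<lambda>x. integral {-1..x} \<Theta>) has_real_derivative \<Theta> t) (at t within {-1..t+1})"
      by (rule integral_has_real_derivative) (use c True in \<open>auto intro: continuous_on_subset\<close>)
    then show ?thesis using True by (simp add: \<kappa>0_def[abs_def] at_within_Icc_at)
  next
    case False
    have "((\<lambda>x. 0) has_real_derivative \<Theta> t) (at t)" using z(1) False by simp
    then show ?thesis
    proof (rule has_field_derivative_transform_within_open[where S="{..<0}"])
      fix x :: real assume "x \<in> {..<0}"
      then have "integral {-1..x} \<Theta> = integral {-1..x} (\<lambda>x. 0)" using z(1) by (intro integral_cong) auto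
      then show "0 = \<kappa>0 x" by (simp add: \<kappa>0_def)
    qed (use False in auto)
  qed
  have const: "\<kappa>0 t = \<kappa>0 c" if "t \<ge> c" for t
  proof (cases "t = c")
    case False
    then have "c < t" using that by simp
    obtain s where "c < s" "s < t" "\<kappa>0 t - \<kappa>0 c = (t - c) * \<Theta> s" using MVT2[OF \<open>c < t\<close> d] by blast
    then show ?thesis using z(2) by simp
  qed simp
  show ?thesis
  proof (intro exI[of _ "\<lambda>t. \<kappa>0 t - \<kappa>0 c"] conjI allI impI)
    show "((\<lambda>t. \<kappa>0 t - \<kappa>0 c) has_real_derivative \<Theta> t) (at t)" for t
      using DERIV_diff[OF d DERIV_const] by simp
    show "\<kappa>0 t - \<kappa>0 c = 0" if "c \<le> t" for t using const[OF that] by simp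
  qed
qed

lemma prim_indicator:
  assumes "0 < r" "r \<le> R"
  shows "prim (\<lambda>s. indicator {0<..<R} s * a s) r = (LINT s:{0<..<r}|lborel. a s)"
    and "prim (\<lambda>s. indicator {0<..<R} s * a s) 0 = 0"
proof -
  have "prim (\<lambda>s. indicator {0<..<R} s * a s) r = (LINT s|lborel. indicator {..r} s *\<^sub>R (indicator {0<..<R} s * a s))"
    by (simp add: prim_def set_lebesgue_integral_def)
  \<comment> \<open>The half-line \<open>{..r}\<close> contains \<open>r\<close> but
    \<open>{0<..<r}\<close> does not; for \<open>r < R\<close> the value at this point is carried
    along as a separate null term.\<close>
  also have "\<dots> = (LINT s|lborel. indicator {0<..<r} s *\<^sub>R a s + indicator {r} s *\<^sub>R (if r < R then a r else 0))"
    by (rule Bochner_Integration.integral_cong) (use assms in \<open>auto simp: indicator_def\<close>)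
  also have "\<dots> = (LINT s:{0<..<r}|lborel. a s)"
  proof -
    have i: "integrable lborel (\<lambda>s. indicator {r} s *\<^sub>R (if r < R then a r else 0))"
      unfolding real_scaleR_def by (rule integrable_mult_left, rule integrable_real_indicator) auto
    show ?thesis
    proof (cases "integrable lborel (\<lambda>s. indicator {0<..<r} s *\<^sub>R a s)")
    case True
    show ?thesis unfolding set_lebesgue_integral_def Bochner_Integration.integral_add[OF True i] by simp
  next
    \<comment> \<open>Without integrability both integrals have the default value 0, and the
      equality persists.\<close>
    case False
    have "\<not> integrable lborel (\<lambda>s. indicator {0<..<r} s *\<^sub>R a s + indicator {r} s *\<^sub>R (if r < R then a r else 0))"
    proof
      assume "integrable lborel (\<lambda>s. indicator {0<..<r} s *\<^sub>R a s + indicator {r} s *\<^sub>R (if r < R then a r else 0))"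
      from Bochner_Integration.integrable_diff[OF this i] False show False by simp
    qed
    then show ?thesis using False by (simp add: set_lebesgue_integral_def not_integrable_integral_eq)
  qed
  qed
  finally show "prim (\<lambda>s. indicator {0<..<R} s * a s) r = (LINT s:{0<..<r}|lborel. a s)" .
  have "(\<lambda>s. indicator {..0} s *\<^sub>R (indicator {0<..<R} s * a s)) = (\<lambda>s. 0)" by (auto simp: indicator_def)
  then show "prim (\<lambda>s. indicator {0<..<R} s * a s) 0 = 0" by (simp add: prim_def set_lebesgue_integral_def)
qed

lemma prim_sphere_int:
  fixes F :: "real^'n \<Rightarrow> real"
  assumes F: "F \<in> borel_measurable borel" "set_integrable lborel (ball x0 R) F" and r: "0 < r" "r \<le> R"
  shows "prim (\<lambda>s. indicator {0<..<R} s * sphere_int x0 s F) r = (LINT x:ball x0 r|lborel. F x)"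
proof -
  have "set_integrable lborel (ball x0 r) F" by (rule set_integrable_subset[OF F(2)]) (use r in auto)
  then show ?thesis using polar_coordinates_ball(3)[OF F(1)] prim_indicator(1)[OF r] by simp
qed

text \<open>In polar coordinates the tested identity becomes one-dimensional. Integrating the term
  with \<open>\<kappa> (s\<^sup>2)\<close> by parts leaves only \<open>\<kappa>'\<close>; both
  boundary terms vanish, at \<open>R\<close> because of \<kappa> and at 0 because of the
  primitive.\<close>

lemma radial_test_identity_1D:
  fixes F G :: "real^'n \<Rightarrow> real"
  assumes R: "0 < R" and F: "F \<in> borel_measurable borel" "set_integrable lborel (ball x0 R) F"
    and G: "G \<in> borel_measurable borel" "set_integrable lborel (ball x0 R) G"
    and \<kappa>: "\<And>t. (\<kappa> has_real_derivative \<kappa>' t) (at t)" "continuous_on UNIV \<kappa>'" "\<kappa> (R\<^sup>2) = 0"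
    and test: "(LINT x:ball x0 R|lborel. \<kappa> ((norm (x - x0))\<^sup>2) * F x + 2 * \<kappa>' ((norm (x - x0))\<^sup>2) * G x) = 0"
  defines "a \<equiv> \<lambda>s. indicator {0<..<R} s * sphere_int x0 s F"
    and "b \<equiv> \<lambda>s. indicator {0<..<R} s * sphere_int x0 s G"
  shows "(LINT s:{0..R}|lborel. 2 * \<kappa>' (s\<^sup>2) * (b s - s * prim a s)) = 0"
proof -
  note F(1)[measurable] G(1)[measurable]
  have ai: "integrable lborel a" using polar_coordinates_ball(2)[OF F] by (simp add: a_def set_integrable_def)
  have bi: "integrable lborel b" using polar_coordinates_ball(2)[OF G] by (simp add: b_def set_integrable_def)
  have ck: "continuous_on UNIV \<kappa>" using \<kappa>(1) by (meson DERIV_isCont continuous_at_imp_continuous_on)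
  have [measurable]: "\<kappa> \<in> borel_measurable borel" "\<kappa>' \<in> borel_measurable borel"
    using ck \<kappa>(2) by (auto intro: borel_measurable_continuous_onI)
  have c1: "continuous_on A (\<lambda>s. \<kappa> (s\<^sup>2))" "continuous_on A (\<lambda>s. 2 * \<kappa>' (s\<^sup>2))" "continuous_on A (\<lambda>s. 2 * s * \<kappa>' (s\<^sup>2))" for A
    by (auto intro!: continuous_intros continuous_on_compose2[OF ck] continuous_on_compose2[OF \<kappa>(2)])
  define P where "P x = \<kappa> ((norm (x - x0))\<^sup>2) * F x + 2 * \<kappa>' ((norm (x - x0))\<^sup>2) * G x" for x
  have [measurable]: "P \<in> borel_measurable borel" unfolding P_def by measurable
  have cb: "set_integrable lborel (ball x0 R) (\<lambda>x. \<phi> ((norm (x - x0))\<^sup>2) * f x)"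
    if "continuous_on UNIV \<phi>" "f \<in> borel_measurable borel" "set_integrable lborel (ball x0 R) f" for \<phi> :: "real \<Rightarrow> real" and f
  proof -
    note that(2)[measurable]
    have [measurable]: "\<phi> \<in> borel_measurable borel" using that(1) by (rule borel_measurable_continuous_onI)
    have "bounded (\<phi> ` {0..R\<^sup>2})" using that(1) by (intro compact_imp_bounded compact_continuous_image) (auto intro: continuous_on_subset)
    then obtain B where B: "\<forall>y\<in>\<phi> ` {0..R\<^sup>2}. norm y \<le> B" unfolding bounded_iff by blast
    have le: "\<bar>\<phi> ((norm (x - x0))\<^sup>2)\<bar> \<le> B" if "x \<in> ball x0 R" for x
    proof -
      have "(norm (x - x0))\<^sup>2 \<le> R\<^sup>2" using that by (intro power_mono) (auto simp: dist_norm norm_minus_commute)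
      then show ?thesis using B by auto
    qed
    show ?thesis unfolding set_integrable_def
    proof (rule Bochner_Integration.integrable_bound)
      show "integrable lborel (\<lambda>x. B * (indicator (ball x0 R) x *\<^sub>R f x))"
        using that(3) by (simp only: set_integrable_def integrable_mult_right)
      have "(\<lambda>x. indicator (ball x0 R) x * (\<phi> ((norm (x - x0))\<^sup>2) * f x)) \<in> borel_measurable borel"
        by (intro borel_measurable_times borel_measurable_indicator) auto
      then show "(\<lambda>x. indicator (ball x0 R) x *\<^sub>R (\<phi> ((norm (x - x0))\<^sup>2) * f x)) \<in> borel_measurable lborel" by simp
      show "AE x in lborel. norm (indicator (ball x0 R) x *\<^sub>R (\<phi> ((norm (x - x0))\<^sup>2) * f x)) \<le> norm (B * (indicator (ball x0 R) x *\<^sub>R f x))"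
      proof (rule AE_I2)
        fix x show "norm (indicator (ball x0 R) x *\<^sub>R (\<phi> ((norm (x - x0))\<^sup>2) * f x)) \<le> norm (B * (indicator (ball x0 R) x *\<^sub>R f x))"
          using le[of x] by (cases "x \<in> ball x0 R") (auto simp: abs_mult intro!: mult_right_mono)
      qed
    qed
  qed
  have c2: "continuous_on UNIV (\<lambda>t. 2 * \<kappa>' t)" by (intro continuous_intros \<kappa>(2))
  have Pi: "set_integrable lborel (ball x0 R) P" unfolding P_def
    by (rule set_integral_add(1)[OF cb[OF ck F] cb[OF c2 G]])
  have "(LINT s:{0..R}|lborel. \<kappa> (s\<^sup>2) * a s + 2 * \<kappa>' (s\<^sup>2) * b s) = (LINT s:{0<..<R}|lborel. sphere_int x0 s P)"
    unfolding set_lebesgue_integral_def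
  proof (rule integral_cong_AE)
    show "(\<lambda>s. indicator {0..R} s *\<^sub>R (\<kappa> (s\<^sup>2) * a s + 2 * \<kappa>' (s\<^sup>2) * b s)) \<in> borel_measurable lborel"
      using borel_measurable_integrable[OF ai] borel_measurable_integrable[OF bi] by measurable
    show "(\<lambda>s. indicator {0<..<R} s *\<^sub>R sphere_int x0 s P) \<in> borel_measurable lborel"
      using polar_coordinates_ball(2)[OF _ Pi] by (auto simp: set_integrable_def)
    show "AE s in lborel. indicator {0..R} s *\<^sub>R (\<kappa> (s\<^sup>2) * a s + 2 * \<kappa>' (s\<^sup>2) * b s) = indicator {0<..<R} s *\<^sub>R sphere_int x0 s P"
      using polar_coordinates_ball(1)[OF F] polar_coordinates_ball(1)[OF G]
    proof eventually_elim
      case (elim s)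
      show ?case
      proof (cases "s \<in> {0<..<R}")
        case True
        have "sphere_int x0 s P = sphere_int x0 s (\<lambda>x. \<kappa> (s\<^sup>2) * F x + (2 * \<kappa>' (s\<^sup>2)) * G x)"
          by (rule sphere_int_cong) (use True in \<open>auto simp: P_def\<close>)
        also have "\<dots> = sphere_int x0 s (\<lambda>x. \<kappa> (s\<^sup>2) * F x) + sphere_int x0 s (\<lambda>x. (2 * \<kappa>' (s\<^sup>2)) * G x)"
          by (rule sphere_int_add) (use elim True in \<open>auto intro: sph_integrable_cmult\<close>)
        finally show ?thesis using True by (simp only: sphere_int_cmult) (simp add: a_def b_def)
      next
        case False
        then show ?thesis by (simp add: a_def b_def)
      qed
    qed
  qed
  also have "\<dots> = 0" using polar_coordinates_ball(3)[OF _ Pi] test by (simp add: P_def)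
  finally have 1: "(LINT s:{0..R}|lborel. \<kappa> (s\<^sup>2) * a s + 2 * \<kappa>' (s\<^sup>2) * b s) = 0" .
  have "\<kappa> (R\<^sup>2) * prim a R - \<kappa> (0\<^sup>2) * prim a 0 = (LINT s:{0..R}|lborel. \<kappa> (s\<^sup>2) * a s + (2 * s * \<kappa>' (s\<^sup>2)) * prim a s)"
  proof (rule prim_by_parts[OF ai])
    show "((\<lambda>s. \<kappa> (s\<^sup>2)) has_real_derivative 2 * x * \<kappa>' (x\<^sup>2)) (at x)" for x
    proof -
      have "((\<lambda>s. s\<^sup>2) has_real_derivative 2 * x) (at x)" by (auto intro!: derivative_eq_intros)
      from DERIV_chain2[OF \<kappa>(1) this] show ?thesis by (simp add: mult.commute)
    qed
  qed (use R c1(3) in auto)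
  moreover have "prim a 0 = 0" using prim_indicator(2)[OF R] by (simp add: a_def)
  ultimately have 2: "(LINT s:{0..R}|lborel. \<kappa> (s\<^sup>2) * a s + (2 * s * \<kappa>' (s\<^sup>2)) * prim a s) = 0" using \<kappa>(3) by simp
  have i1: "set_integrable lborel {0..R} (\<lambda>s. \<kappa> (s\<^sup>2) * a s + 2 * \<kappa>' (s\<^sup>2) * b s)"
    by (rule set_integral_add(1)[OF set_integrable_continuous_mult[OF ai c1(1)] set_integrable_continuous_mult[OF bi c1(2)]])
  have i2: "set_integrable lborel {0..R} (\<lambda>s. \<kappa> (s\<^sup>2) * a s + (2 * s * \<kappa>' (s\<^sup>2)) * prim a s)"
    by (rule set_integral_add(1)[OF set_integrable_continuous_mult[OF ai c1(1)] set_integrable_continuous_mult_prim[OF ai c1(3)]])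
  have "(LINT s:{0..R}|lborel. (\<kappa> (s\<^sup>2) * a s + 2 * \<kappa>' (s\<^sup>2) * b s) - (\<kappa> (s\<^sup>2) * a s + (2 * s * \<kappa>' (s\<^sup>2)) * prim a s)) = 0"
    using set_integral_diff(2)[OF i1 i2] 1 2 by simp
  moreover have "(\<lambda>s. (\<kappa> (s\<^sup>2) * a s + 2 * \<kappa>' (s\<^sup>2) * b s) - (\<kappa> (s\<^sup>2) * a s + (2 * s * \<kappa>' (s\<^sup>2)) * prim a s))
      = (\<lambda>s. 2 * \<kappa>' (s\<^sup>2) * (b s - s * prim a s))" by (auto simp: algebra_simps)
  ultimately show ?thesis by simp
qed

text \<open>A family of integral identities tested with radial functions amounts to one identity between a
  sphere integral and a ball integral for almost every radius. The test functions depend on the squared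
  distance, which keeps them differentiable at the centre.\<close>

lemma radial_identity:
  fixes F G :: "real^'n \<Rightarrow> real"
  assumes R: "0 < R" and F: "F \<in> borel_measurable borel" "set_integrable lborel (ball x0 R) F"
    and G: "G \<in> borel_measurable borel" "set_integrable lborel (ball x0 R) G"
    and test: "\<And>\<kappa> \<kappa>' \<rho>. (\<And>t. (\<kappa> has_real_derivative \<kappa>' t) (at t)) \<Longrightarrow> continuous_on UNIV \<kappa>' \<Longrightarrow> 0 < \<rho> \<Longrightarrow> \<rho> < R \<Longrightarrow>
       (\<And>t. t \<ge> \<rho>\<^sup>2 \<Longrightarrow> \<kappa> t = 0) \<Longrightarrow>
       (LINT x:ball x0 R|lborel. \<kappa> ((norm (x - x0))\<^sup>2) * F x + 2 * \<kappa>' ((norm (x - x0))\<^sup>2) * G x) = 0"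
  shows "AE r in lborel. r \<in> {0<..<R} \<longrightarrow> sphere_int x0 r G = r * (LINT x:ball x0 r|lborel. F x)"
proof -
  define a where "a \<equiv> \<lambda>s. indicator {0<..<R} s * sphere_int x0 s F"
  define b where "b \<equiv> \<lambda>s. indicator {0<..<R} s * sphere_int x0 s G"
  have ai: "integrable lborel a" using polar_coordinates_ball(2)[OF F] by (simp add: a_def set_integrable_def)
  have bi: "integrable lborel b" using polar_coordinates_ball(2)[OF G] by (simp add: b_def set_integrable_def)
  have am[measurable]: "a \<in> borel_measurable borel" and bm[measurable]: "b \<in> borel_measurable borel"
    using ai bi by auto
  have "AE s in lborel. s \<in> {0<..<R} \<longrightarrow> b s - s * prim a s = 0"
  proof (rule fundamental_lemma_calculus_of_variations)
    show "(\<lambda>s. b s - s * prim a s) \<in> borel_measurable borel" by measurable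
    have i0: "set_integrable lborel {0..R} (\<lambda>s. b s - s * prim a s)"
      by (rule set_integral_diff(1)[OF set_integrable_of_integrable[OF bi] set_integrable_continuous_mult_prim[OF ai]])
         (auto intro: continuous_intros)
    then show "set_integrable lborel K (\<lambda>s. b s - s * prim a s)" if "compact K" "K \<subseteq> {0<..<R}" for K
      by (rule set_integrable_subset) (use that in \<open>auto simp: borel_compact\<close>)
    fix \<psi> :: "real \<Rightarrow> real" and K assume \<psi>: "C1_fun \<psi>" and K: "compact K" "K \<subseteq> {0<..<R}" and \<psi>0: "\<And>x. x \<notin> K \<Longrightarrow> \<psi> x = 0"
    \<comment> \<open>The support of \<psi> stays away from \<open>R\<close>, which leaves room for
      a radius \<rho> strictly below \<open>R\<close> as the premise \<open>test\<close>
      demands.\<close>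
    obtain \<rho> where \<rho>: "0 < \<rho>" "\<rho> < R" "\<And>s. s \<ge> \<rho> \<Longrightarrow> s \<notin> K"
    proof (cases "K = {}")
      case True
      then show ?thesis using that[of "R/2"] R by auto
    next
      case False
      then obtain m where m: "m \<in> K" "\<And>s. s \<in> K \<Longrightarrow> s \<le> m" using compact_attains_sup[OF K(1)] by blast
      then have "0 < m" "m < R" using K(2) by auto
      then show ?thesis using that[of "(m + R)/2"] m(2) by force
    qed
    \<comment> \<open>This makes \<open>2 * \<kappa>' (s\<^sup>2)\<close> equal to
      \<open>\<psi> s\<close> for nonnegative \<open>s\<close>, so every test function \<psi> on the
      interval of radii arises. The square root is harmless at 0 because \<psi> vanishes near
      0.\<close>
    define \<kappa>' where "\<kappa>' t = \<psi> (sqrt t) / 2" for t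
    have c: "continuous_on UNIV \<kappa>'" unfolding \<kappa>'_def
      by (intro continuous_intros continuous_on_compose2[OF C1_fun_continuous[OF \<psi>]]) auto
    have z1: "\<kappa>' t = 0" if "t \<le> 0" for t
    proof -
      have "sqrt t \<le> 0" using that by simp
      then have "sqrt t \<notin> K" using K(2) by auto
      then show ?thesis using \<psi>0 by (simp add: \<kappa>'_def)
    qed
    have z2: "\<kappa>' t = 0" if "t \<ge> \<rho>\<^sup>2" for t
    proof -
      have "sqrt t \<ge> \<rho>" using that by (rule real_le_rsqrt)
      then show ?thesis using \<psi>0 \<rho>(3) by (simp add: \<kappa>'_def)
    qed
    obtain \<kappa> where \<kappa>: "\<And>t. (\<kappa> has_real_derivative \<kappa>' t) (at t)" "\<And>t. t \<ge> \<rho>\<^sup>2 \<Longrightarrow> \<kappa> t = 0"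
      using exists_antiderivative_vanishing[OF c z1 z2] by blast
    have "\<rho>\<^sup>2 \<le> R\<^sup>2" using \<rho> by (intro power_mono) auto
    then have "(LINT s:{0..R}|lborel. 2 * \<kappa>' (s\<^sup>2) * (b s - s * prim a s)) = 0"
      unfolding a_def b_def by (intro radial_test_identity_1D[OF R F G \<kappa>(1) c \<kappa>(2) test[OF \<kappa>(1) c \<rho>(1,2) \<kappa>(2)]])
    moreover have "indicator {0..R} s *\<^sub>R (2 * \<kappa>' (s\<^sup>2) * (b s - s * prim a s)) = (b s - s * prim a s) * \<psi> s" for s
    proof (cases "s \<in> {0..R}")
      case True
      then show ?thesis by (simp add: \<kappa>'_def)
    next
      case False
      then have "s \<notin> K" using K(2) by auto
      then show ?thesis using False \<psi>0 by simp
    qed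
    ultimately show "(LINT s|lborel. (b s - s * prim a s) * \<psi> s) = 0"
      by (simp only: set_lebesgue_integral_def)
  qed simp
  then show ?thesis
  proof eventually_elim
    case (elim r)
    show ?case
    proof
      assume r: "r \<in> {0<..<R}"
      then have "prim a r = (LINT x:ball x0 r|lborel. F x)" unfolding a_def by (intro prim_sphere_int F) auto
      then show "sphere_int x0 r G = r * (LINT x:ball x0 r|lborel. F x)" using elim r by (simp add: b_def)
    qed
  qed
qed

section \<open>Variational solutions\<close>

text \<open>The derivative is a parameter, and the support is replaced by any compact set off which
  \<psi> vanishes. This way \<open>frechet_derivative\<close> and the closure in
  \<open>tsupp\<close> are handled once, where the hypotheses on \<open>u\<close> are
  invoked.\<close>

definition test_fun :: "('a::euclidean_space \<Rightarrow> real) \<Rightarrow> ('a \<Rightarrow> 'a \<Rightarrow> real) \<Rightarrow> 'a set \<Rightarrow> bool" where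
  "test_fun \<psi> D K \<longleftrightarrow> (\<forall>x. (\<psi> has_derivative D x) (at x)) \<and> (\<forall>h. continuous_on UNIV (\<lambda>x. D x h)) \<and>
     compact K \<and> (\<forall>x. x \<notin> K \<longrightarrow> \<psi> x = 0)"

lemma test_fun_derivative: "test_fun \<psi> D K \<Longrightarrow> (\<psi> has_derivative D x) (at x)"
  and test_fun_continuous_derivative: "test_fun \<psi> D K \<Longrightarrow> continuous_on UNIV (\<lambda>x. D x h)"
  and test_fun_compact: "test_fun \<psi> D K \<Longrightarrow> compact K"
  and test_fun_zero: "test_fun \<psi> D K \<Longrightarrow> x \<notin> K \<Longrightarrow> \<psi> x = 0"
  by (auto simp: test_fun_def)

lemma test_fun_continuous: "test_fun \<psi> D K \<Longrightarrow> continuous_on UNIV \<psi>"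
  by (meson continuous_at_imp_continuous_on has_derivative_continuous test_fun_derivative)

lemma test_fun_derivative_zero:
  assumes "test_fun \<psi> D K" "x \<notin> K"
  shows "D x h = 0"
proof -
  have "((\<lambda>x. 0) has_derivative D x) (at x)"
    by (rule has_derivative_transform_within_open[OF test_fun_derivative[OF assms(1)], of "- K"])
       (use assms in \<open>auto simp: test_fun_def compact_imp_closed\<close>)
  then have "D x = (\<lambda>h. 0)" by (rule has_derivative_unique) simp
  then show ?thesis by simp
qed

lemma test_fun_exists: "C1_fun \<psi> \<Longrightarrow> compact K \<Longrightarrow> (\<And>x. x \<notin> K \<Longrightarrow> \<psi> x = 0) \<Longrightarrow> \<exists>D. test_fun \<psi> D K"
  by (auto simp: test_fun_def C1_fun_def)

lemma borel_measurable_test_fun: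
  assumes "test_fun \<psi> D K"
  shows "\<psi> \<in> borel_measurable borel" "(\<lambda>x. D x h) \<in> borel_measurable borel"
  using test_fun_continuous[OF assms] test_fun_continuous_derivative[OF assms]
  by (auto intro: borel_measurable_continuous_onI)

lemma integrable_mult_compact_support:
  fixes f \<phi> :: "'a::euclidean_space \<Rightarrow> real"
  assumes f: "set_integrable lborel K f" and K: "compact K" and \<phi>: "continuous_on UNIV \<phi>" "\<And>x. x \<notin> K \<Longrightarrow> \<phi> x = 0"
  shows "integrable lborel (\<lambda>x. f x * \<phi> x)"
proof -
  have "bounded (\<phi> ` K)" using \<phi>(1) K by (intro compact_imp_bounded compact_continuous_image) (auto intro: continuous_on_subset)
  then obtain B where B: "\<forall>y\<in>\<phi> ` K. norm y \<le> B" unfolding bounded_iff by blast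
  have [measurable]: "\<phi> \<in> borel_measurable borel" using \<phi>(1) by (rule borel_measurable_continuous_onI)
  have fm: "(\<lambda>x. indicator K x *\<^sub>R f x) \<in> borel_measurable borel" using f by (auto simp: set_integrable_def)
  have eq: "(\<lambda>x. f x * \<phi> x) = (\<lambda>x. (indicator K x *\<^sub>R f x) * \<phi> x)"
  proof
    fix x show "f x * \<phi> x = (indicator K x *\<^sub>R f x) * \<phi> x" using \<phi>(2)[of x] by (cases "x \<in> K") auto
  qed
  show ?thesis unfolding eq
  proof (rule Bochner_Integration.integrable_bound)
    show "integrable lborel (\<lambda>x. B * (indicator K x *\<^sub>R f x))"
      using f by (simp only: set_integrable_def integrable_mult_right)
    show "(\<lambda>x. indicat_real K x *\<^sub>R f x * \<phi> x) \<in> borel_measurable lborel" using fm by simp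
    show "AE x in lborel. norm (indicat_real K x *\<^sub>R f x * \<phi> x) \<le> norm (B * (indicat_real K x *\<^sub>R f x))"
    proof (rule AE_I2)
      fix x
      show "norm (indicat_real K x *\<^sub>R f x * \<phi> x) \<le> norm (B * (indicat_real K x *\<^sub>R f x))"
      proof (cases "x \<in> K")
        case True
        then have "\<bar>\<phi> x\<bar> \<le> B" using B by auto
        then have "\<bar>\<phi> x\<bar> \<le> \<bar>B\<bar>" by linarith
        then show ?thesis using True by (simp add: abs_mult mult.commute mult_right_mono)
      qed simp
    qed
  qed
qed

lemma borel_measurable_vec_nth[measurable]:
  fixes f :: "'a \<Rightarrow> real^'n"
  assumes [measurable]: "f \<in> borel_measurable M"
  shows "(\<lambda>x. f x $ i) \<in> borel_measurable M"
  by (simp add: cart_eq_inner_axis)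

text \<open>Upgrades almost everywhere identities between continuous quantities to all points: a
  nonempty open set is not null.\<close>

lemma continuous_AE_zero_imp_zero:
  fixes f :: "'a::euclidean_space \<Rightarrow> real"
  assumes "open S" "continuous_on S f" "AE x in lborel. x \<in> S \<longrightarrow> f x = 0" "x \<in> S"
  shows "f x = 0"
proof (rule ccontr)
  assume "f x \<noteq> 0"
  define U where "U = S \<inter> f -` (- {0})"
  have oU: "open U" unfolding U_def by (rule continuous_open_preimage[OF assms(2,1)]) auto
  have "x \<in> U" using assms \<open>f x \<noteq> 0\<close> by (auto simp: U_def)
  have "AE x in lborel. x \<notin> U" using assms(3) by eventually_elim (auto simp: U_def)
  then have "U \<in> null_sets lborel" using oU by (subst (asm) AE_iff_null_sets[symmetric]) auto
  then have "negligible U" using oU by (simp add: negligible_iff_null_sets null_sets_completionI)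
  then show False using oU \<open>x \<in> U\<close> open_not_negligible by blast
qed

text \<open>\<open>g\<close> and \<open>H\<close> are the classical gradient and Hessian of \<open>u\<close> on the positivity set \<open>P\<close>.\<close>

locale variational =
  fixes k :: "'n::finite" and \<Omega> :: "(real^'n) set" and u :: "real^'n \<Rightarrow> real" and Du :: "real^'n \<Rightarrow> real^'n"
    and g :: "real^'n \<Rightarrow> real^'n" and H :: "real^'n \<Rightarrow> real^'n \<Rightarrow> real^'n" and P :: "(real^'n) set"
  assumes op: "open \<Omega>" and W: "W12loc_grad \<Omega> u Du" and cu: "continuous_on \<Omega> u"
    and P_def: "P = {x\<in>\<Omega>. u x > 0}"
    and u_nonneg: "\<And>x. x \<in> \<Omega> \<Longrightarrow> u x \<ge> 0" and u_zero: "\<And>x. x \<in> \<Omega> \<Longrightarrow> x $ k \<le> 0 \<Longrightarrow> u x = 0"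
    and du: "\<And>x. x \<in> P \<Longrightarrow> (u has_derivative (\<lambda>h. g x \<bullet> h)) (at x)"
    and dg: "\<And>x. x \<in> P \<Longrightarrow> (g has_derivative H x) (at x)"
    and cH: "\<And>i j. continuous_on P (\<lambda>x. H x (axis j 1) $ i)"
    and var: "\<And>\<phi>. C1c_field \<Omega> \<phi> \<Longrightarrow>
        (LINT x:\<Omega>|lebesgue.
            (norm (Du x))\<^sup>2 * divg \<phi> x
          - 2 * (Du x \<bullet> frechet_derivative \<phi> (at x) (Du x))
          + x $ k * chi_pos u x * divg \<phi> x
          + chi_pos u x * \<phi> x $ k) = 0"
begin

lemma um[measurable]: "u \<in> borel_measurable borel" and Dum[measurable]: "Du \<in> borel_measurable borel"
  using W by (auto simp: W12loc_grad_def)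

lemma open_P: "open P"
proof -
  have "P = \<Omega> \<inter> u -` {0<..}" by (auto simp: P_def)
  then show ?thesis using continuous_open_preimage[OF cu op, of "{0<..}"] by simp
qed

lemma P_sub: "P \<subseteq> \<Omega>" by (auto simp: P_def)

lemma P_borel[measurable]: "P \<in> sets borel" and \<Omega>_borel[measurable]: "\<Omega> \<in> sets borel"
  using open_P op by auto

lemma continuous_on_g: "continuous_on P g"
  using dg by (meson continuous_at_imp_continuous_on has_derivative_continuous)

lemma continuous_on_u_P: "continuous_on P u"
  using cu P_sub continuous_on_subset by blast

text \<open>The integrands met later are at most quadratic in \<open>Du\<close> with locally bounded
  coefficients, so one dominating function serves for many of them.\<close>

lemma set_integrable_compact:
  assumes K: "compact K" "K \<subseteq> \<Omega>" and f[measurable]: "f \<in> borel_measurable borel"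
    and le: "\<And>x. x \<in> K \<Longrightarrow> \<bar>f x\<bar> \<le> C * (1 + (norm (Du x))\<^sup>2)"
  shows "set_integrable lborel K f"
proof -
  have Kb[measurable]: "K \<in> sets borel" using K by (simp add: borel_compact)
  have "set_integrable lebesgue K (\<lambda>x. (norm (Du x))\<^sup>2)" using W K by (auto simp: W12loc_grad_def)
  then have "set_integrable lborel K (\<lambda>x. (norm (Du x))\<^sup>2)" by (simp add: set_integrable_lebesgue_eq_lborel)
  moreover have "set_integrable lborel K (\<lambda>x. 1 :: real)"
    unfolding set_integrable_def by (rule borel_integrable_compact[OF K(1) continuous_on_const])
  ultimately have "set_integrable lborel K (\<lambda>x. 1 + (norm (Du x))\<^sup>2)" by (intro set_integral_add(1))
  then have "integrable lborel (\<lambda>x. C * (indicator K x *\<^sub>R (1 + (norm (Du x))\<^sup>2)))"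
    by (simp only: set_integrable_def integrable_mult_right)
  then show ?thesis unfolding set_integrable_def
  proof (rule Bochner_Integration.integrable_bound)
    show "AE x in lborel. norm (indicat_real K x *\<^sub>R f x) \<le> norm (C * indicat_real K x *\<^sub>R (1 + (norm (Du x))\<^sup>2))"
    proof (rule AE_I2)
      fix x show "norm (indicat_real K x *\<^sub>R f x) \<le> norm (C * indicat_real K x *\<^sub>R (1 + (norm (Du x))\<^sup>2))"
        using le[of x] by (cases "x \<in> K") auto
    qed
  qed measurable
qed

lemma u_bounded:
  assumes "compact K" "K \<subseteq> \<Omega>"
  obtains B where "B \<ge> 0" "\<And>x. x \<in> K \<Longrightarrow> \<bar>u x\<bar> \<le> B"
proof -
  have "bounded (u ` K)" using assms cu by (intro compact_imp_bounded compact_continuous_image) (auto intro: continuous_on_subset)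
  then obtain B where "\<forall>y\<in>u ` K. norm y \<le> B" unfolding bounded_iff by blast
  then show ?thesis using that[of "max B 0"] by force
qed

lemma norm_le_one_plus_square: "norm v \<le> 1 + (norm v)\<^sup>2"
proof -
  have "0 \<le> (norm v - 1/2)\<^sup>2" by simp
  then show ?thesis by (simp add: power2_eq_square algebra_simps)
qed

lemma set_integrable_Du_component:
  assumes "compact K" "K \<subseteq> \<Omega>"
  shows "set_integrable lborel K (\<lambda>x. Du x $ i)"
proof (rule set_integrable_compact[OF assms, where C=1])
  show "\<bar>Du x $ i\<bar> \<le> 1 * (1 + (norm (Du x))\<^sup>2)" for x
    unfolding mult_1 using component_le_norm_cart[of "Du x" i] norm_le_one_plus_square[of "Du x"] by (rule order_trans)
qed measurable

lemma set_integrable_u: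
  assumes "compact K" "K \<subseteq> \<Omega>"
  shows "set_integrable lborel K u"
  unfolding set_integrable_def using assms cu by (intro borel_integrable_compact) (auto intro: continuous_on_subset)

lemma weak_derivative:
  assumes t: "test_fun \<psi> D K" and K: "K \<subseteq> \<Omega>"
  shows "(LINT x:\<Omega>|lborel. u x * D x (axis i 1)) = - (LINT x:\<Omega>|lborel. Du x $ i * \<psi> x)"
proof -
  note borel_measurable_test_fun[OF t, measurable]
  have sub: "tsupp \<psi> \<subseteq> K" unfolding tsupp_def
    by (rule closure_minimal) (use t in \<open>auto simp: test_fun_def compact_imp_closed\<close>)
  then have "compact (tsupp \<psi>)" using test_fun_compact[OF t] by (metis closed_closure compact_Int_closed inf.absorb2 tsupp_def)
  then have "C1c_scalar \<Omega> \<psi>" unfolding C1c_scalar_def using t sub K by (auto simp: test_fun_def)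
  then have "(LINT x:\<Omega>|lebesgue. u x * frechet_derivative \<psi> (at x) (axis i 1)) = - (LINT x:\<Omega>|lebesgue. Du x $ i * \<psi> x)"
    using W by (auto simp: W12loc_grad_def)
  moreover have "frechet_derivative \<psi> (at x) = D x" for x
    using frechet_derivative_at[OF test_fun_derivative[OF t]] by simp
  ultimately show ?thesis by (simp add: set_lebesgue_integral_lebesgue_eq_lborel)
qed

text \<open>Against test functions supported in \<open>P\<close>, classical integration by parts and
  the definition of the weak gradient give the same values.\<close>

lemma grad_eq_AE: "AE x in lborel. x \<in> P \<longrightarrow> Du x = g x"
proof -
  \<comment> \<open>Nothing is known about \<open>g\<close> off \<open>P\<close>; the indicator
    makes the difference a Borel function on the whole space.\<close>
  have "AE x in lborel. x \<in> P \<longrightarrow> indicator P x *\<^sub>R (Du x $ i - g x $ i) = 0" for i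
  proof (rule fundamental_lemma_calculus_of_variations[OF open_P])
    have gm: "(\<lambda>x. indicator P x *\<^sub>R g x $ i) \<in> borel_measurable borel"
      by (rule borel_measurable_continuous_on_indicator) (auto intro!: continuous_intros continuous_on_g)
    then show "(\<lambda>x. indicator P x *\<^sub>R (Du x $ i - g x $ i)) \<in> borel_measurable borel"
      unfolding scaleR_diff_right by measurable
    have gK: "set_integrable lborel K (\<lambda>x. g x $ i)" if "compact K" "K \<subseteq> P" for K
      unfolding set_integrable_def using that continuous_on_g
      by (intro borel_integrable_compact) (auto intro!: continuous_intros intro: continuous_on_subset)
    show "set_integrable lborel K (\<lambda>x. indicator P x *\<^sub>R (Du x $ i - g x $ i))" if K: "compact K" "K \<subseteq> P" for K
    proof -
      have "set_integrable lborel K (\<lambda>x. Du x $ i - g x $ i)"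
        using K P_sub by (intro set_integral_diff(1) gK set_integrable_Du_component) auto
      then show ?thesis unfolding set_integrable_def
        by (rule Bochner_Integration.integrable_cong[THEN iffD1, rotated 2]) (use K in \<open>auto simp: indicator_def\<close>)
    qed
    fix \<psi> K assume \<psi>: "C1_fun \<psi>" and K: "compact K" "K \<subseteq> P" and \<psi>0: "\<And>x. x \<notin> K \<Longrightarrow> \<psi> x = 0"
    obtain D where t: "test_fun \<psi> D K" using test_fun_exists[OF \<psi> K(1) \<psi>0] by blast
    have K\<Omega>: "K \<subseteq> \<Omega>" using K P_sub by auto
    let ?e = "axis i 1 :: real^'n"
    have c\<psi>: "continuous_on P \<psi>" "continuous_on P (\<lambda>x. D x ?e)"
      using test_fun_continuous[OF t] test_fun_continuous_derivative[OF t] by (auto intro: continuous_on_subset)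
    have "(LINT x:P|lborel. u x * D x ?e + (g x \<bullet> ?e) * \<psi> x) = 0"
      by (rule integral_directional_derivative_eq_0(2)[OF open_P K, where f = "\<lambda>x. u x * \<psi> x" and D = "\<lambda>x h. u x * D x h + (g x \<bullet> h) * \<psi> x"])
         (auto intro!: has_derivative_mult du test_fun_derivative[OF t] continuous_intros c\<psi> continuous_on_u_P continuous_on_g simp: \<psi>0)
    moreover have i1: "integrable lborel (\<lambda>x. u x * D x ?e)"
      by (rule integrable_mult_compact_support[OF set_integrable_u[OF K(1) K\<Omega>] K(1) test_fun_continuous_derivative[OF t]])
         (simp add: test_fun_derivative_zero[OF t])
    moreover have i2: "integrable lborel (\<lambda>x. g x $ i * \<psi> x)"
      by (rule integrable_mult_compact_support[OF gK[OF K] K(1) test_fun_continuous[OF t]]) (simp add: \<psi>0)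
    moreover have i3: "integrable lborel (\<lambda>x. Du x $ i * \<psi> x)"
      by (rule integrable_mult_compact_support[OF set_integrable_Du_component[OF K(1) K\<Omega>] K(1) test_fun_continuous[OF t]]) (simp add: \<psi>0)
    moreover have e1: "(\<lambda>x. indicator S x *\<^sub>R (f x * \<psi> x)) = (\<lambda>x. f x * \<psi> x)" if "P \<subseteq> S" for f S
    proof
      fix x show "indicator S x *\<^sub>R (f x * \<psi> x) = f x * \<psi> x" using \<psi>0[of x] that K by (cases "x \<in> K") (auto simp: indicator_def)
    qed
    moreover have e2: "(\<lambda>x. indicator S x *\<^sub>R (f x * D x ?e)) = (\<lambda>x. f x * D x ?e)" if "P \<subseteq> S" for f S
    proof
      fix x show "indicator S x *\<^sub>R (f x * D x ?e) = f x * D x ?e" using test_fun_derivative_zero[OF t, of x] that K by (cases "x \<in> K") (auto simp: indicator_def)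
    qed
    moreover have e3: "(\<lambda>x. (indicator P x *\<^sub>R (Du x $ i - g x $ i)) * \<psi> x) = (\<lambda>x. Du x $ i * \<psi> x - g x $ i * \<psi> x)"
    proof
      fix x show "(indicator P x *\<^sub>R (Du x $ i - g x $ i)) * \<psi> x = Du x $ i * \<psi> x - g x $ i * \<psi> x"
        using \<psi>0[of x] K by (cases "x \<in> K") (auto simp: indicator_def algebra_simps)
    qed
    have "(LINT x|lborel. u x * D x ?e) + (LINT x|lborel. g x $ i * \<psi> x) = 0"
    proof -
      have "(LINT x:P|lborel. u x * D x ?e + (g x \<bullet> ?e) * \<psi> x) = (LINT x|lborel. u x * D x ?e + g x $ i * \<psi> x)"
        unfolding set_lebesgue_integral_def scaleR_add_right
      proof (rule Bochner_Integration.integral_cong[OF refl])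
        fix x
        show "indicat_real P x *\<^sub>R (u x * D x ?e) + indicat_real P x *\<^sub>R ((g x \<bullet> ?e) * \<psi> x) = u x * D x ?e + g x $ i * \<psi> x"
          using fun_cong[OF e1[OF order_refl, of "\<lambda>x. g x $ i"], of x] fun_cong[OF e2[OF order_refl, of u], of x]
          by (simp only: inner_axis real_inner_1_right)
      qed
      then show ?thesis
        using \<open>(LINT x:P|lborel. u x * D x ?e + (g x \<bullet> ?e) * \<psi> x) = 0\<close> Bochner_Integration.integral_add[OF i1 i2] by simp
    qed
    moreover have "(LINT x|lborel. u x * D x ?e) = - (LINT x|lborel. Du x $ i * \<psi> x)"
      using weak_derivative[OF t K\<Omega>, of i] unfolding set_lebesgue_integral_def e1[OF P_sub] e2[OF P_sub] .
    ultimately show "(LINT x|lborel. (indicator P x *\<^sub>R (Du x $ i - g x $ i)) * \<psi> x) = 0"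
      unfolding e3 Bochner_Integration.integral_diff[OF i3 i2] by linarith
  qed
  then have "AE x in lborel. \<forall>i\<in>UNIV. x \<in> P \<longrightarrow> indicator P x *\<^sub>R (Du x $ i - g x $ i) = 0"
    by (intro AE_ball_countable[THEN iffD2]) auto
  then show ?thesis by eventually_elim (auto simp: vec_eq_iff)
qed

end

text \<open>The function \<open>t * (gq \<epsilon> t)^2\<close>, that is \<open>(t - \<epsilon>)^2 / t\<close> for \<open>t > \<epsilon>\<close>, is a continuously differentiable
  truncation of the identity on the positive axis which vanishes below \<open>\<epsilon>\<close>. Composed with \<open>u\<close> it allows
  integration by parts on the positivity set without any regularity of the free boundary.\<close>

definition gq :: "real \<Rightarrow> real \<Rightarrow> real" where "gq \<epsilon> t = max 0 (t - \<epsilon>) / t"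

lemma gq_bounds: "\<epsilon> > 0 \<Longrightarrow> t > 0 \<Longrightarrow> 0 \<le> gq \<epsilon> t" "\<epsilon> > 0 \<Longrightarrow> t > 0 \<Longrightarrow> gq \<epsilon> t \<le> 1"
  by (auto simp: gq_def divide_le_eq)

lemma gq_zero: "t < \<epsilon> \<Longrightarrow> gq \<epsilon> t = 0"
  by (simp add: gq_def)

lemma continuous_on_gq: "continuous_on {0<..} (gq \<epsilon>)"
  unfolding gq_def by (intro continuous_intros) auto

lemma DERIV_gq:
  assumes "t > 0"
  shows "((\<lambda>t. t * (gq \<epsilon> t)\<^sup>2) has_real_derivative gq \<epsilon> t * (2 - gq \<epsilon> t)) (at t)"
proof -
  have "((\<lambda>t. t - \<epsilon>) has_real_derivative 1) (at t)" by (auto intro!: derivative_eq_intros)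
  from DERIV_chain2[OF DERIV_max_0_squared this]
  have 1: "((\<lambda>t. (max 0 (t - \<epsilon>))\<^sup>2) has_real_derivative 2 * max 0 (t - \<epsilon>)) (at t)" by simp
  have "((\<lambda>t. (max 0 (t - \<epsilon>))\<^sup>2 / t) has_real_derivative (2 * max 0 (t - \<epsilon>) * t - (max 0 (t - \<epsilon>))\<^sup>2 * 1) / (t * t)) (at t)"
    by (rule DERIV_divide[OF 1 DERIV_ident]) (use assms in simp)
  moreover have "(2 * max 0 (t - \<epsilon>) * t - (max 0 (t - \<epsilon>))\<^sup>2 * 1) / (t * t) = gq \<epsilon> t * (2 - gq \<epsilon> t)"
    using assms by (simp add: gq_def field_simps power2_eq_square)
  ultimately have "((\<lambda>t. (max 0 (t - \<epsilon>))\<^sup>2 / t) has_real_derivative gq \<epsilon> t * (2 - gq \<epsilon> t)) (at t)" by simp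
  then show ?thesis
    by (rule has_field_derivative_transform_within_open[where S="{0<..}"]) (use assms in \<open>auto simp: gq_def power2_eq_square\<close>)
qed

lemma gq_tendsto:
  assumes "t > 0"
  shows "(\<lambda>m. gq (1 / real (Suc m)) t) \<longlonglongrightarrow> 1"
proof -
  have "(\<lambda>m. 1 / real (Suc m)) \<longlonglongrightarrow> 0" using LIMSEQ_Suc[OF lim_1_over_n] by simp
  then have "(\<lambda>m. gq (1 / real (Suc m)) t) \<longlonglongrightarrow> max 0 (t - 0) / t"
    unfolding gq_def using assms by (intro tendsto_intros) auto
  then show ?thesis using assms by simp
qed

lemma test_fun_apply:
  fixes \<psi> :: "real^'n \<Rightarrow> real"
  assumes "test_fun \<psi> D K"
  shows "D x v = (\<Sum>i\<in>UNIV. v $ i * D x (axis i 1))"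
proof -
  have lin: "linear (D x)" using test_fun_derivative[OF assms] by (rule has_derivative_linear)
  have "D x v = D x (\<Sum>i\<in>UNIV. (v $ i) *\<^sub>R axis i 1)" using basis_expansion[of v] by (simp add: scalar_mult_eq_scaleR)
  also have "\<dots> = (\<Sum>i\<in>UNIV. v $ i * D x (axis i 1))" by (simp add: linear_sum[OF lin] linear_cmul[OF lin])
  finally show ?thesis .
qed

section \<open>Integration by parts across the free boundary\<close>

context variational
begin

text \<open>The compact set \<open>K\<close> may cross the free boundary. The truncated factor
  confines the product to the part of \<open>K\<close> where \<open>u\<close> is at least
  \<epsilon>, a compact subset of \<open>P\<close>, so the integral of a directional derivative of
  the product vanishes. A factor \<open>u\<close> is left in front of \<open>Dp\<close>, which
  compensates for derivatives of \<open>p\<close> that are not controlled near the free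
  boundary.\<close>

lemma gamma_identity:
  assumes \<epsilon>: "\<epsilon> > 0" and K: "compact K" "K \<subseteq> \<Omega>"
    and p: "\<And>x. x \<in> P \<Longrightarrow> (p has_derivative Dp x) (at x)" "continuous_on P (\<lambda>x. Dp x h)"
    and p0: "\<And>x. x \<in> P \<Longrightarrow> x \<notin> K \<Longrightarrow> p x = 0"
  defines "I \<equiv> \<lambda>x. gq \<epsilon> (u x) * (2 - gq \<epsilon> (u x)) * ((g x \<bullet> h) * p x) + (gq \<epsilon> (u x))\<^sup>2 * (u x * Dp x h)"
  shows "set_integrable lborel P I" "(LINT x:P|lborel. I x) = 0"
proof -
  define \<gamma> where "\<gamma> t = t * (gq \<epsilon> t)\<^sup>2" for t
  define K' where "K' = K \<inter> (K \<inter> u -` {\<epsilon>..})"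
  have "closed (K \<inter> u -` {\<epsilon>..})"
    by (rule continuous_closed_preimage) (use K cu in \<open>auto intro: continuous_on_subset compact_imp_closed\<close>)
  then have K': "compact K'" unfolding K'_def by (rule compact_Int_closed[OF K(1)])
  have K'P: "K' \<subseteq> P" using K \<epsilon> by (auto simp: K'_def P_def)
  define D where "D x h = \<gamma> (u x) * Dp x h + gq \<epsilon> (u x) * (2 - gq \<epsilon> (u x)) * (g x \<bullet> h) * p x" for x h
  have pos: "u x > 0" if "x \<in> P" for x using that by (simp add: P_def)
  have d: "((\<lambda>x. \<gamma> (u x) * p x) has_derivative D x) (at x)" if x: "x \<in> P" for x
  proof -
    have "((\<lambda>x. \<gamma> (u x)) has_derivative (\<lambda>h. gq \<epsilon> (u x) * (2 - gq \<epsilon> (u x)) * (g x \<bullet> h))) (at x)"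
      using has_derivative_compose[OF du[OF x] DERIV_gq[OF pos[OF x], of \<epsilon>, unfolded has_field_derivative_def]]
      by (simp add: \<gamma>_def)
    from has_derivative_mult[OF this p(1)[OF x]] show ?thesis by (simp add: D_def[abs_def])
  qed
  have cp: "continuous_on P p" using p(1) by (meson continuous_at_imp_continuous_on has_derivative_continuous)
  have cq: "continuous_on P (\<lambda>x. gq \<epsilon> (u x))"
    by (rule continuous_on_compose2[OF continuous_on_gq continuous_on_u_P]) (auto simp: P_def)
  have c: "continuous_on P (\<lambda>x. D x h)" unfolding D_def \<gamma>_def
    by (intro continuous_intros cq cp p(2) continuous_on_u_P continuous_on_g)
  have z: "\<gamma> (u x) * p x = 0" if "x \<in> P" "x \<notin> K'" for x
  proof (cases "x \<in> K")
    case True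
    then have "u x < \<epsilon>" using that by (auto simp: K'_def)
    then show ?thesis by (simp add: \<gamma>_def gq_zero)
  qed (use p0 that in simp)
  have I: "I = (\<lambda>x. D x h)" by (auto simp: I_def D_def \<gamma>_def)
  show "set_integrable lborel P I" "(LINT x:P|lborel. I x) = 0"
    unfolding I by (rule integral_directional_derivative_eq_0[OF open_P K' K'P z d c]; assumption)+
qed

text \<open>For \<open>q\<close> the truncation factor, both \<open>q * (2 - q)\<close> and
  \<open>q\<^sup>2\<close> lie in [0, 1] and tend to 1 on \<open>P\<close> as \<epsilon> decreases
  to 0, so dominated convergence removes the truncation. What applications must supply is the
  integrability of the two limit terms separately.\<close>

lemma gamma_limit:
  assumes A: "set_integrable lborel P A" and B: "set_integrable lborel P B"
    and eq: "\<And>\<epsilon>. \<epsilon> > 0 \<Longrightarrow> (LINT x:P|lborel. gq \<epsilon> (u x) * (2 - gq \<epsilon> (u x)) * A x + (gq \<epsilon> (u x))\<^sup>2 * B x) = 0"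
  shows "(LINT x:P|lborel. A x + B x) = 0"
proof -
  define e where "e m = 1 / real (Suc m)" for m
  have e: "e m > 0" for m by (simp add: e_def)
  have pos: "u x > 0" if "x \<in> P" for x using that by (simp add: P_def)
  have [measurable]: "(\<lambda>x. indicator P x *\<^sub>R A x) \<in> borel_measurable borel" "(\<lambda>x. indicator P x *\<^sub>R B x) \<in> borel_measurable borel"
    using A B by (auto simp: set_integrable_def)
  have gqm[measurable]: "(\<lambda>x. gq \<epsilon> (u x)) \<in> borel_measurable borel" for \<epsilon> unfolding gq_def by measurable
  have "(\<lambda>m. LINT x:P|lborel. gq (e m) (u x) * (2 - gq (e m) (u x)) * A x + (gq (e m) (u x))\<^sup>2 * B x) \<longlonglongrightarrow> (LINT x:P|lborel. A x + B x)"
    unfolding set_lebesgue_integral_def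
  proof (rule integral_dominated_convergence)
    have "(\<lambda>x. indicator P x *\<^sub>R A x + indicator P x *\<^sub>R B x) \<in> borel_measurable borel" by measurable
    then show "(\<lambda>x. indicator P x *\<^sub>R (A x + B x)) \<in> borel_measurable lborel" by (simp add: algebra_simps)
    have "(\<lambda>x. gq (e m) (u x) * (2 - gq (e m) (u x)) * (indicator P x *\<^sub>R A x) + (gq (e m) (u x))\<^sup>2 * (indicator P x *\<^sub>R B x)) \<in> borel_measurable borel" for m
      by measurable
    then show "(\<lambda>x. indicator P x *\<^sub>R (gq (e m) (u x) * (2 - gq (e m) (u x)) * A x + (gq (e m) (u x))\<^sup>2 * B x)) \<in> borel_measurable lborel" for m
      by (simp add: algebra_simps)
    show "integrable lborel (\<lambda>x. \<bar>indicator P x *\<^sub>R A x\<bar> + \<bar>indicator P x *\<^sub>R B x\<bar>)"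
      using A B by (simp only: set_integrable_def) (intro Bochner_Integration.integrable_add integrable_abs)
    show "AE x in lborel. norm (indicator P x *\<^sub>R (gq (e m) (u x) * (2 - gq (e m) (u x)) * A x + (gq (e m) (u x))\<^sup>2 * B x)) \<le> \<bar>indicator P x *\<^sub>R A x\<bar> + \<bar>indicator P x *\<^sub>R B x\<bar>" for m
    proof (rule AE_I2)
      fix x
      show "norm (indicator P x *\<^sub>R (gq (e m) (u x) * (2 - gq (e m) (u x)) * A x + (gq (e m) (u x))\<^sup>2 * B x)) \<le> \<bar>indicator P x *\<^sub>R A x\<bar> + \<bar>indicator P x *\<^sub>R B x\<bar>"
      proof (cases "x \<in> P")
        case True
        define q where "q = gq (e m) (u x)"
        have q: "0 \<le> q" "q \<le> 1" using gq_bounds[OF e pos[OF True]] by (auto simp: q_def)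
        have "q * (2 - q) = 1 - (1 - q)\<^sup>2" by (simp add: power2_eq_square algebra_simps)
        then have "q * (2 - q) \<le> 1" by simp
        moreover have "0 \<le> q * (2 - q)" using q by simp
        ultimately have 1: "\<bar>q * (2 - q) * A x\<bar> \<le> 1 * \<bar>A x\<bar>" unfolding abs_mult[of "q * (2 - q)"] by (intro mult_right_mono) auto
        have "q\<^sup>2 \<le> 1" using q by (simp add: power_le_one)
        then have 2: "\<bar>q\<^sup>2 * B x\<bar> \<le> 1 * \<bar>B x\<bar>" unfolding abs_mult by (intro mult_right_mono) auto
        have "\<bar>q * (2 - q) * A x + q\<^sup>2 * B x\<bar> \<le> \<bar>A x\<bar> + \<bar>B x\<bar>" using 1 2 by linarith
        then show ?thesis using True by (simp add: q_def)
      qed simp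
    qed
    show "AE x in lborel. (\<lambda>m. indicator P x *\<^sub>R (gq (e m) (u x) * (2 - gq (e m) (u x)) * A x + (gq (e m) (u x))\<^sup>2 * B x)) \<longlonglongrightarrow> indicator P x *\<^sub>R (A x + B x)"
    proof (rule AE_I2)
      fix x
      show "(\<lambda>m. indicator P x *\<^sub>R (gq (e m) (u x) * (2 - gq (e m) (u x)) * A x + (gq (e m) (u x))\<^sup>2 * B x)) \<longlonglongrightarrow> indicator P x *\<^sub>R (A x + B x)"
      proof (cases "x \<in> P")
        case True
        have "(\<lambda>m. gq (e m) (u x)) \<longlonglongrightarrow> 1" unfolding e_def by (rule gq_tendsto[OF pos[OF True]])
        then have "(\<lambda>m. gq (e m) (u x) * (2 - gq (e m) (u x)) * A x + (gq (e m) (u x))\<^sup>2 * B x) \<longlonglongrightarrow> 1 * (2 - 1) * A x + 1\<^sup>2 * B x"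
          by (intro tendsto_intros)
        then show ?thesis using True by simp
      qed simp
    qed
  qed
  then show ?thesis unfolding eq[OF e] by (simp add: LIMSEQ_const_iff)
qed

lemma set_integrable_continuous_P:
  fixes f :: "real^'n \<Rightarrow> real"
  assumes c: "continuous_on P f" and K: "compact K" "K \<subseteq> P" and z: "\<And>x. x \<in> P \<Longrightarrow> x \<notin> K \<Longrightarrow> f x = 0"
  shows "set_integrable lborel P f"
proof -
  have "integrable lborel (\<lambda>x. indicator K x *\<^sub>R f x)" using c K by (intro borel_integrable_compact) (auto intro: continuous_on_subset)
  moreover have "(\<lambda>x. indicator K x *\<^sub>R f x) = (\<lambda>x. indicator P x *\<^sub>R f x)"
  proof
    fix x show "indicator K x *\<^sub>R f x = indicator P x *\<^sub>R f x"
      using z[of x] K by (cases "x \<in> K"; cases "x \<in> P") auto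
  qed
  ultimately show ?thesis by (simp add: set_integrable_def)
qed

lemma borel_measurable_indicator_P:
  fixes f :: "real^'n \<Rightarrow> real"
  assumes "continuous_on P f"
  shows "(\<lambda>x. indicator P x *\<^sub>R f x) \<in> borel_measurable borel"
  by (rule borel_measurable_continuous_on_indicator[OF P_borel assms])

lemma set_integrable_u_Du:
  assumes "compact K" "K \<subseteq> \<Omega>"
  shows "set_integrable lborel K (\<lambda>x. u x * Du x $ i)"
proof -
  obtain B where B: "B \<ge> 0" "\<And>x. x \<in> K \<Longrightarrow> \<bar>u x\<bar> \<le> B" using u_bounded[OF assms] by blast
  show ?thesis
  proof (rule set_integrable_compact[OF assms, where C=B])
    fix x assume "x \<in> K"
    have "\<bar>Du x $ i\<bar> \<le> 1 + (norm (Du x))\<^sup>2"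
      using component_le_norm_cart[of "Du x" i] norm_le_one_plus_square[of "Du x"] by (rule order_trans)
    then show "\<bar>u x * Du x $ i\<bar> \<le> B * (1 + (norm (Du x))\<^sup>2)"
      unfolding abs_mult using B \<open>x \<in> K\<close> by (intro mult_mono) auto
  qed measurable
qed

lemma set_integrable_Du_sq:
  assumes "compact K" "K \<subseteq> \<Omega>"
  shows "set_integrable lborel K (\<lambda>x. (norm (Du x))\<^sup>2)"
  by (rule set_integrable_compact[OF assms, where C=1]) auto

text \<open>The classical gradient extended by zero is also a weak gradient of \<open>u\<close> on
  \<Omega>: the truncated identity with \<open>p = \<psi>\<close> passes to the limit without a
  boundary term, and \<open>u\<close> vanishes off \<open>P\<close>. Weak gradients are unique up to
  null sets.\<close>

lemma grad_zero_AE: "AE x in lborel. x \<in> \<Omega> \<longrightarrow> Du x = indicator P x *\<^sub>R g x"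
proof -
  have "AE x in lborel. x \<in> \<Omega> \<longrightarrow> Du x $ i - indicator P x *\<^sub>R g x $ i = 0" for i
  proof (rule fundamental_lemma_calculus_of_variations[OF op])
    have gm[measurable]: "(\<lambda>x. indicator P x *\<^sub>R g x $ i) \<in> borel_measurable borel"
      by (intro borel_measurable_indicator_P continuous_intros continuous_on_g)
    show "(\<lambda>x. Du x $ i - indicator P x *\<^sub>R g x $ i) \<in> borel_measurable borel" by measurable
    \<comment> \<open>\<open>g\<close> is not known to be bounded near the free boundary; its
      integrability on \<open>K\<close> is inherited from \<open>Du\<close>, with which it agrees
      almost everywhere on \<open>P\<close>.\<close>
    have gK: "set_integrable lborel K (\<lambda>x. indicator P x *\<^sub>R g x $ i)" if K: "compact K" "K \<subseteq> \<Omega>" for K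
    proof -
      have [measurable]: "K \<in> sets borel" using K by (simp add: borel_compact)
      have "set_integrable lborel (K \<inter> P) (\<lambda>x. Du x $ i)"
        by (rule set_integrable_subset[OF set_integrable_Du_component[OF K, of i]]) auto
      then have i: "integrable lborel (\<lambda>x. indicator (K \<inter> P) x *\<^sub>R Du x $ i)" by (simp only: set_integrable_def)
      show ?thesis unfolding set_integrable_def
      proof (rule integrable_cong_AE[THEN iffD1, OF _ _ _ i])
        show "(\<lambda>x. indicat_real (K \<inter> P) x *\<^sub>R Du x $ i) \<in> borel_measurable lborel" using i by (rule borel_measurable_integrable)
        show "(\<lambda>x. indicat_real K x *\<^sub>R indicat_real P x *\<^sub>R g x $ i) \<in> borel_measurable lborel" by measurable
        show "AE x in lborel. indicat_real (K \<inter> P) x *\<^sub>R Du x $ i = indicat_real K x *\<^sub>R indicat_real P x *\<^sub>R g x $ i"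
          using grad_eq_AE by eventually_elim (auto simp: indicator_def)
      qed
    qed
    show "set_integrable lborel K (\<lambda>x. Du x $ i - indicator P x *\<^sub>R g x $ i)" if "compact K" "K \<subseteq> \<Omega>" for K
      using that by (intro set_integral_diff(1) gK set_integrable_Du_component)
    fix \<psi> K assume \<psi>: "C1_fun \<psi>" and K: "compact K" "K \<subseteq> \<Omega>" and \<psi>0: "\<And>x. x \<notin> K \<Longrightarrow> \<psi> x = 0"
    obtain D where t: "test_fun \<psi> D K" using test_fun_exists[OF \<psi> K(1) \<psi>0] by blast
    let ?e = "axis i 1 :: real^'n"
    have i1: "integrable lborel (\<lambda>x. indicator P x *\<^sub>R g x $ i * \<psi> x)"
      by (rule integrable_mult_compact_support[OF gK[OF K] K(1) test_fun_continuous[OF t]]) (simp add: \<psi>0)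
    have i2: "integrable lborel (\<lambda>x. u x * D x ?e)"
      by (rule integrable_mult_compact_support[OF set_integrable_u[OF K] K(1) test_fun_continuous_derivative[OF t]])
         (simp add: test_fun_derivative_zero[OF t])
    have i3: "integrable lborel (\<lambda>x. Du x $ i * \<psi> x)"
      by (rule integrable_mult_compact_support[OF set_integrable_Du_component[OF K] K(1) test_fun_continuous[OF t]]) (simp add: \<psi>0)
    have A: "set_integrable lborel P (\<lambda>x. (g x \<bullet> ?e) * \<psi> x)"
      using i1 by (simp add: set_integrable_def inner_axis mult.assoc)
    have B: "set_integrable lborel P (\<lambda>x. u x * D x ?e)"
      by (rule set_integrable_of_integrable[OF i2]) simp
    have "(LINT x:P|lborel. (g x \<bullet> ?e) * \<psi> x + u x * D x ?e) = 0"
      by (rule gamma_limit[OF A B], rule gamma_identity(2)[OF _ K])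
         (use \<psi>0 test_fun_continuous_derivative[OF t] in \<open>auto intro: test_fun_derivative[OF t] continuous_on_subset\<close>)
    then have "(LINT x:P|lborel. (g x \<bullet> ?e) * \<psi> x) + (LINT x:P|lborel. u x * D x ?e) = 0"
      using set_integral_add(2)[OF A B] by simp
    moreover have "(LINT x:P|lborel. (g x \<bullet> ?e) * \<psi> x) = (LINT x|lborel. indicator P x *\<^sub>R g x $ i * \<psi> x)"
      by (simp add: set_lebesgue_integral_def inner_axis mult.assoc)
    moreover have "(LINT x:P|lborel. u x * D x ?e) = (LINT x:\<Omega>|lborel. u x * D x ?e)"
      unfolding set_lebesgue_integral_def
    proof (rule Bochner_Integration.integral_cong[OF refl])
      fix x show "indicator P x *\<^sub>R (u x * D x ?e) = indicator \<Omega> x *\<^sub>R (u x * D x ?e)"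
        using u_nonneg[of x] by (auto simp: P_def indicator_def)
    qed
    moreover have "(LINT x:\<Omega>|lborel. Du x $ i * \<psi> x) = (LINT x|lborel. Du x $ i * \<psi> x)"
      unfolding set_lebesgue_integral_def
    proof (rule Bochner_Integration.integral_cong[OF refl])
      fix x show "indicator \<Omega> x *\<^sub>R (Du x $ i * \<psi> x) = Du x $ i * \<psi> x"
        using \<psi>0[of x] K by (cases "x \<in> K") (auto simp: indicator_def)
    qed
    moreover have "(LINT x|lborel. (Du x $ i - indicator P x *\<^sub>R g x $ i) * \<psi> x) = (LINT x|lborel. Du x $ i * \<psi> x) - (LINT x|lborel. indicator P x *\<^sub>R g x $ i * \<psi> x)"
      using Bochner_Integration.integral_diff[OF i3 i1] by (simp add: left_diff_distrib)
    ultimately show "(LINT x|lborel. (Du x $ i - indicator P x *\<^sub>R g x $ i) * \<psi> x) = 0"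
      using weak_derivative[OF t K(2), of i] by linarith
  qed
  then have "AE x in lborel. \<forall>i\<in>UNIV. x \<in> \<Omega> \<longrightarrow> Du x $ i - indicator P x *\<^sub>R g x $ i = 0"
    by (intro AE_ball_countable[THEN iffD2]) auto
  then show ?thesis by eventually_elim (auto simp: vec_eq_iff)
qed

end

section \<open>Harmonicity in the positivity set\<close>

lemma C1c_field_of_test_fun:
  fixes \<psi> :: "real^'n \<Rightarrow> real" and v :: "real^'n"
  assumes t: "test_fun \<psi> D K" and K: "K \<subseteq> \<Omega>"
  shows "C1c_field \<Omega> (\<lambda>x. \<psi> x *\<^sub>R v)"
    and "frechet_derivative (\<lambda>x. \<psi> x *\<^sub>R v) (at x) = (\<lambda>h. D x h *\<^sub>R v)"
    and "divg (\<lambda>x. \<psi> x *\<^sub>R axis j 1) x = D x (axis j 1)"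
proof -
  have d: "((\<lambda>x. \<psi> x *\<^sub>R w) has_derivative (\<lambda>h. D x h *\<^sub>R w)) (at x)" for x and w :: "real^'n"
    by (rule has_derivative_scaleR_left[OF test_fun_derivative[OF t]])
  have sub: "tsupp (\<lambda>x. \<psi> x *\<^sub>R v) \<subseteq> K" unfolding tsupp_def
    by (rule closure_minimal) (use t in \<open>auto simp: test_fun_def compact_imp_closed\<close>)
  then have "compact (tsupp (\<lambda>x. \<psi> x *\<^sub>R v))"
    using test_fun_compact[OF t] by (metis closed_closure compact_Int_closed inf.absorb2 tsupp_def)
  moreover have "\<exists>D. (\<forall>x. ((\<lambda>x. \<psi> x *\<^sub>R v) has_derivative D x) (at x)) \<and> (\<forall>i j. continuous_on UNIV (\<lambda>x. D x (axis j 1) $ i))"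
    using d test_fun_continuous_derivative[OF t]
    by (intro exI[of _ "\<lambda>x h. D x h *\<^sub>R v"]) (auto intro!: continuous_intros)
  ultimately show "C1c_field \<Omega> (\<lambda>x. \<psi> x *\<^sub>R v)" using sub K by (auto simp: C1c_field_def)
  show f: "frechet_derivative (\<lambda>x. \<psi> x *\<^sub>R v) (at x) = (\<lambda>h. D x h *\<^sub>R v)" for x and v :: "real^'n"
    using frechet_derivative_at[OF d] by simp
  show "divg (\<lambda>x. \<psi> x *\<^sub>R axis j 1) x = D x (axis j 1)"
    unfolding divg_def f by (simp add: axis_def if_distrib cong: if_cong)
qed

context variational
begin

definition lapl :: "real^'n \<Rightarrow> real" where "lapl x = (\<Sum>i\<in>UNIV. H x (axis i 1) $ i)"

lemma continuous_on_lapl: "continuous_on P lapl"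
  unfolding lapl_def by (intro continuous_intros cH)

lemma hessian_symmetric:
  assumes "x \<in> P"
  shows "H x (axis j 1) $ i = H x (axis i 1) $ j"
proof -
  have "H x (axis j 1) \<bullet> axis i 1 = H x (axis i 1) \<bullet> axis j 1"
    by (rule symmetric_second_derivative[OF open_P assms du dg]) (auto simp: inner_axis intro: cH)
  then show ?thesis by (simp add: inner_axis)
qed

lemma norm_sq_eq_sum: "(norm (v::real^'n))\<^sup>2 = (\<Sum>i\<in>UNIV. v $ i * v $ i)"
  by (simp add: power2_norm_eq_inner inner_vec_def)

text \<open>On a support inside \<open>P\<close> the characteristic function is 1 and
  \<open>Du\<close> may be replaced by \<open>g\<close>, so the domain variation becomes an identity
  between classical derivatives.\<close>

lemma variation_in_P:
  assumes t: "test_fun \<psi> D K" and K: "K \<subseteq> P"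
  shows "(LINT x:P|lborel. (norm (g x))\<^sup>2 * D x (axis j 1) - 2 * (g x $ j * D x (g x)) + x $ k * D x (axis j 1) + \<psi> x * axis j 1 $ k) = 0"
proof -
  note borel_measurable_test_fun[OF t, measurable]
  have DDu[measurable]: "(\<lambda>x. D x (Du x)) \<in> borel_measurable borel"
    unfolding test_fun_apply[OF t, of _ "Du _"] by measurable
  have chim[measurable]: "chi_pos u \<in> borel_measurable borel" unfolding chi_pos_def[abs_def] by measurable
  have K\<Omega>: "K \<subseteq> \<Omega>" using K P_sub by auto
  let ?I = "\<lambda>x. (norm (Du x))\<^sup>2 * D x (axis j 1) - 2 * (Du x \<bullet> (D x (Du x) *\<^sub>R axis j 1)) + x $ k * chi_pos u x * D x (axis j 1) + chi_pos u x * (\<psi> x *\<^sub>R axis j 1) $ k"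
  let ?J = "\<lambda>x. (norm (g x))\<^sup>2 * D x (axis j 1) - 2 * (g x $ j * D x (g x)) + x $ k * D x (axis j 1) + \<psi> x * axis j 1 $ k"
  have "(LINT x:\<Omega>|lebesgue. ?I x) = 0"
    using var[OF C1c_field_of_test_fun(1)[OF t K\<Omega>, of "axis j 1"]]
    unfolding C1c_field_of_test_fun(2,3)[OF t K\<Omega>] .
  then have "(LINT x:\<Omega>|lborel. ?I x) = 0" by (subst (asm) set_lebesgue_integral_lebesgue_eq_lborel) measurable
  moreover have "(LINT x:\<Omega>|lborel. ?I x) = (LINT x:P|lborel. ?J x)"
    unfolding set_lebesgue_integral_def
  proof (rule integral_cong_AE)
    show "(\<lambda>x. indicator \<Omega> x *\<^sub>R ?I x) \<in> borel_measurable lborel" by measurable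
    have cD: "continuous_on P (\<lambda>x. D x h)" for h using test_fun_continuous_derivative[OF t] continuous_on_subset by blast
    have "continuous_on P ?J"
      unfolding test_fun_apply[OF t, of _ "g _"]
      by (intro continuous_intros cD continuous_on_g) (use test_fun_continuous[OF t] in \<open>auto intro: continuous_on_subset\<close>)
    then show "(\<lambda>x. indicator P x *\<^sub>R ?J x) \<in> borel_measurable lborel" using borel_measurable_indicator_P by simp
    show "AE x in lborel. indicator \<Omega> x *\<^sub>R ?I x = indicator P x *\<^sub>R ?J x"
      using grad_eq_AE
    proof eventually_elim
      case (elim x)
      show ?case
      proof (cases "x \<in> K")
        case True
        then have "x \<in> P" "x \<in> \<Omega>" using K K\<Omega> by auto
        then show ?thesis using elim by (simp add: chi_pos_def P_def inner_axis)
      next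
        case False
        then show ?thesis using test_fun_zero[OF t] test_fun_derivative_zero[OF t] by simp
      qed
    qed
  qed
  ultimately show ?thesis by simp
qed

text \<open>The variation integrand differs from twice \<open>g x $ j * lapl x * \<psi> x\<close> by
  exact derivatives: \<open>D1\<close> differentiates (|g|^2 + x_k) \<psi> along axis j, and
  \<open>D2 i\<close> differentiates g_j g_i \<psi> along axis i. The derivative of |g|^2 cancels
  against the mixed second derivatives by symmetry of the Hessian, and the height terms together
  form part of \<open>D1\<close>.\<close>

lemma gradient_times_laplacian_zero:
  assumes "x \<in> P"
  shows "g x $ j * lapl x = 0"
proof (rule continuous_AE_zero_imp_zero[OF open_P _ _ assms])
  show c: "continuous_on P (\<lambda>x. g x $ j * lapl x)"
    by (intro continuous_intros continuous_on_g continuous_on_lapl)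
  let ?f = "\<lambda>x. indicator P x *\<^sub>R (g x $ j * lapl x)"
  have "AE x in lborel. x \<in> P \<longrightarrow> ?f x = 0"
  proof (rule fundamental_lemma_calculus_of_variations[OF open_P])
    show "?f \<in> borel_measurable borel" by (rule borel_measurable_indicator_P[OF c])
    show "set_integrable lborel K ?f" if K: "compact K" "K \<subseteq> P" for K
    proof -
      have "integrable lborel (\<lambda>x. indicator K x *\<^sub>R (g x $ j * lapl x))"
        using K c by (intro borel_integrable_compact) (auto intro: continuous_on_subset)
      moreover have "(\<lambda>x. indicator K x *\<^sub>R (g x $ j * lapl x)) = (\<lambda>x. indicator K x *\<^sub>R ?f x)"
      proof
        fix x show "indicator K x *\<^sub>R (g x $ j * lapl x) = indicator K x *\<^sub>R ?f x" using K by (cases "x \<in> K") auto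
      qed
      ultimately show ?thesis by (simp add: set_integrable_def)
    qed
    fix \<psi> K assume \<psi>: "C1_fun \<psi>" and K: "compact K" "K \<subseteq> P" and \<psi>0: "\<And>x. x \<notin> K \<Longrightarrow> \<psi> x = 0"
    obtain D where t: "test_fun \<psi> D K" using test_fun_exists[OF \<psi> K(1) \<psi>0] by blast
    let ?J = "\<lambda>x. (norm (g x))\<^sup>2 * D x (axis j 1) - 2 * (g x $ j * D x (g x)) + x $ k * D x (axis j 1) + \<psi> x * axis j 1 $ k"
    have cD: "continuous_on P (\<lambda>x. D x h)" for h using test_fun_continuous_derivative[OF t] continuous_on_subset by blast
    have c\<psi>: "continuous_on P \<psi>" using test_fun_continuous[OF t] continuous_on_subset by blast
    have cH': "continuous_on P (\<lambda>x. H x (axis i 1))" for i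
      using continuous_on_vec_lambda[of P "\<lambda>l x. H x (axis i 1) $ l"] cH by simp
    have gi: "((\<lambda>x. g x $ i) has_derivative (\<lambda>h. H x h $ i)) (at x)" if "x \<in> P" for x i
      by (rule bounded_linear.has_derivative[OF bounded_linear_vec_nth dg[OF that]])
    define D1 where "D1 x h = ((g x \<bullet> g x) + x $ k) * D x h + ((g x \<bullet> H x h + H x h \<bullet> g x) + h $ k) * \<psi> x" for x h
    have d1: "((\<lambda>x. ((g x \<bullet> g x) + x $ k) * \<psi> x) has_derivative D1 x) (at x)" if x: "x \<in> P" for x
      unfolding D1_def[abs_def]
      by (rule has_derivative_mult[OF has_derivative_add[OF has_derivative_inner[OF dg[OF x] dg[OF x]]
            bounded_linear.has_derivative[OF bounded_linear_vec_nth has_derivative_ident]] test_fun_derivative[OF t]])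
    have I1: "set_integrable lborel P (\<lambda>x. D1 x (axis j 1))" "(LINT x:P|lborel. D1 x (axis j 1)) = 0"
      by (rule integral_directional_derivative_eq_0[OF open_P K _ d1];
          (simp add: \<psi>0)?; (unfold D1_def, intro continuous_intros continuous_on_g cH' cD c\<psi>)?)+
    define D2 where "D2 i x h = g x $ j * (g x $ i * D x h + H x h $ i * \<psi> x) + H x h $ j * (g x $ i * \<psi> x)" for i x h
    have d2: "((\<lambda>x. g x $ j * (g x $ i * \<psi> x)) has_derivative D2 i x) (at x)" if x: "x \<in> P" for x i
      unfolding D2_def[abs_def]
      by (rule has_derivative_mult[OF gi[OF x] has_derivative_mult[OF gi[OF x] test_fun_derivative[OF t]]])
    have I2: "set_integrable lborel P (\<lambda>x. D2 i x (axis i 1))" "(LINT x:P|lborel. D2 i x (axis i 1)) = 0" for i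
      by (rule integral_directional_derivative_eq_0[OF open_P K _ d2];
          (simp add: \<psi>0)?; (unfold D2_def, intro continuous_intros continuous_on_g cH cD c\<psi>)?)+
    have sI2: "set_integrable lborel P (\<lambda>x. \<Sum>i\<in>UNIV. D2 i x (axis i 1))" "(LINT x:P|lborel. (\<Sum>i\<in>UNIV. D2 i x (axis i 1))) = 0"
    proof -
      have i: "integrable lborel (\<lambda>x. indicator P x *\<^sub>R D2 i x (axis i 1))" for i
        using I2(1) by (simp only: set_integrable_def)
      have z: "(LINT x|lborel. indicator P x *\<^sub>R D2 i x (axis i 1)) = 0" for i
        using I2(2) by (simp only: set_lebesgue_integral_def)
      show "set_integrable lborel P (\<lambda>x. \<Sum>i\<in>UNIV. D2 i x (axis i 1))"
        unfolding set_integrable_def scaleR_sum_right by (rule Bochner_Integration.integrable_sum) (rule i)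
      show "(LINT x:P|lborel. (\<Sum>i\<in>UNIV. D2 i x (axis i 1))) = 0"
        unfolding set_lebesgue_integral_def scaleR_sum_right Bochner_Integration.integral_sum[OF i] z by simp
    qed
    have J: "set_integrable lborel P ?J"
    proof (rule set_integrable_continuous_P[OF _ K])
      show "continuous_on P ?J"
        unfolding test_fun_apply[OF t, of _ "g _"] by (intro continuous_intros cD continuous_on_g c\<psi>)
    qed (simp add: \<psi>0 test_fun_derivative_zero[OF t])
    have eq: "g x $ j * lapl x * \<psi> x = 1/2 * (?J x - (D1 x (axis j 1) - 2 * (\<Sum>i\<in>UNIV. D2 i x (axis i 1))))" if x: "x \<in> P" for x
    proof -
      define T where "T = (\<Sum>i\<in>UNIV. H x (axis i 1) $ j * g x $ i)"
      have gH: "g x \<bullet> H x (axis j 1) = T"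
        unfolding T_def inner_vec_def using hessian_symmetric[OF x] by (auto intro!: sum.cong simp: mult.commute)
      have s: "(\<Sum>i\<in>UNIV. D2 i x (axis i 1)) = g x $ j * D x (g x) + g x $ j * lapl x * \<psi> x + T * \<psi> x"
        unfolding D2_def test_fun_apply[OF t, of x "g x"] lapl_def T_def
        by (simp add: sum.distrib sum_distrib_left sum_distrib_right algebra_simps)
      have D1x: "D1 x (axis j 1) = ((norm (g x))\<^sup>2 + x $ k) * D x (axis j 1) + (2 * T + axis j 1 $ k) * \<psi> x"
        unfolding D1_def by (simp add: gH inner_commute[of "H x (axis j 1)"] power2_norm_eq_inner)
      show ?thesis unfolding s D1x by (simp add: algebra_simps)
    qed
    have "(LINT x|lborel. ?f x * \<psi> x) = (LINT x:P|lborel. 1/2 * (?J x - (D1 x (axis j 1) - 2 * (\<Sum>i\<in>UNIV. D2 i x (axis i 1)))))"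
      unfolding set_lebesgue_integral_def
    proof (rule Bochner_Integration.integral_cong[OF refl])
      fix x show "?f x * \<psi> x = indicator P x *\<^sub>R (1/2 * (?J x - (D1 x (axis j 1) - 2 * (\<Sum>i\<in>UNIV. D2 i x (axis i 1)))))"
        using eq[of x] by (cases "x \<in> P") simp_all
    qed
    also have "\<dots> = 1/2 * ((LINT x:P|lborel. ?J x) - ((LINT x:P|lborel. D1 x (axis j 1)) - 2 * (LINT x:P|lborel. (\<Sum>i\<in>UNIV. D2 i x (axis i 1)))))"
      using J I1(1) sI2(1) by (simp add: set_integral_diff)
    also have "\<dots> = 0" using variation_in_P[OF t K(2), of j] I1(2) sI2(2) by simp
    finally show "(LINT x|lborel. ?f x * \<psi> x) = 0" .
  qed
  then show "AE x in lborel. x \<in> P \<longrightarrow> g x $ j * lapl x = 0" by eventually_elim auto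
qed

text \<open>Where the Laplacian is nonzero, \<open>g\<close> vanishes on a whole neighbourhood by
  the previous lemma; then the Hessian vanishes there, and so does its trace.\<close>

lemma laplacian_zero:
  assumes x: "x \<in> P"
  shows "lapl x = 0"
proof (rule ccontr)
  assume "lapl x \<noteq> 0"
  define U where "U = P \<inter> lapl -` (- {0})"
  have oU: "open U" unfolding U_def by (rule continuous_open_preimage[OF continuous_on_lapl open_P]) auto
  have xU: "x \<in> U" using x \<open>lapl x \<noteq> 0\<close> by (simp add: U_def)
  have g0: "g y = 0" if "y \<in> U" for y
    using gradient_times_laplacian_zero[of y] that by (auto simp: U_def vec_eq_iff)
  have "((\<lambda>y. 0) has_derivative H x) (at x)"
    by (rule has_derivative_transform_within_open[OF dg[OF x] oU xU]) (simp add: g0)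
  then have "H x = (\<lambda>h. 0)" by (rule has_derivative_unique) simp
  then show False using \<open>lapl x \<noteq> 0\<close> by (simp add: lapl_def)
qed

section \<open>Energy identity and weak derivative of the square\<close>

lemma set_integrable_indicator_P_mult:
  fixes f f' :: "real^'n \<Rightarrow> real"
  assumes f: "integrable lborel f" and eq: "AE x in lborel. x \<in> P \<longrightarrow> f x = f' x" and c: "continuous_on P f'"
  shows "set_integrable lborel P f'"
proof -
  have "set_integrable lborel P f" by (rule set_integrable_of_integrable[OF f]) simp
  then have i: "integrable lborel (\<lambda>x. indicator P x *\<^sub>R f x)" by (simp only: set_integrable_def)
  show ?thesis unfolding set_integrable_def
  proof (rule integrable_cong_AE[THEN iffD1, OF _ _ _ i])
    show "(\<lambda>x. indicat_real P x *\<^sub>R f x) \<in> borel_measurable lborel" using i by (rule borel_measurable_integrable)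
    show "(\<lambda>x. indicat_real P x *\<^sub>R f' x) \<in> borel_measurable lborel" using borel_measurable_indicator_P[OF c] by simp
    show "AE x in lborel. indicat_real P x *\<^sub>R f x = indicat_real P x *\<^sub>R f' x" using eq by eventually_elim (auto simp: indicator_def)
  qed
qed

lemma integral_P_eq_integral:
  fixes F f' :: "real^'n \<Rightarrow> real"
  assumes F: "integrable lborel F" and c: "continuous_on P f'"
    and eq: "AE x in lborel. x \<in> P \<longrightarrow> F x = f' x" "AE x in lborel. x \<notin> P \<longrightarrow> F x = 0"
  shows "(LINT x:P|lborel. f' x) = (LINT x|lborel. F x)"
  unfolding set_lebesgue_integral_def
proof (rule integral_cong_AE)
  show "(\<lambda>x. indicator P x *\<^sub>R f' x) \<in> borel_measurable lborel" using borel_measurable_indicator_P[OF c] by simp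
  show "AE x in lborel. indicat_real P x *\<^sub>R f' x = F x" using eq by eventually_elim (auto simp: indicator_def)
qed (use F in auto)

lemma AE_Du_zero_off_P: "AE x in lborel. x \<in> \<Omega> \<longrightarrow> x \<notin> P \<longrightarrow> Du x = 0 \<and> u x = 0"
  using grad_zero_AE
proof eventually_elim
  case (elim x)
  then show ?case using u_nonneg[of x] by (auto simp: P_def)
qed

text \<open>Formally this is \<open>u\<close> times its Laplacian, tested with \<eta>, whose support
  may cross the free boundary. The truncated identity is applied to each
  \<open>g x $ i * \<eta> x\<close> in its own direction \<open>axis i 1\<close>.\<close>

lemma energy_identity:
  assumes t: "test_fun \<eta> D K" and K: "K \<subseteq> \<Omega>"
  shows "integrable lborel (\<lambda>x. (norm (Du x))\<^sup>2 * \<eta> x)" "integrable lborel (\<lambda>x. u x * D x (Du x))"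
    and "(LINT x|lborel. (norm (Du x))\<^sup>2 * \<eta> x + u x * D x (Du x)) = 0"
proof -
  note Kc = test_fun_compact[OF t]
  show i1: "integrable lborel (\<lambda>x. (norm (Du x))\<^sup>2 * \<eta> x)"
    by (rule integrable_mult_compact_support[OF set_integrable_Du_sq[OF Kc K] Kc test_fun_continuous[OF t] test_fun_zero[OF t]])
  have "integrable lborel (\<lambda>x. (u x * Du x $ i) * D x (axis i 1))" for i
    by (rule integrable_mult_compact_support[OF set_integrable_u_Du[OF Kc K] Kc test_fun_continuous_derivative[OF t] test_fun_derivative_zero[OF t]])
  then have "integrable lborel (\<lambda>x. \<Sum>i\<in>UNIV. (u x * Du x $ i) * D x (axis i 1))" by (intro Bochner_Integration.integrable_sum)
  moreover have "(\<lambda>x. \<Sum>i\<in>UNIV. (u x * Du x $ i) * D x (axis i 1)) = (\<lambda>x. u x * D x (Du x))"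
    by (auto simp: test_fun_apply[OF t, of _ "Du _"] sum_distrib_left mult.assoc)
  ultimately show i2: "integrable lborel (\<lambda>x. u x * D x (Du x))" by simp
  have cD: "continuous_on P (\<lambda>x. D x h)" for h using test_fun_continuous_derivative[OF t] continuous_on_subset by blast
  have c\<eta>: "continuous_on P \<eta>" using test_fun_continuous[OF t] continuous_on_subset by blast
  have cDg: "continuous_on P (\<lambda>x. D x (g x))"
    unfolding test_fun_apply[OF t, of _ "g _"] by (intro continuous_intros cD continuous_on_g)
  have c1: "continuous_on P (\<lambda>x. (norm (g x))\<^sup>2 * \<eta> x)" by (intro continuous_intros continuous_on_g c\<eta>)
  have c2: "continuous_on P (\<lambda>x. u x * D x (g x))" by (intro continuous_intros continuous_on_u_P cDg)
  have A: "set_integrable lborel P (\<lambda>x. (norm (g x))\<^sup>2 * \<eta> x)"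
    by (rule set_integrable_indicator_P_mult[OF i1 _ c1]) (use grad_eq_AE in \<open>eventually_elim, auto\<close>)
  have B: "set_integrable lborel P (\<lambda>x. u x * D x (g x))"
    by (rule set_integrable_indicator_P_mult[OF i2 _ c2]) (use grad_eq_AE in \<open>eventually_elim, auto\<close>)
  have "(LINT x:P|lborel. (norm (g x))\<^sup>2 * \<eta> x + u x * D x (g x)) = 0"
  proof (rule gamma_limit[OF A B])
    fix \<epsilon> :: real assume \<epsilon>: "\<epsilon> > 0"
    define Dp where "Dp i x h = g x $ i * D x h + H x h $ i * \<eta> x" for i x h
    have gi: "((\<lambda>x. g x $ i) has_derivative (\<lambda>h. H x h $ i)) (at x)" if "x \<in> P" for x i
      by (rule bounded_linear.has_derivative[OF bounded_linear_vec_nth dg[OF that]])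
    have dp: "((\<lambda>x. g x $ i * \<eta> x) has_derivative Dp i x) (at x)" if "x \<in> P" for x i
      unfolding Dp_def[abs_def] by (rule has_derivative_mult[OF gi[OF that] test_fun_derivative[OF t]])
    have cp: "continuous_on P (\<lambda>x. Dp i x (axis i 1))" for i
      unfolding Dp_def by (intro continuous_intros continuous_on_g cD cH c\<eta>)
    have zp: "g x $ i * \<eta> x = 0" if "x \<notin> K" for x i using test_fun_zero[OF t that] by simp
    let ?I = "\<lambda>i x. gq \<epsilon> (u x) * (2 - gq \<epsilon> (u x)) * ((g x \<bullet> axis i 1) * (g x $ i * \<eta> x)) + (gq \<epsilon> (u x))\<^sup>2 * (u x * Dp i x (axis i 1))"
    have I: "set_integrable lborel P (?I i)" "(LINT x:P|lborel. ?I i x) = 0" for i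
      using gamma_identity[OF \<epsilon> Kc K dp cp zp] by auto
    \<comment> \<open>The sum over \<open>i\<close> is formed before \<epsilon> tends to 0. For a
      single Hessian term no integrable bound is at hand, but in the sum the Hessian enters only
      through the Laplacian, which vanishes.\<close>
    have "(LINT x:P|lborel. (\<Sum>i\<in>UNIV. ?I i x)) = (\<Sum>i\<in>UNIV. LINT x:P|lborel. ?I i x)"
      unfolding set_lebesgue_integral_def scaleR_sum_right
      by (rule Bochner_Integration.integral_sum) (use I(1) in \<open>simp only: set_integrable_def\<close>)
    also have "\<dots> = 0" using I(2) by simp
    finally have z: "(LINT x:P|lborel. (\<Sum>i\<in>UNIV. ?I i x)) = 0" .
    have "(\<Sum>i\<in>UNIV. ?I i x) = gq \<epsilon> (u x) * (2 - gq \<epsilon> (u x)) * ((norm (g x))\<^sup>2 * \<eta> x) + (gq \<epsilon> (u x))\<^sup>2 * (u x * D x (g x))" if x: "x \<in> P" for x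
    proof -
      have "(\<Sum>i\<in>UNIV. Dp i x (axis i 1)) = D x (g x) + lapl x * \<eta> x"
        unfolding Dp_def test_fun_apply[OF t, of x "g x"] lapl_def by (simp add: sum.distrib sum_distrib_right)
      then have s1: "(\<Sum>i\<in>UNIV. Dp i x (axis i 1)) = D x (g x)" using laplacian_zero[OF x] by simp
      have s2: "(\<Sum>i\<in>UNIV. (g x \<bullet> axis i 1) * (g x $ i * \<eta> x)) = (norm (g x))\<^sup>2 * \<eta> x"
        by (simp add: norm_sq_eq_sum inner_axis sum_distrib_right mult.assoc)
      show ?thesis unfolding sum.distrib sum_distrib_left[symmetric] s1 s2 ..
    qed
    then have "(LINT x:P|lborel. (\<Sum>i\<in>UNIV. ?I i x)) = (LINT x:P|lborel. gq \<epsilon> (u x) * (2 - gq \<epsilon> (u x)) * ((norm (g x))\<^sup>2 * \<eta> x) + (gq \<epsilon> (u x))\<^sup>2 * (u x * D x (g x)))"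
      by (intro set_lebesgue_integral_cong) auto
    then show "(LINT x:P|lborel. gq \<epsilon> (u x) * (2 - gq \<epsilon> (u x)) * ((norm (g x))\<^sup>2 * \<eta> x) + (gq \<epsilon> (u x))\<^sup>2 * (u x * D x (g x))) = 0"
      using z by simp
  qed
  moreover have "(LINT x:P|lborel. (norm (g x))\<^sup>2 * \<eta> x + u x * D x (g x)) = (LINT x|lborel. (norm (Du x))\<^sup>2 * \<eta> x + u x * D x (Du x))"
  proof (rule integral_P_eq_integral)
    show "AE x in lborel. x \<notin> P \<longrightarrow> (norm (Du x))\<^sup>2 * \<eta> x + u x * D x (Du x) = 0"
      using AE_Du_zero_off_P
    proof eventually_elim
      case (elim x)
      then show ?case using test_fun_zero[OF t, of x] test_fun_derivative_zero[OF t, of x] K by (cases "x \<in> K") auto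
    qed
    show "AE x in lborel. x \<in> P \<longrightarrow> (norm (Du x))\<^sup>2 * \<eta> x + u x * D x (Du x) = (norm (g x))\<^sup>2 * \<eta> x + u x * D x (g x)"
      using grad_eq_AE by eventually_elim auto
  qed (use i1 i2 c1 c2 in \<open>auto intro: continuous_intros\<close>)
  ultimately show "(LINT x|lborel. (norm (Du x))\<^sup>2 * \<eta> x + u x * D x (Du x)) = 0" by simp
qed

lemma set_integrable_u_sq:
  assumes "compact K" "K \<subseteq> \<Omega>"
  shows "set_integrable lborel K (\<lambda>x. (u x)\<^sup>2)"
  unfolding set_integrable_def using assms cu by (intro borel_integrable_compact) (auto intro!: continuous_intros intro: continuous_on_subset)

text \<open>Taking \<open>p = u * \<psi>\<close> in the truncated identity replaces a product rule
  for weak derivatives. Summed over the components of a radial field, the result becomes the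
  divergence theorem for \<open>u\<^sup>2\<close>.\<close>

lemma square_identity:
  assumes t: "test_fun \<psi> D K" and K: "K \<subseteq> \<Omega>"
  shows "integrable lborel (\<lambda>x. u x * Du x $ i * \<psi> x)" "integrable lborel (\<lambda>x. (u x)\<^sup>2 * D x (axis i 1))"
    and "(LINT x|lborel. 2 * (u x * Du x $ i * \<psi> x) + (u x)\<^sup>2 * D x (axis i 1)) = 0"
proof -
  note Kc = test_fun_compact[OF t]
  let ?e = "axis i 1 :: real^'n"
  show i1: "integrable lborel (\<lambda>x. u x * Du x $ i * \<psi> x)"
    by (rule integrable_mult_compact_support[OF set_integrable_u_Du[OF Kc K] Kc test_fun_continuous[OF t] test_fun_zero[OF t]])
  show i2: "integrable lborel (\<lambda>x. (u x)\<^sup>2 * D x ?e)"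
    by (rule integrable_mult_compact_support[OF set_integrable_u_sq[OF Kc K] Kc test_fun_continuous_derivative[OF t] test_fun_derivative_zero[OF t]])
  have cD: "continuous_on P (\<lambda>x. D x h)" for h using test_fun_continuous_derivative[OF t] continuous_on_subset by blast
  have c\<psi>: "continuous_on P \<psi>" using test_fun_continuous[OF t] continuous_on_subset by blast
  define Dp where "Dp x h = u x * D x h + (g x \<bullet> h) * \<psi> x" for x h
  have dp: "((\<lambda>x. u x * \<psi> x) has_derivative Dp x) (at x)" if "x \<in> P" for x
    unfolding Dp_def[abs_def] by (rule has_derivative_mult[OF du[OF that] test_fun_derivative[OF t]])
  have cp: "continuous_on P (\<lambda>x. Dp x ?e)" unfolding Dp_def by (intro continuous_intros continuous_on_g continuous_on_u_P cD c\<psi>)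
  have c1: "continuous_on P (\<lambda>x. (g x \<bullet> ?e) * (u x * \<psi> x))" by (intro continuous_intros continuous_on_g continuous_on_u_P c\<psi>)
  have c2: "continuous_on P (\<lambda>x. u x * Dp x ?e)" by (intro continuous_intros continuous_on_u_P cp)
  have A: "set_integrable lborel P (\<lambda>x. (g x \<bullet> ?e) * (u x * \<psi> x))"
    by (rule set_integrable_indicator_P_mult[OF i1 _ c1]) (use grad_eq_AE in \<open>eventually_elim, auto simp: inner_axis\<close>)
  have i3: "integrable lborel (\<lambda>x. (u x)\<^sup>2 * D x ?e + u x * Du x $ i * \<psi> x)" by (intro Bochner_Integration.integrable_add i1 i2)
  have B: "set_integrable lborel P (\<lambda>x. u x * Dp x ?e)"
    by (rule set_integrable_indicator_P_mult[OF i3 _ c2])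
       (use grad_eq_AE in \<open>eventually_elim, auto simp: inner_axis Dp_def power2_eq_square algebra_simps\<close>)
  have "(LINT x:P|lborel. (g x \<bullet> ?e) * (u x * \<psi> x) + u x * Dp x ?e) = 0"
  proof (rule gamma_limit[OF A B], rule gamma_identity(2)[OF _ Kc K dp cp])
    show "u x * \<psi> x = 0" if "x \<notin> K" for x using test_fun_zero[OF t that] by simp
  qed
  moreover have "(LINT x:P|lborel. (g x \<bullet> ?e) * (u x * \<psi> x) + u x * Dp x ?e) = (LINT x|lborel. 2 * (u x * Du x $ i * \<psi> x) + (u x)\<^sup>2 * D x ?e)"
  proof (rule integral_P_eq_integral)
    show "AE x in lborel. x \<notin> P \<longrightarrow> 2 * (u x * Du x $ i * \<psi> x) + (u x)\<^sup>2 * D x ?e = 0"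
      using AE_Du_zero_off_P
    proof eventually_elim
      case (elim x)
      then show ?case using test_fun_zero[OF t, of x] test_fun_derivative_zero[OF t, of x] K by (cases "x \<in> K") auto
    qed
    show "AE x in lborel. x \<in> P \<longrightarrow> 2 * (u x * Du x $ i * \<psi> x) + (u x)\<^sup>2 * D x ?e = (g x \<bullet> ?e) * (u x * \<psi> x) + u x * Dp x ?e"
      using grad_eq_AE by eventually_elim (auto simp: inner_axis Dp_def power2_eq_square algebra_simps)
  qed (use i1 i2 c1 c2 in \<open>auto intro: continuous_intros\<close>)
  ultimately show "(LINT x|lborel. 2 * (u x * Du x $ i * \<psi> x) + (u x)\<^sup>2 * D x ?e) = 0" by simp
qed

end

section \<open>Radial fields and integral identities on balls\<close>

text \<open>The scalar profile is the test function for the energy identity; its products with the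
  coordinates of \<open>x - x0\<close> are the components of the cut-off dilation field, used in the
  square identity.\<close>

lemma test_fun_radial:
  fixes x0 :: "real^'n"
  assumes \<kappa>: "\<And>t. (\<kappa> has_real_derivative \<kappa>' t) (at t)" "continuous_on UNIV \<kappa>'" "0 < \<rho>" "\<And>t. t \<ge> \<rho>\<^sup>2 \<Longrightarrow> \<kappa> t = 0"
  shows "test_fun (\<lambda>x. \<kappa> ((norm (x - x0))\<^sup>2)) (\<lambda>x h. 2 * \<kappa>' ((norm (x - x0))\<^sup>2) * ((x - x0) \<bullet> h)) (cball x0 \<rho>)"
    and "test_fun (\<lambda>x. \<kappa> ((norm (x - x0))\<^sup>2) * (x - x0) $ i)
      (\<lambda>x h. \<kappa> ((norm (x - x0))\<^sup>2) * h $ i + 2 * \<kappa>' ((norm (x - x0))\<^sup>2) * ((x - x0) \<bullet> h) * (x - x0) $ i) (cball x0 \<rho>)"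
proof -
  have ck: "continuous_on UNIV \<kappa>" using \<kappa>(1) by (meson DERIV_isCont continuous_at_imp_continuous_on)
  have d: "((\<lambda>x. \<kappa> ((norm (x - x0))\<^sup>2)) has_derivative (\<lambda>h. 2 * \<kappa>' ((norm (x - x0))\<^sup>2) * ((x - x0) \<bullet> h))) (at x)" for x
  proof -
    have "((\<lambda>x. (x - x0) \<bullet> (x - x0)) has_derivative (\<lambda>h. 2 * ((x - x0) \<bullet> h))) (at x)"
      by (auto intro!: derivative_eq_intros simp: inner_commute)
    from has_derivative_compose[OF this[folded power2_norm_eq_inner] \<kappa>(1)[unfolded has_field_derivative_def]]
    show ?thesis by (simp add: mult_ac)
  qed
  have z: "\<kappa> ((norm (x - x0))\<^sup>2) = 0" if "x \<notin> cball x0 \<rho>" for x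
  proof -
    have "\<rho>\<^sup>2 \<le> (norm (x - x0))\<^sup>2" using that \<kappa>(3) by (intro power_mono) (auto simp: dist_norm norm_minus_commute)
    then show ?thesis by (rule \<kappa>(4))
  qed
  have c: "continuous_on UNIV (\<lambda>x. \<kappa> ((norm (x - x0))\<^sup>2))" "continuous_on UNIV (\<lambda>x. \<kappa>' ((norm (x - x0))\<^sup>2))"
    by (auto intro!: continuous_on_compose2[OF ck] continuous_on_compose2[OF \<kappa>(2)] continuous_intros)
  show "test_fun (\<lambda>x. \<kappa> ((norm (x - x0))\<^sup>2)) (\<lambda>x h. 2 * \<kappa>' ((norm (x - x0))\<^sup>2) * ((x - x0) \<bullet> h)) (cball x0 \<rho>)"
    unfolding test_fun_def using d z by (auto intro!: continuous_intros c)
  have "((\<lambda>x. (x - x0) $ i) has_derivative (\<lambda>h. h $ i)) (at x)" for x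
    by (rule bounded_linear.has_derivative[OF bounded_linear_vec_nth]) (auto intro!: derivative_eq_intros)
  from has_derivative_mult[OF d this]
  show "test_fun (\<lambda>x. \<kappa> ((norm (x - x0))\<^sup>2) * (x - x0) $ i)
      (\<lambda>x h. \<kappa> ((norm (x - x0))\<^sup>2) * h $ i + 2 * \<kappa>' ((norm (x - x0))\<^sup>2) * ((x - x0) \<bullet> h) * (x - x0) $ i) (cball x0 \<rho>)"
    unfolding test_fun_def using z by (auto intro!: continuous_intros c)
qed

lemma C1c_field_radial:
  fixes x0 :: "real^'n"
  assumes \<kappa>: "\<And>t. (\<kappa> has_real_derivative \<kappa>' t) (at t)" "continuous_on UNIV \<kappa>'" "0 < \<rho>" "\<And>t. t \<ge> \<rho>\<^sup>2 \<Longrightarrow> \<kappa> t = 0"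
    and sub: "cball x0 \<rho> \<subseteq> \<Omega>"
  defines "\<phi> \<equiv> \<lambda>x. \<kappa> ((norm (x - x0))\<^sup>2) *\<^sub>R (x - x0)"
  shows "C1c_field \<Omega> \<phi>"
    and "frechet_derivative \<phi> (at x) = (\<lambda>h. \<kappa> ((norm (x - x0))\<^sup>2) *\<^sub>R h + (2 * \<kappa>' ((norm (x - x0))\<^sup>2) * ((x - x0) \<bullet> h)) *\<^sub>R (x - x0))"
    and "divg \<phi> x = real CARD('n) * \<kappa> ((norm (x - x0))\<^sup>2) + 2 * \<kappa>' ((norm (x - x0))\<^sup>2) * (norm (x - x0))\<^sup>2"
proof -
  note t = test_fun_radial(1)[OF \<kappa>, of x0]
  define D where "D x h = \<kappa> ((norm (x - x0))\<^sup>2) *\<^sub>R h + (2 * \<kappa>' ((norm (x - x0))\<^sup>2) * ((x - x0) \<bullet> h)) *\<^sub>R (x - x0)" for x h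
  have d: "(\<phi> has_derivative D x) (at x)" for x
    unfolding \<phi>_def D_def[abs_def]
    by (rule has_derivative_scaleR[OF test_fun_derivative[OF t]]) (auto intro!: derivative_eq_intros)
  have ck: "continuous_on UNIV \<kappa>" using \<kappa>(1) by (meson DERIV_isCont continuous_at_imp_continuous_on)
  have c: "continuous_on UNIV (\<lambda>x. \<kappa> ((norm (x - x0))\<^sup>2))" "continuous_on UNIV (\<lambda>x. \<kappa>' ((norm (x - x0))\<^sup>2))"
    by (auto intro!: continuous_on_compose2[OF ck] continuous_on_compose2[OF \<kappa>(2)] continuous_intros)
  have cD: "continuous_on UNIV (\<lambda>x. D x (axis j 1) $ i)" for i j
    unfolding D_def by (intro continuous_intros c)
  have ts: "tsupp \<phi> \<subseteq> cball x0 \<rho>" unfolding tsupp_def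
  proof (rule closure_minimal)
    have "\<phi> x = 0" if "x \<notin> cball x0 \<rho>" for x using test_fun_zero[OF t that] by (simp add: \<phi>_def)
    then show "{x. \<phi> x \<noteq> 0} \<subseteq> cball x0 \<rho>" by blast
  qed simp
  then have "compact (tsupp \<phi>)"
    by (metis closed_closure compact_Int_closed compact_cball inf.absorb2 tsupp_def)
  then show "C1c_field \<Omega> \<phi>" unfolding C1c_field_def using d cD ts sub by blast
  show f: "frechet_derivative \<phi> (at x) = (\<lambda>h. \<kappa> ((norm (x - x0))\<^sup>2) *\<^sub>R h + (2 * \<kappa>' ((norm (x - x0))\<^sup>2) * ((x - x0) \<bullet> h)) *\<^sub>R (x - x0))" for x
    using frechet_derivative_at[OF d, of x] by (simp add: D_def[abs_def])
  have "(\<Sum>i\<in>UNIV. (x - x0) $ i * (x - x0) $ i) = (norm (x - x0))\<^sup>2" by (simp add: power2_norm_eq_inner inner_vec_def)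
  moreover have "divg \<phi> x = (\<Sum>i\<in>UNIV. \<kappa> ((norm (x - x0))\<^sup>2) + 2 * \<kappa>' ((norm (x - x0))\<^sup>2) * ((x - x0) $ i * (x - x0) $ i))"
    unfolding divg_def f by (rule sum.cong) (auto simp: inner_axis)
  ultimately show "divg \<phi> x = real CARD('n) * \<kappa> ((norm (x - x0))\<^sup>2) + 2 * \<kappa>' ((norm (x - x0))\<^sup>2) * (norm (x - x0))\<^sup>2"
    by (simp only: sum.distrib sum_distrib_left[symmetric] sum_constant)
qed

locale variational_ball = variational k \<Omega> u Du g H P
  for k :: "'n::finite" and \<Omega> u Du g H P +
  fixes x0 :: "real^'n" and R :: real
  assumes R: "0 < R" and ball_sub: "cball x0 R \<subseteq> \<Omega>" and x0k: "x0 $ k = 0"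
begin

lemma chi_measurable[measurable]: "chi_pos u \<in> borel_measurable borel"
  unfolding chi_pos_def[abs_def] by measurable

lemma set_integrable_ball:
  assumes "f \<in> borel_measurable borel" "\<And>x. x \<in> cball x0 R \<Longrightarrow> \<bar>f x\<bar> \<le> C * (1 + (norm (Du x))\<^sup>2)"
  shows "set_integrable lborel (ball x0 R) f"
  by (rule set_integrable_subset[OF set_integrable_compact[OF compact_cball ball_sub assms(1)]]) (use assms(2) in auto)

lemma integrable_ball_basic:
  shows "set_integrable lborel (ball x0 R) (\<lambda>x. (norm (Du x))\<^sup>2)"
    and "set_integrable lborel (ball x0 R) (\<lambda>x. (u x)\<^sup>2)"
    and "set_integrable lborel (ball x0 R) (\<lambda>x. u x * (Du x \<bullet> (x - x0)))"
    and "set_integrable lborel (ball x0 R) (\<lambda>x. (Du x \<bullet> (x - x0))\<^sup>2)"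
    and "set_integrable lborel (ball x0 R) (\<lambda>x. x $ k * chi_pos u x)"
    and "set_integrable lborel (ball x0 R) (\<lambda>x. max (x $ k) 0)"
    and "set_integrable lborel (ball x0 R) (\<lambda>x. max (x $ k) 0 * (1 - chi_pos u x))"
proof -
  obtain B where B: "B \<ge> 0" "\<And>x. x \<in> cball x0 R \<Longrightarrow> \<bar>u x\<bar> \<le> B" using u_bounded[OF compact_cball ball_sub] by blast
  have ip: "\<bar>Du x \<bullet> (x - x0)\<bar> \<le> norm (Du x) * R" if "x \<in> cball x0 R" for x
  proof -
    have "\<bar>Du x \<bullet> (x - x0)\<bar> \<le> norm (Du x) * norm (x - x0)" by (rule Cauchy_Schwarz_ineq2)
    also have "\<dots> \<le> norm (Du x) * R" using that by (intro mult_left_mono) (auto simp: dist_norm norm_minus_commute)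
    finally show ?thesis .
  qed
  have xk: "\<bar>x $ k\<bar> \<le> R" if "x \<in> cball x0 R" for x
  proof -
    have "\<bar>x $ k\<bar> = \<bar>(x - x0) $ k\<bar>" using x0k by simp
    also have "\<dots> \<le> norm (x - x0)" by (rule component_le_norm_cart)
    finally show ?thesis using that by (simp add: dist_norm norm_minus_commute)
  qed
  have n1: "1 \<le> 1 + (norm (Du x))\<^sup>2" for x by simp
  show "set_integrable lborel (ball x0 R) (\<lambda>x. (norm (Du x))\<^sup>2)"
    by (rule set_integrable_ball[where C=1]) auto
  show "set_integrable lborel (ball x0 R) (\<lambda>x. (u x)\<^sup>2)"
  proof (rule set_integrable_ball[where C="B\<^sup>2"])
    fix x assume x: "x \<in> cball x0 R"
    have "\<bar>(u x)\<^sup>2\<bar> \<le> B\<^sup>2 * 1" using power_mono[OF B(2)[OF x], of 2] by simp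
    also have "\<dots> \<le> B\<^sup>2 * (1 + (norm (Du x))\<^sup>2)" by (intro mult_left_mono n1) simp
    finally show "\<bar>(u x)\<^sup>2\<bar> \<le> B\<^sup>2 * (1 + (norm (Du x))\<^sup>2)" .
  qed measurable
  show "set_integrable lborel (ball x0 R) (\<lambda>x. u x * (Du x \<bullet> (x - x0)))"
  proof (rule set_integrable_ball[where C="B * R"])
    fix x assume x: "x \<in> cball x0 R"
    have "\<bar>u x * (Du x \<bullet> (x - x0))\<bar> \<le> B * (norm (Du x) * R)"
      unfolding abs_mult using B(1) B(2)[OF x] ip[OF x] by (intro mult_mono) auto
    also have "\<dots> = B * R * norm (Du x)" by simp
    also have "\<dots> \<le> B * R * (1 + (norm (Du x))\<^sup>2)" using B(1) R by (intro mult_left_mono norm_le_one_plus_square) auto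
    finally show "\<bar>u x * (Du x \<bullet> (x - x0))\<bar> \<le> B * R * (1 + (norm (Du x))\<^sup>2)" .
  qed measurable
  show "set_integrable lborel (ball x0 R) (\<lambda>x. (Du x \<bullet> (x - x0))\<^sup>2)"
  proof (rule set_integrable_ball[where C="R\<^sup>2"])
    fix x assume x: "x \<in> cball x0 R"
    have "\<bar>(Du x \<bullet> (x - x0))\<^sup>2\<bar> \<le> (norm (Du x) * R)\<^sup>2" using power_mono[OF ip[OF x], of 2] by simp
    also have "\<dots> = R\<^sup>2 * (norm (Du x))\<^sup>2" by (simp add: power_mult_distrib)
    also have "\<dots> \<le> R\<^sup>2 * (1 + (norm (Du x))\<^sup>2)" by (intro mult_left_mono) auto
    finally show "\<bar>(Du x \<bullet> (x - x0))\<^sup>2\<bar> \<le> R\<^sup>2 * (1 + (norm (Du x))\<^sup>2)" .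
  qed measurable
  have le: "\<bar>a\<bar> \<le> R * (1 + (norm (Du x))\<^sup>2)" if "\<bar>a\<bar> \<le> R" for a :: real and x
  proof -
    have "R * 1 \<le> R * (1 + (norm (Du x))\<^sup>2)" using R by (intro mult_left_mono n1) simp
    then show ?thesis using that by simp
  qed
  show "set_integrable lborel (ball x0 R) (\<lambda>x. x $ k * chi_pos u x)"
    by (rule set_integrable_ball[where C=R], measurable, rule le, use xk R in \<open>auto simp: chi_pos_def\<close>)
  show "set_integrable lborel (ball x0 R) (\<lambda>x. max (x $ k) 0)"
    by (rule set_integrable_ball[where C=R], measurable, rule le, use xk R in \<open>force simp: max_def\<close>)
  show "set_integrable lborel (ball x0 R) (\<lambda>x. max (x $ k) 0 * (1 - chi_pos u x))"
    by (rule set_integrable_ball[where C=R], measurable, rule le, use xk R in \<open>force simp: max_def chi_pos_def\<close>)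
qed

lemma integral_ball_eq:
  fixes f :: "real^'n \<Rightarrow> real"
  assumes "\<And>x. x \<notin> cball x0 \<rho> \<Longrightarrow> f x = 0" "\<rho> < R" "cball x0 R \<subseteq> S"
  shows "(LINT x:S|lborel. f x) = (LINT x:ball x0 R|lborel. f x)"
  unfolding set_lebesgue_integral_def
proof (rule Bochner_Integration.integral_cong[OF refl])
  fix x
  show "indicator S x *\<^sub>R f x = indicator (ball x0 R) x *\<^sub>R f x"
  proof (cases "x \<in> cball x0 \<rho>")
    case True
    then have "x \<in> ball x0 R" "x \<in> S" using assms(2,3) by auto
    then show ?thesis by simp
  next
    case False
    then show ?thesis using assms(1) by simp
  qed
qed

text \<open>Green's formula for \<open>u\<close>. The position vector \<open>x - x0\<close> is
  \<open>r\<close> times the unit normal on the sphere, which accounts for the factor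
  \<open>r\<close>.\<close>

lemma radial_energy:
  "AE r in lborel. r \<in> {0<..<R} \<longrightarrow> sphere_int x0 r (\<lambda>x. u x * (Du x \<bullet> (x - x0))) = r * (LINT x:ball x0 r|lborel. (norm (Du x))\<^sup>2)"
proof (rule radial_identity[OF R _ integrable_ball_basic(1) _ integrable_ball_basic(3)])
  fix \<kappa> \<kappa>' \<rho> assume \<kappa>: "\<And>t. (\<kappa> has_real_derivative \<kappa>' t) (at t)" "continuous_on UNIV \<kappa>'" "0 < \<rho>" "\<rho> < R" "\<And>t. t \<ge> \<rho>\<^sup>2 \<Longrightarrow> \<kappa> t = 0"
  note t = test_fun_radial(1)[OF \<kappa>(1-3,5), of x0]
  have sub: "cball x0 \<rho> \<subseteq> \<Omega>" using ball_sub \<kappa>(4) by auto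
  let ?f = "\<lambda>x. (norm (Du x))\<^sup>2 * \<kappa> ((norm (x - x0))\<^sup>2) + u x * (2 * \<kappa>' ((norm (x - x0))\<^sup>2) * ((x - x0) \<bullet> Du x))"
  have "(LINT x:UNIV|lborel. ?f x) = 0"
    using energy_identity(3)[OF t sub] by (simp add: set_lebesgue_integral_def)
  moreover have "(LINT x:UNIV|lborel. ?f x) = (LINT x:ball x0 R|lborel. ?f x)"
    by (rule integral_ball_eq[OF _ \<kappa>(4)])
       (use test_fun_zero[OF t] test_fun_derivative_zero[OF t] in auto)
  moreover have "?f = (\<lambda>x. \<kappa> ((norm (x - x0))\<^sup>2) * (norm (Du x))\<^sup>2 + 2 * \<kappa>' ((norm (x - x0))\<^sup>2) * (u x * (Du x \<bullet> (x - x0))))"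
    by (auto simp: inner_commute mult_ac)
  ultimately show "(LINT x:ball x0 R|lborel. \<kappa> ((norm (x - x0))\<^sup>2) * (norm (Du x))\<^sup>2 + 2 * \<kappa>' ((norm (x - x0))\<^sup>2) * (u x * (Du x \<bullet> (x - x0)))) = 0"
    by simp
qed measurable

text \<open>The divergence theorem for the field \<open>u\<^sup>2\<close> times
  \<open>x - x0\<close>, multiplied by \<open>r\<close>. The factor
  \<open>(norm (x - x0))\<^sup>2\<close> is constant on each sphere and comes from differentiating
  the radial cut-off.\<close>

lemma radial_square:
  "AE r in lborel. r \<in> {0<..<R} \<longrightarrow> sphere_int x0 r (\<lambda>x. (norm (x - x0))\<^sup>2 * (u x)\<^sup>2) =
     r * (LINT x:ball x0 r|lborel. real CARD('n) * (u x)\<^sup>2 + 2 * (u x * (Du x \<bullet> (x - x0))))"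
proof (rule radial_identity[OF R])
  show "set_integrable lborel (ball x0 R) (\<lambda>x. real CARD('n) * (u x)\<^sup>2 + 2 * (u x * (Du x \<bullet> (x - x0))))"
    by (intro set_integral_add(1) set_integrable_mult_right integrable_ball_basic)
  obtain B where B: "B \<ge> 0" "\<And>x. x \<in> cball x0 R \<Longrightarrow> \<bar>u x\<bar> \<le> B" using u_bounded[OF compact_cball ball_sub] by blast
  show "set_integrable lborel (ball x0 R) (\<lambda>x. (norm (x - x0))\<^sup>2 * (u x)\<^sup>2)"
  proof (rule set_integrable_ball[where C="R\<^sup>2 * B\<^sup>2"])
    fix x assume x: "x \<in> cball x0 R"
    have "\<bar>(norm (x - x0))\<^sup>2 * (u x)\<^sup>2\<bar> \<le> R\<^sup>2 * B\<^sup>2"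
      unfolding abs_mult using power_mono[OF B(2)[OF x], of 2] x
      by (intro mult_mono) (auto simp: dist_norm norm_minus_commute intro: power_mono)
    also have "\<dots> \<le> R\<^sup>2 * B\<^sup>2 * (1 + (norm (Du x))\<^sup>2)"
      using mult_left_mono[of 1 "1 + (norm (Du x))\<^sup>2" "R\<^sup>2 * B\<^sup>2"] by simp
    finally show "\<bar>(norm (x - x0))\<^sup>2 * (u x)\<^sup>2\<bar> \<le> R\<^sup>2 * B\<^sup>2 * (1 + (norm (Du x))\<^sup>2)" .
  qed measurable
  fix \<kappa> \<kappa>' \<rho> assume \<kappa>: "\<And>t. (\<kappa> has_real_derivative \<kappa>' t) (at t)" "continuous_on UNIV \<kappa>'" "0 < \<rho>" "\<rho> < R" "\<And>t. t \<ge> \<rho>\<^sup>2 \<Longrightarrow> \<kappa> t = 0"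
  note t = test_fun_radial(2)[OF \<kappa>(1-3,5), of x0]
  note t1 = test_fun_radial(1)[OF \<kappa>(1-3,5), of x0]
  have sub: "cball x0 \<rho> \<subseteq> \<Omega>" using ball_sub \<kappa>(4) by auto
  let ?q = "\<lambda>x. (norm (x - x0))\<^sup>2"
  let ?fi = "\<lambda>i x. 2 * (u x * Du x $ i * (\<kappa> (?q x) * (x - x0) $ i)) + (u x)\<^sup>2 * (\<kappa> (?q x) * axis i 1 $ i + 2 * \<kappa>' (?q x) * ((x - x0) \<bullet> axis i 1) * (x - x0) $ i)"
  let ?f = "\<lambda>x. \<kappa> (?q x) * (real CARD('n) * (u x)\<^sup>2 + 2 * (u x * (Du x \<bullet> (x - x0)))) + 2 * \<kappa>' (?q x) * (?q x * (u x)\<^sup>2)"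
  have fi: "integrable lborel (?fi i)" for i
    by (rule Bochner_Integration.integrable_add[OF integrable_mult_right[OF square_identity(1)[OF t sub]] square_identity(2)[OF t sub]])
  have s: "(\<Sum>i\<in>UNIV. ?fi i x) = ?f x" for x
  proof -
    have "?fi i x = (2 * u x * \<kappa> (?q x)) * (Du x $ i * (x - x0) $ i) + ((u x)\<^sup>2 * \<kappa> (?q x) + ((u x)\<^sup>2 * 2 * \<kappa>' (?q x)) * ((x - x0) $ i * (x - x0) $ i))" for i
      by (simp add: inner_axis algebra_simps)
    moreover have "(\<Sum>i\<in>UNIV. c1 * a i + (c2 + c3 * b i)) = c1 * (\<Sum>i\<in>UNIV. a i) + (real CARD('n) * c2 + c3 * (\<Sum>i\<in>UNIV. b i))"
      for c1 c2 c3 :: real and a b :: "'n \<Rightarrow> real" by (simp add: sum.distrib sum_distrib_left)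
    ultimately have "(\<Sum>i\<in>UNIV. ?fi i x) = (2 * u x * \<kappa> (?q x)) * (\<Sum>i\<in>UNIV. Du x $ i * (x - x0) $ i)
        + (real CARD('n) * ((u x)\<^sup>2 * \<kappa> (?q x)) + ((u x)\<^sup>2 * 2 * \<kappa>' (?q x)) * (\<Sum>i\<in>UNIV. (x - x0) $ i * (x - x0) $ i))"
      by (simp only:)
    also have "(\<Sum>i\<in>UNIV. Du x $ i * (x - x0) $ i) = Du x \<bullet> (x - x0)" by (simp add: inner_vec_def)
    also have "(\<Sum>i\<in>UNIV. (x - x0) $ i * (x - x0) $ i) = ?q x" by (simp add: power2_norm_eq_inner inner_vec_def)
    finally show ?thesis by (simp add: algebra_simps)
  qed
  have "(LINT x|lborel. (\<Sum>i\<in>UNIV. ?fi i x)) = (\<Sum>i\<in>UNIV. LINT x|lborel. ?fi i x)"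
    by (rule Bochner_Integration.integral_sum) (rule fi)
  also have "\<dots> = 0" using square_identity(3)[OF t sub] by (intro sum.neutral ballI)
  finally have "(LINT x:UNIV|lborel. ?f x) = 0" unfolding s by (simp add: set_lebesgue_integral_def)
  moreover have "(LINT x:UNIV|lborel. ?f x) = (LINT x:ball x0 R|lborel. ?f x)"
  proof (rule integral_ball_eq[OF _ \<kappa>(4)])
    fix x assume x: "x \<notin> cball x0 \<rho>"
    \<comment> \<open>Evaluating the vanishing derivative of the profile in the direction
      \<open>x - x0\<close> yields \<open>\<kappa>' = 0\<close> off the support.\<close>
    have "2 * \<kappa>' (?q x) * ((x - x0) \<bullet> (x - x0)) = 0" using test_fun_derivative_zero[OF t1 x] .
    moreover have "x \<noteq> x0" using x \<kappa>(3) by auto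
    ultimately have "\<kappa>' (?q x) = 0" by simp
    then show "?f x = 0" using test_fun_zero[OF t1 x] by simp
  qed simp
  ultimately show "(LINT x:ball x0 R|lborel. ?f x) = 0" by simp
qed measurable

text \<open>The Pohozaev identity, from the cut-off dilation field. Its divergence contributes n to
  both terms; the quadratic term in \<open>Du\<close> lowers the Dirichlet coefficient to n - 2, and
  differentiating the height along the field raises the other one to n + 1.\<close>

lemma radial_variation:
  "AE r in lborel. r \<in> {0<..<R} \<longrightarrow> sphere_int x0 r (\<lambda>x. (norm (x - x0))\<^sup>2 * ((norm (Du x))\<^sup>2 + x $ k * chi_pos u x) - 2 * (Du x \<bullet> (x - x0))\<^sup>2) =
     r * (LINT x:ball x0 r|lborel. (real CARD('n) - 2) * (norm (Du x))\<^sup>2 + (real CARD('n) + 1) * (x $ k * chi_pos u x))"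
proof (rule radial_identity[OF R])
  show "set_integrable lborel (ball x0 R) (\<lambda>x. (real CARD('n) - 2) * (norm (Du x))\<^sup>2 + (real CARD('n) + 1) * (x $ k * chi_pos u x))"
    by (intro set_integral_add(1) set_integrable_mult_right integrable_ball_basic)
  show "set_integrable lborel (ball x0 R) (\<lambda>x. (norm (x - x0))\<^sup>2 * ((norm (Du x))\<^sup>2 + x $ k * chi_pos u x) - 2 * (Du x \<bullet> (x - x0))\<^sup>2)"
  proof (intro set_integral_diff(1) set_integrable_mult_right integrable_ball_basic)
    have i: "set_integrable lborel (ball x0 R) (\<lambda>x. R\<^sup>2 * ((norm (Du x))\<^sup>2 + x $ k * chi_pos u x))"
      by (intro set_integral_add(1) set_integrable_mult_right integrable_ball_basic)
    show "set_integrable lborel (ball x0 R) (\<lambda>x. (norm (x - x0))\<^sup>2 * ((norm (Du x))\<^sup>2 + x $ k * chi_pos u x))"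
    proof (rule set_integrable_bound[OF i])
      show "set_borel_measurable lborel (ball x0 R) (\<lambda>x. (norm (x - x0))\<^sup>2 * ((norm (Du x))\<^sup>2 + x $ k * chi_pos u x))"
        unfolding set_borel_measurable_def by (intro borel_measurable_scaleR borel_measurable_indicator) auto
      show "AE x in lborel. x \<in> ball x0 R \<longrightarrow> norm ((norm (x - x0))\<^sup>2 * ((norm (Du x))\<^sup>2 + x $ k * chi_pos u x)) \<le> norm (R\<^sup>2 * ((norm (Du x))\<^sup>2 + x $ k * chi_pos u x))"
      proof (intro AE_I2 impI)
        fix x assume "x \<in> ball x0 R"
        then have "(norm (x - x0))\<^sup>2 \<le> R\<^sup>2" by (intro power_mono) (auto simp: dist_norm norm_minus_commute)
        then show "norm ((norm (x - x0))\<^sup>2 * ((norm (Du x))\<^sup>2 + x $ k * chi_pos u x)) \<le> norm (R\<^sup>2 * ((norm (Du x))\<^sup>2 + x $ k * chi_pos u x))"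
          unfolding norm_mult by (intro mult_right_mono) auto
      qed
    qed
  qed
  fix \<kappa> \<kappa>' \<rho> assume \<kappa>: "\<And>t. (\<kappa> has_real_derivative \<kappa>' t) (at t)" "continuous_on UNIV \<kappa>'" "0 < \<rho>" "\<rho> < R" "\<And>t. t \<ge> \<rho>\<^sup>2 \<Longrightarrow> \<kappa> t = 0"
  note t = test_fun_radial(1)[OF \<kappa>(1-3,5), of x0]
  have sub: "cball x0 \<rho> \<subseteq> \<Omega>" using ball_sub \<kappa>(4) by auto
  note C = C1c_field_radial[OF \<kappa>(1-3,5) sub]
  have ck: "continuous_on UNIV \<kappa>" using \<kappa>(1) by (meson DERIV_isCont continuous_at_imp_continuous_on)
  have [measurable]: "\<kappa> \<in> borel_measurable borel" "\<kappa>' \<in> borel_measurable borel"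
    using ck \<kappa>(2) by (auto intro: borel_measurable_continuous_onI)
  let ?q = "\<lambda>x. (norm (x - x0))\<^sup>2"
  let ?n = "real CARD('n)"
  let ?f = "\<lambda>x. \<kappa> (?q x) * ((?n - 2) * (norm (Du x))\<^sup>2 + (?n + 1) * (x $ k * chi_pos u x))
     + 2 * \<kappa>' (?q x) * (?q x * ((norm (Du x))\<^sup>2 + x $ k * chi_pos u x) - 2 * (Du x \<bullet> (x - x0))\<^sup>2)"
  let ?\<phi> = "\<lambda>x. \<kappa> (?q x) *\<^sub>R (x - x0)"
  have eq: "(norm (Du x))\<^sup>2 * divg ?\<phi> x - 2 * (Du x \<bullet> frechet_derivative ?\<phi> (at x) (Du x))
      + x $ k * chi_pos u x * divg ?\<phi> x + chi_pos u x * ?\<phi> x $ k = ?f x" for x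
  proof -
    have fr: "frechet_derivative ?\<phi> (at x) (Du x) = \<kappa> (?q x) *\<^sub>R Du x + (2 * \<kappa>' (?q x) * ((x - x0) \<bullet> Du x)) *\<^sub>R (x - x0)"
      by (simp only: C(2))
    have dv: "divg ?\<phi> x = ?n * \<kappa> (?q x) + 2 * \<kappa>' (?q x) * ?q x" by (rule C(3))
    have ip: "Du x \<bullet> (\<kappa> (?q x) *\<^sub>R Du x + (2 * \<kappa>' (?q x) * ((x - x0) \<bullet> Du x)) *\<^sub>R (x - x0)) = \<kappa> (?q x) * (norm (Du x))\<^sup>2 + 2 * \<kappa>' (?q x) * (Du x \<bullet> (x - x0))\<^sup>2"
      by (simp add: inner_add_right power2_norm_eq_inner inner_commute[of "x - x0" "Du x"] power2_eq_square[of "Du x \<bullet> (x - x0)"])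
    \<comment> \<open>The centre lies on the hyperplane of height 0, so the last term of the
      variation is again proportional to the height and merges with the divergence term.\<close>
    have "?\<phi> x $ k = \<kappa> (?q x) * x $ k" using x0k by simp
    then show ?thesis unfolding fr dv ip by (simp add: algebra_simps)
  qed
  have "(LINT x:\<Omega>|lebesgue. ?f x) = 0" using var[OF C(1)] by (simp only: eq)
  then have "(LINT x:\<Omega>|lborel. ?f x) = 0" by (subst (asm) set_lebesgue_integral_lebesgue_eq_lborel) measurable
  moreover have "(LINT x:\<Omega>|lborel. ?f x) = (LINT x:ball x0 R|lborel. ?f x)"
  proof (rule integral_ball_eq[OF _ \<kappa>(4) ball_sub])
    fix x assume x: "x \<notin> cball x0 \<rho>"
    have "2 * \<kappa>' (?q x) * ((x - x0) \<bullet> (x - x0)) = 0" using test_fun_derivative_zero[OF t x] .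
    moreover have "x \<noteq> x0" using x \<kappa>(3) by auto
    ultimately have "\<kappa>' (?q x) = 0" by simp
    then show "?f x = 0" using test_fun_zero[OF t x] by simp
  qed
  ultimately show "(LINT x:ball x0 R|lborel. ?f x) = 0" by simp
qed measurable

end

section \<open>Monotonicity of the frequency\<close>

lemma continuous_on_prim:
  assumes a: "integrable lborel a"
  shows "continuous_on UNIV (prim a)"
  unfolding continuous_on_sequentially
proof (intro allI ballI impI, elim conjE)
  fix X :: "nat \<Rightarrow> real" and y :: real assume X: "X \<longlonglongrightarrow> y"
  have am[measurable]: "a \<in> borel_measurable borel" using a by auto
  show "(prim a \<circ> X) \<longlonglongrightarrow> prim a y"
    unfolding comp_def prim_eq_integral_if
  proof (rule integral_dominated_convergence)
    show "integrable lborel (\<lambda>x. \<bar>a x\<bar>)" using a by simp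
    have "AE x in lborel. x \<noteq> y" by (rule AE_lborel_singleton)
    then show "AE x in lborel. (\<lambda>i. if x \<le> X i then a x else 0) \<longlonglongrightarrow> (if x \<le> y then a x else 0)"
    proof eventually_elim
      fix x assume "x \<noteq> y"
      then consider "x < y" | "y < x" by linarith
      then show "(\<lambda>i. if x \<le> X i then a x else 0) \<longlonglongrightarrow> (if x \<le> y then a x else 0)"
      proof cases
        case 1
        have "eventually (\<lambda>i. (if x \<le> X i then a x else 0) = (if x \<le> y then a x else 0)) sequentially"
          using order_tendstoD(1)[OF X 1] by eventually_elim (use 1 in auto)
        then show ?thesis by (rule tendsto_eventually)
      next
        case 2
        have "eventually (\<lambda>i. (if x \<le> X i then a x else 0) = (if x \<le> y then a x else 0)) sequentially"
          using order_tendstoD(2)[OF X 2] by eventually_elim (use 2 in auto)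
        then show ?thesis by (rule tendsto_eventually)
      qed
    qed
  qed auto
qed

text \<open>Where the density is continuous no radius is exceptional; this is what makes
  \<open>Hs\<close> differentiable everywhere on the interval.\<close>

lemma DERIV_prim_continuous:
  assumes a: "integrable lborel a" and c: "continuous_on {p<..<q} a" and r: "r \<in> {p<..<q}"
  shows "(prim a has_real_derivative a r) (at r)"
proof -
  obtain s where s: "p < s" "s < r" using r dense by auto
  obtain t where t: "r < t" "t < q" using r dense by auto
  have cst: "continuous_on {s..t} a" by (rule continuous_on_subset[OF c]) (use s t in auto)
  have eq: "prim a s + integral {s..y} a = prim a y" if "y \<in> {s<..<t}" for y
  proof -
    have "continuous_on {s..y} a" by (rule continuous_on_subset[OF cst]) (use that in auto)
    then have i: "set_integrable lborel {s..y} a" unfolding set_integrable_def by (intro borel_integrable_compact) auto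
    have "prim a y - prim a s = (LINT x:{s<..y}|lborel. a x)" using that by (intro prim_diff[OF a]) auto
    also have "\<dots> = (LINT x:{s..y}|lborel. a x)"
    proof (unfold set_lebesgue_integral_def, rule integral_cong_AE)
      have "AE x in lborel. x \<noteq> s" by (rule AE_lborel_singleton)
      then show "AE x in lborel. indicator {s<..y} x *\<^sub>R a x = indicator {s..y} x *\<^sub>R a x"
        by eventually_elim (auto simp: indicator_def)
    qed (use a in measurable)
    also have "\<dots> = integral {s..y} a" using i by (rule set_borel_integral_eq_integral)
    finally show ?thesis by simp
  qed
  have "((\<lambda>y. integral {s..y} a) has_real_derivative a r) (at r within {s..t})"
    by (rule integral_has_real_derivative[OF cst]) (use s t in auto)
  then have "((\<lambda>y. integral {s..y} a) has_real_derivative a r) (at r)" using s t by (simp add: at_within_Icc_at)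
  from DERIV_add[OF DERIV_const[of "prim a s"] this]
  have "((\<lambda>y. prim a s + integral {s..y} a) has_real_derivative a r) (at r)" by simp
  then show ?thesis
    by (rule has_field_derivative_transform_within_open[where S="{s<..<t}"]) (use s t eq in auto)
qed

lemma prim_cong_AE:
  assumes "AE x in lborel. a x = b x" "a \<in> borel_measurable borel" "b \<in> borel_measurable borel"
  shows "prim a y = prim b y"
  unfolding prim_eq_integral_if
  by (rule integral_cong_AE) (use assms in \<open>auto elim: eventually_mono\<close>)

lemma sphere_int_pos_part:
  fixes x0 :: "real^'n"
  assumes "x0 $ k = 0" "r > 0"
  shows "sphere_int x0 r (\<lambda>x. max (x $ k) 0) =
    (real CARD('n) * (LINT z:ball 0 1|lborel. max ((z::real^'n) $ k / norm z) 0)) * r ^ CARD('n)"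
proof -
  have "max ((x0 + (r / norm z) *\<^sub>R z) $ k) 0 = r * max (z $ k / norm z) 0" for z :: "real^'n"
    using assms by (simp add: max_mult_distrib_left)
  moreover have "(\<lambda>x::real^'n. max (x $ k) 0) \<in> borel_measurable borel" by measurable
  moreover have "r ^ (CARD('n) - 1) * r = r ^ CARD('n)" by (simp add: power_eq_if)
  ultimately show ?thesis by (simp add: sphere_int_lborel mult_ac)
qed

text \<open>The positive part of the height is homogeneous of degree one about a centre on the
  hyperplane, so the constant \<open>c\<close> is shared with the sphere integrals. The case
  \<open>r = 1\<close> evaluates the limit in \<open>Sigma_set\<close> by the same constant.\<close>

lemma integral_pos_part_ball:
  fixes x0 :: "real^'n"
  assumes x0: "x0 $ k = 0" and r: "r > 0"
  defines "c \<equiv> real CARD('n) * (LINT z:ball 0 1|lborel. max ((z::real^'n) $ k / norm z) 0)"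
  shows "(LINT x:ball x0 r|lborel. max (x $ k) 0) = c / (real CARD('n) + 1) * r ^ (CARD('n) + 1)"
proof -
  have "integrable lborel (\<lambda>x. indicator (cball x0 r) x *\<^sub>R max (x $ k) 0)"
    by (intro borel_integrable_compact continuous_intros) auto
  then have "set_integrable lborel (cball x0 r) (\<lambda>x. max (x $ k) 0)" by (simp add: set_integrable_def)
  then have i: "set_integrable lborel (ball x0 r) (\<lambda>x. max (x $ k) 0)" by (rule set_integrable_subset) auto
  have "(LINT x:ball x0 r|lborel. max (x $ k) 0) = (LINT s:{0<..<r}|lborel. sphere_int x0 s (\<lambda>x. max (x $ k) 0))"
    by (rule polar_coordinates_ball(3)[OF _ i]) measurable
  also have "\<dots> = (LINT s:{0<..<r}|lborel. c * s ^ CARD('n))"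
    by (rule set_lebesgue_integral_cong) (auto simp: sphere_int_pos_part[where k=k, OF x0] c_def)
  also have "\<dots> = (LINT s|lborel. indicator {0..r} s *\<^sub>R (c * s ^ CARD('n)))"
  proof (unfold set_lebesgue_integral_def, rule integral_cong_AE)
    have "AE s in lborel. s \<noteq> 0" "AE s in lborel. s \<noteq> r" by (rule AE_lborel_singleton)+
    then show "AE s in lborel. indicator {0<..<r} s *\<^sub>R (c * s ^ CARD('n)) = indicator {0..r} s *\<^sub>R (c * s ^ CARD('n))"
      by eventually_elim (auto simp: indicator_def)
  qed measurable
  also have "\<dots> = c / (real CARD('n) + 1) * r ^ (CARD('n) + 1) - c / (real CARD('n) + 1) * 0 ^ (CARD('n) + 1)"
  proof (rule integral_FTC_Icc)
    fix s :: real
    have "((\<lambda>s. c / (real CARD('n) + 1) * s ^ (CARD('n) + 1)) has_real_derivative c * s ^ CARD('n)) (at s within {0..r})"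
    proof -
      have "((\<lambda>s. s ^ (CARD('n) + 1)) has_real_derivative (real CARD('n) + 1) * s ^ CARD('n)) (at s within {0..r})"
        using DERIV_pow[of "CARD('n) + 1" s] by (simp add: has_field_derivative_at_within add.commute)
      from DERIV_cmult[OF this, of "c / (real CARD('n) + 1)"]
      show ?thesis by (rule DERIV_cong) (simp add: add_nonneg_eq_0_iff)
    qed
    then show "((\<lambda>s. c / (real CARD('n) + 1) * s ^ (CARD('n) + 1)) has_vector_derivative c * s ^ CARD('n)) (at s within {0..r})"
      by (simp add: has_real_derivative_iff_has_vector_derivative)
  qed (use r in \<open>auto intro!: continuous_intros\<close>)
  finally show ?thesis by simp
qed

lemma mono_on_tendsto_at_right:
  fixes F :: "real \<Rightarrow> real"
  assumes m: "mono_on {0<..<R} F" and R: "R > 0" and b: "\<And>r. r \<in> {0<..<R} \<Longrightarrow> F r \<ge> B"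
  shows "\<exists>L. (F \<longlongrightarrow> L) (at_right 0) \<and> L \<ge> B"
proof (intro exI conjI)
  have bdd: "bdd_below (F ` {0<..<R})" by (rule bdd_belowI2[of _ B]) (use b in auto)
  have ne: "F ` {0<..<R} \<noteq> {}" using R by auto
  show "Inf (F ` {0<..<R}) \<ge> B" using b by (intro cInf_greatest ne) auto
  show "(F \<longlongrightarrow> Inf (F ` {0<..<R})) (at_right 0)"
  proof (rule order_tendstoI)
    fix a assume "a < Inf (F ` {0<..<R})"
    then have "a < F r" if "r \<in> {0<..<R}" for r using that by (meson bdd cInf_lower imageI less_le_trans)
    then show "eventually (\<lambda>r. a < F r) (at_right 0)"
      using R by (auto simp: eventually_at_right_field intro!: exI[of _ R])
  next
    fix a assume "Inf (F ` {0<..<R}) < a"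
    then obtain r where r: "r \<in> {0<..<R}" "F r < a" using cInf_lessD[OF ne] by blast
    have "F s < a" if "0 < s" "s < r" for s
    proof -
      have "F s \<le> F r" by (rule mono_onD[OF m]) (use r that in auto)
      then show ?thesis using r by simp
    qed
    then show "eventually (\<lambda>r. F r < a) (at_right 0)"
      using r by (auto simp: eventually_at_right_field intro!: exI[of _ r])
  qed
qed

section \<open>Ball and sphere quantities around the point\<close>

text \<open>Only the topological half of membership in \<open>Sigma_set\<close> enters the locale.
  The limit of the functional becomes the premise \<open>lim\<close> of later lemmas, once the
  functional is expressed by the quantities below.\<close>

locale sigma_point = variational_ball k \<Omega> u Du g H P x0 R
  for k :: "'n::finite" and \<Omega> u Du g H P x0 R +
  assumes x0_closure: "x0 \<in> closure P"
begin

text \<open>Sphere integrals end in \<open>s\<close>, ball integrals in \<open>r\<close>; \<open>Hs'\<close> is the derivative of \<open>Hs\<close>.\<close>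

definition Hs :: "real \<Rightarrow> real" where "Hs r = sphere_int x0 r (\<lambda>x. (u x)\<^sup>2)"
definition Dr :: "real \<Rightarrow> real" where "Dr r = (LINT x:ball x0 r|lborel. (norm (Du x))\<^sup>2)"
definition Vr :: "real \<Rightarrow> real" where "Vr r = (LINT x:ball x0 r|lborel. max (x $ k) 0 * (1 - chi_pos u x))"
definition Pr :: "real \<Rightarrow> real" where "Pr r = (LINT x:ball x0 r|lborel. max (x $ k) 0)"
definition Ns :: "real \<Rightarrow> real" where "Ns r = sphere_int x0 r (\<lambda>x. (Du x \<bullet> (x - x0))\<^sup>2)"
definition Ms :: "real \<Rightarrow> real" where "Ms r = sphere_int x0 r (\<lambda>x. u x * (Du x \<bullet> (x - x0)))"
definition Hs' :: "real \<Rightarrow> real" where "Hs' r = ((real CARD('n) - 1) * Hs r + 2 * r * Dr r) / r"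

lemma cball_sub_u: "continuous_on (cball x0 R) (\<lambda>x. (u x)\<^sup>2)"
  using cu ball_sub by (auto intro!: continuous_intros intro: continuous_on_subset)

lemma sph_integrable_u_sq: "r \<in> {0<..<R} \<Longrightarrow> sph_integrable x0 r (\<lambda>x. (u x)\<^sup>2)"
  by (rule continuous_on_sphere_int(2)[OF _ cball_sub_u]) measurable

lemma continuous_on_Hs: "continuous_on {0<..<R} Hs"
  unfolding Hs_def by (rule continuous_on_sphere_int(1)[OF _ cball_sub_u]) measurable

lemma Hs_nonneg: "r \<ge> 0 \<Longrightarrow> Hs r \<ge> 0" and Dr_nonneg: "Dr r \<ge> 0" and Vr_nonneg: "Vr r \<ge> 0"
  unfolding Hs_def Dr_def Vr_def set_lebesgue_integral_def
  by (auto intro!: sphere_int_nonneg integral_nonneg simp: chi_pos_def)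

lemma Dr_prim: "r \<in> {0<..<R} \<Longrightarrow> prim (\<lambda>s. indicator {0<..<R} s * sphere_int x0 s (\<lambda>x. (norm (Du x))\<^sup>2)) r = Dr r"
  unfolding Dr_def by (rule prim_sphere_int[OF _ integrable_ball_basic(1)]) auto

lemma integrable_indicator_sphere_int:
  assumes "f \<in> borel_measurable borel" "set_integrable lborel (ball x0 R) f"
  shows "integrable lborel (\<lambda>s. indicator {0<..<R} s * sphere_int x0 s f)"
  using polar_coordinates_ball(2)[OF assms] by (simp add: set_integrable_def)

lemma continuous_on_Dr: "continuous_on {0<..<R} Dr"
proof -
  have "continuous_on {0<..<R} (prim (\<lambda>s. indicator {0<..<R} s * sphere_int x0 s (\<lambda>x. (norm (Du x))\<^sup>2)))"
    by (rule continuous_on_subset[OF continuous_on_prim[OF integrable_indicator_sphere_int[OF _ integrable_ball_basic(1)]]]) auto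
  then show ?thesis by (rule continuous_on_eq) (simp add: Dr_prim)
qed

lemma AE_sph_integrable:
  shows "AE r in lborel. r \<in> {0<..<R} \<longrightarrow> sph_integrable x0 r (\<lambda>x. u x * (Du x \<bullet> (x - x0)))"
    and "AE r in lborel. r \<in> {0<..<R} \<longrightarrow> sph_integrable x0 r (\<lambda>x. (Du x \<bullet> (x - x0))\<^sup>2)"
  by (rule polar_coordinates_ball(1)[OF _ integrable_ball_basic(3)], measurable)
     (rule polar_coordinates_ball(1)[OF _ integrable_ball_basic(4)], measurable)

lemma AE_Ms: "AE r in lborel. r \<in> {0<..<R} \<longrightarrow> Ms r = r * Dr r"
  using radial_energy by (simp add: Ms_def Dr_def)

lemma square_flux_measurable:
  "(\<lambda>x. real CARD('n) * (u x)\<^sup>2 + 2 * (u x * (Du x \<bullet> (x - x0)))) \<in> borel_measurable borel"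
  by measurable

text \<open>The density delivered by \<open>radial_square\<close> contains the flux
  \<open>Ms\<close>, which is meaningful for almost every radius only. Exchanging
  \<open>Ms s\<close> for \<open>s * Dr s\<close> changes it on a null set and makes it continuous.
  Both sides of the claim are then continuous, so it holds at every radius, and \<open>Hs\<close>
  turns out to be of class C^1.\<close>

lemma Hs_primitive:
  defines "a \<equiv> \<lambda>s. indicator {0<..<R} s * (real CARD('n) * Hs s + 2 * s * Dr s)"
  shows "integrable lborel a" and "r \<in> {0<..<R} \<Longrightarrow> r * Hs r = prim a r"
proof -
  let ?f = "\<lambda>x. real CARD('n) * (u x)\<^sup>2 + 2 * (u x * (Du x \<bullet> (x - x0)))"
  define b where "b = (\<lambda>s. indicator {0<..<R} s * sphere_int x0 s ?f)"
  have f: "?f \<in> borel_measurable borel" by (rule square_flux_measurable)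
  have fi: "set_integrable lborel (ball x0 R) ?f"
    by (intro set_integral_add(1) set_integrable_mult_right integrable_ball_basic)
  have bi: "integrable lborel b" unfolding b_def by (rule integrable_indicator_sphere_int[OF f fi])
  have am: "a \<in> borel_measurable borel"
  proof -
    have "continuous_on {0<..<R} (\<lambda>s. real CARD('n) * Hs s + 2 * s * Dr s)"
      by (intro continuous_intros continuous_on_Hs continuous_on_Dr)
    then have "(\<lambda>s. indicator {0<..<R} s *\<^sub>R (real CARD('n) * Hs s + 2 * s * Dr s)) \<in> borel_measurable borel"
      by (intro borel_measurable_continuous_on_indicator) auto
    then show ?thesis unfolding a_def real_scaleR_def .
  qed
  have ab: "AE s in lborel. b s = a s"
    using AE_Ms AE_sph_integrable(1)
  proof eventually_elim
    case (elim s)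
    show ?case
    proof (cases "s \<in> {0<..<R}")
      case True
      have "sphere_int x0 s ?f = sphere_int x0 s (\<lambda>x. real CARD('n) * (u x)\<^sup>2) + sphere_int x0 s (\<lambda>x. 2 * (u x * (Du x \<bullet> (x - x0))))"
        by (rule sphere_int_add) (use elim True sph_integrable_u_sq in \<open>auto intro: sph_integrable_cmult\<close>)
      then show ?thesis using True elim by (simp only: sphere_int_cmult) (simp add: a_def b_def Hs_def Ms_def)
    qed (simp add: a_def b_def)
  qed
  have "integrable lborel b \<longleftrightarrow> integrable lborel a" using bi am ab by (intro integrable_cong_AE) auto
  then show ai: "integrable lborel a" using bi by simp
  have pab: "prim b s = prim a s" for s using ab am bi by (intro prim_cong_AE) auto
  have "AE s in lborel. s \<in> {0<..<R} \<longrightarrow> s * Hs s - prim a s = 0"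
    using radial_square
  proof eventually_elim
    case (elim s)
    show ?case
    proof
      assume s: "s \<in> {0<..<R}"
      have "sphere_int x0 s (\<lambda>x. (norm (x - x0))\<^sup>2 * (u x)\<^sup>2) = sphere_int x0 s (\<lambda>x. s\<^sup>2 * (u x)\<^sup>2)"
        by (rule sphere_int_cong) (use s in auto)
      also have "\<dots> = s\<^sup>2 * Hs s" by (simp add: sphere_int_cmult Hs_def)
      finally have "s\<^sup>2 * Hs s = s * prim b s"
        using elim s prim_sphere_int[OF f fi, of s] by (simp add: b_def)
      then show "s * Hs s - prim a s = 0" using s pab by (simp add: power2_eq_square)
    qed
  qed
  moreover have "continuous_on {0<..<R} (\<lambda>s. s * Hs s - prim a s)"
    using continuous_on_prim[OF ai] by (intro continuous_intros continuous_on_Hs) (auto intro: continuous_on_subset)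
  ultimately have "r * Hs r - prim a r = 0" if "r \<in> {0<..<R}" for r
    by (intro continuous_AE_zero_imp_zero[of "{0<..<R}"]) (use that in auto)
  then show "r \<in> {0<..<R} \<Longrightarrow> r * Hs r = prim a r" by simp
qed

lemma Hs_derivative:
  assumes r: "r \<in> {0<..<R}"
  shows "(Hs has_real_derivative Hs' r) (at r)"
proof -
  define a where "a = (\<lambda>s. indicator {0<..<R} s * (real CARD('n) * Hs s + 2 * s * Dr s))"
  have c: "continuous_on {0<..<R} a"
  proof -
    have "continuous_on {0<..<R} (\<lambda>s. real CARD('n) * Hs s + 2 * s * Dr s)"
      by (intro continuous_intros continuous_on_Hs continuous_on_Dr)
    then show ?thesis by (rule continuous_on_eq) (simp add: a_def)
  qed
  have "(prim a has_real_derivative a r) (at r)"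
    by (rule DERIV_prim_continuous[OF _ c r]) (use Hs_primitive(1) in \<open>simp add: a_def\<close>)
  then have "((\<lambda>s. prim a s / s) has_real_derivative (a r * r - prim a r * 1) / (r * r)) (at r)"
    using r by (intro DERIV_divide DERIV_ident) auto
  moreover have "(a r * r - prim a r * 1) / (r * r) = Hs' r"
    using Hs_primitive(2)[OF r, folded a_def] r by (simp add: Hs'_def a_def[THEN fun_cong, of r] field_simps power2_eq_square)
  ultimately have "((\<lambda>s. prim a s / s) has_real_derivative Hs' r) (at r)" by simp
  then show ?thesis
    by (rule has_field_derivative_transform_within_open[where S="{0<..<R}"])
       (use r Hs_primitive(2)[folded a_def] in \<open>auto simp: field_simps\<close>)
qed

lemma continuous_on_Hs': "continuous_on {0<..<R} Hs'"
  unfolding Hs'_def by (intro continuous_intros continuous_on_Hs continuous_on_Dr) auto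

lemma Hs_pos:
  assumes r: "r \<in> {0<..<R}"
  shows "Hs r > 0"
proof (rule ccontr)
  assume "\<not> Hs r > 0"
  then have H0: "Hs r = 0" using Hs_nonneg[of r] r by simp
  define N where "N = CARD('n) - 1"
  have N: "real CARD('n) - 1 = real N" by (simp add: N_def of_nat_diff Suc_leI)
  have d: "((\<lambda>s. Hs s / s ^ N) has_real_derivative 2 * Dr s / s ^ N) (at s)" if s: "s \<in> {0<..<R}" for s
  proof -
    have "((\<lambda>s. Hs s / s ^ N) has_real_derivative (Hs' s * s ^ N - Hs s * (real N * s ^ (N - 1))) / (s ^ N * s ^ N)) (at s)"
      using s by (intro DERIV_divide Hs_derivative) (auto intro!: derivative_eq_intros)
    moreover have "(Hs' s * s ^ N - Hs s * (real N * s ^ (N - 1))) / (s ^ N * s ^ N) = 2 * Dr s / s ^ N"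
    proof -
      \<comment> \<open>For \<open>N = 0\<close> the truncated exponent \<open>N - 1\<close> does no
        harm because of the factor \<open>real N\<close>.\<close>
      have e: "real N * s ^ (N - 1) = real N * s ^ N / s" using s by (cases N) auto
      have "Hs' s * s ^ N - Hs s * (real N * s ^ N / s) = 2 * Dr s * s ^ N"
        using s unfolding Hs'_def N by (simp add: field_simps)
      then have "Hs' s * s ^ N - Hs s * (real N * s ^ (N - 1)) = 2 * Dr s * s ^ N" by (simp only: e)
      then show ?thesis using s by simp
    qed
    ultimately show ?thesis by simp
  qed
  have z: "Hs s = 0" if s: "0 < s" "s \<le> r" for s
  proof -
    have "Hs s / s ^ N \<le> Hs r / r ^ N"
    proof (rule DERIV_nonneg_imp_nondecreasing[OF s(2)])
      fix x assume x: "s \<le> x" "x \<le> r"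
      have "2 * Dr x / x ^ N \<ge> 0" using Dr_nonneg[of x] s x by simp
      then show "\<exists>y. ((\<lambda>s. Hs s / s ^ N) has_real_derivative y) (at x) \<and> 0 \<le> y" using d[of x] x s r by auto
    qed
    then have "Hs s / s ^ N \<le> 0" using H0 by simp
    moreover have "s ^ N > 0" using s by simp
    ultimately have "Hs s \<le> 0" by (simp only: pos_divide_le_eq mult_zero_left)
    then show ?thesis using Hs_nonneg[of s] s by simp
  qed
  have i: "set_integrable lborel (ball x0 r) (\<lambda>x. (u x)\<^sup>2)"
    by (rule set_integrable_subset[OF integrable_ball_basic(2)]) (use r in auto)
  have "(LINT x:ball x0 r|lborel. (u x)\<^sup>2) = (LINT s:{0<..<r}|lborel. Hs s)"
    unfolding Hs_def by (rule polar_coordinates_ball(3)[OF _ i]) measurable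
  also have "\<dots> = (LINT s:{0<..<r}|lborel. 0)" by (rule set_lebesgue_integral_cong) (auto simp: z)
  finally have "(LINT x|lborel. indicator (ball x0 r) x *\<^sub>R (u x)\<^sup>2) = 0" by (simp add: set_lebesgue_integral_def)
  then have "AE x in lborel. indicator (ball x0 r) x *\<^sub>R (u x)\<^sup>2 = 0"
    using i unfolding set_integrable_def by (subst (asm) integral_nonneg_eq_0_iff_AE) auto
  then have ae: "AE x in lborel. x \<in> ball x0 r \<longrightarrow> u x = 0" by eventually_elim (auto simp: indicator_def split: if_splits)
  have "ball x0 r \<subseteq> \<Omega>" using ball_sub r by (auto simp: subset_iff)
  then have cball_sub: "continuous_on (ball x0 r) u" using cu continuous_on_subset by blast
  have "u x = 0" if "x \<in> ball x0 r" for x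
    by (rule continuous_AE_zero_imp_zero[OF _ _ ae that]) (use cball_sub r in auto)
  then have "ball x0 r \<inter> P = {}" by (auto simp: P_def)
  moreover have "ball x0 r \<inter> P \<noteq> {}" 
  proof -
    have "x0 \<in> ball x0 r \<inter> closure P" using x0_closure r by simp
    then show ?thesis using open_Int_closure_eq_empty[of "ball x0 r" P] by blast
  qed
  ultimately show False by simp
qed

end

section \<open>The boundary functional and the derivative of the frequency\<close>

text \<open>The left-hand side is the product rule for (r / H) (D - V), with \<open>f\<close> the
  density of D - V. After substitution the terms r D H cancel, the product of 2 r D with r D gives
  the square of \<open>M\<close>, and V H keeps the coefficient (n - 2) - (n + 1) = -3, which is the
  source of 3/2.\<close>

lemma frequency_derivative_algebra:
  fixes r H N D V f n H' M :: real
  assumes "r > 0" "H > 0" and f: "r\<^sup>2 * f = 2 * N + r * (n - 2) * D - (n + 1) * r * V"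
    and H': "H' = ((n - 1) * H + 2 * r * D) / r" and M: "M = r * D"
  shows "(H - r * H') / (H * H) * (D - V) + r / H * f =
     2 / r * (1 / H\<^sup>2) * (N * H - M\<^sup>2) + 2 * V / H * (r * D / H - 3/2)"
proof -
  have e: "r * H' = (n - 1) * H + 2 * r * D" using H' \<open>r > 0\<close> by simp
  have "(H - r * H') / (H * H) * (D - V) + r / H * f =
     ((H - ((n - 1) * H + 2 * r * D)) * r * (D - V) + (r\<^sup>2 * f) * H) / (r * H\<^sup>2)"
    unfolding e using assms(1,2) by (simp add: field_simps power2_eq_square)
  also have "\<dots> = (2 * (N * H - M\<^sup>2) + 2 * V * r * (r * D - 3/2 * H)) / (r * H\<^sup>2)"
    unfolding f M by (simp add: algebra_simps power2_eq_square)
  also have "\<dots> = 2 / r * (1 / H\<^sup>2) * (N * H - M\<^sup>2) + 2 * V / H * (r * D / H - 3/2)"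
    using assms(1,2) by (simp add: field_simps power2_eq_square)
  finally show ?thesis .
qed

context sigma_point
begin

definition q :: "real^'n \<Rightarrow> real" where "q x = (norm (Du x))\<^sup>2 + max (x $ k) 0 * (chi_pos u x - 1)"

lemma q_measurable[measurable]: "q \<in> borel_measurable borel"
  unfolding q_def[abs_def] by measurable

lemma q_alt: "q = (\<lambda>x. (norm (Du x))\<^sup>2 - max (x $ k) 0 * (1 - chi_pos u x))"
  by (auto simp: q_def algebra_simps)

lemma q_integrable: "set_integrable lborel (ball x0 R) q"
  unfolding q_alt by (intro set_integral_diff(1) integrable_ball_basic)

lemma set_integrable_smaller_ball:
  fixes f :: "real^'n \<Rightarrow> real"
  assumes "set_integrable lborel (ball x0 R) f" "r \<le> R"
  shows "set_integrable lborel (ball x0 r) f"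
  by (rule set_integrable_subset[OF assms(1)]) (use assms(2) in auto)

lemmas integrable_smaller_ball = integrable_ball_basic[THEN set_integrable_smaller_ball]

lemma integral_q: "r \<le> R \<Longrightarrow> (LINT x:ball x0 r|lborel. q x) = Dr r - Vr r"
  unfolding q_alt Dr_def Vr_def
  by (intro set_integral_diff(2) integrable_smaller_ball)

text \<open>\<open>u\<close> vanishes wherever the height is not positive, so the height may be
  replaced by its positive part in front of the characteristic function. This separates an explicit
  homogeneous term from the part counted by \<open>Vr\<close>.\<close>

lemma height_chi:
  assumes "x \<in> cball x0 R"
  shows "x $ k * chi_pos u x = max (x $ k) 0 * (chi_pos u x - 1) + max (x $ k) 0"
proof -
  have "x \<in> \<Omega>" using assms ball_sub by auto
  then show ?thesis using u_zero[of x] by (auto simp: chi_pos_def max_def)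
qed

lemma height_chi_split:
  assumes "x \<in> cball x0 R"
  shows "(norm (Du x))\<^sup>2 + x $ k * chi_pos u x = q x + max (x $ k) 0"
  using height_chi[OF assms] by (simp add: q_def)

lemma integral_height_chi:
  assumes "r \<le> R"
  shows "(LINT x:ball x0 r|lborel. x $ k * chi_pos u x) = Pr r - Vr r"
proof -
  have "(LINT x:ball x0 r|lborel. x $ k * chi_pos u x) = (LINT x:ball x0 r|lborel. max (x $ k) 0 - max (x $ k) 0 * (1 - chi_pos u x))"
    by (rule set_lebesgue_integral_cong) (use assms height_chi in \<open>auto simp: algebra_simps\<close>)
  also have "\<dots> = Pr r - Vr r" unfolding Pr_def Vr_def
    by (intro set_integral_diff(2) integrable_smaller_ball assms)
  finally show ?thesis .
qed

lemma integral_energy: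
  assumes "r \<le> R"
  shows "(LINT x:ball x0 r|lborel. (norm (Du x))\<^sup>2 + x $ k * chi_pos u x) = Dr r + Pr r - Vr r"
proof -
  have "(LINT x:ball x0 r|lborel. (norm (Du x))\<^sup>2 + x $ k * chi_pos u x) = Dr r + (LINT x:ball x0 r|lborel. x $ k * chi_pos u x)"
    unfolding Dr_def by (intro set_integral_add(2) integrable_smaller_ball assms)
  then show ?thesis using integral_height_chi[OF assms] by simp
qed

definition cP :: real where "cP = real CARD('n) * (LINT z:ball 0 1|lborel. max ((z::real^'n) $ k / norm z) 0)"

lemma Pr_eq: "r > 0 \<Longrightarrow> Pr r = cP / (real CARD('n) + 1) * r ^ (CARD('n) + 1)"
  unfolding Pr_def cP_def by (rule integral_pos_part_ball[OF x0k])

text \<open>The positive part of the height, being homogeneous of degree one, satisfies an identity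
  of its own: \<open>r\<close> times its sphere integral is n + 1 times its ball integral.
  Subtracting this from the Pohozaev identity leaves only \<open>q\<close>, \<open>Ns\<close>,
  \<open>Dr\<close> and \<open>Vr\<close>.\<close>

lemma AE_variation:
  "AE r in lborel. r \<in> {0<..<R} \<longrightarrow>
     r\<^sup>2 * sphere_int x0 r q = 2 * Ns r + r * (real CARD('n) - 2) * Dr r - (real CARD('n) + 1) * r * Vr r \<and>
     sphere_int x0 r (\<lambda>x. (norm (Du x))\<^sup>2 + x $ k * chi_pos u x) = sphere_int x0 r q + (real CARD('n) + 1) * Pr r / r"
  using radial_variation AE_sph_integrable(2) polar_coordinates_ball(1)[OF q_measurable q_integrable]
proof eventually_elim
  case (elim r)
  show ?case
  proof
    assume r: "r \<in> {0<..<R}"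
    let ?n = "real CARD('n)"
    have on: "x \<in> cball x0 R" if "norm (x - x0) = r" for x using that r by (simp add: dist_norm norm_minus_commute)
    have mm: "(\<lambda>x::real^'n. max (x $ k) 0) \<in> borel_measurable borel" by measurable
    have i1: "sph_integrable x0 r q" and i2: "sph_integrable x0 r (\<lambda>x. (Du x \<bullet> (x - x0))\<^sup>2)" using elim r by auto
    have i3: "sph_integrable x0 r (\<lambda>x. max (x $ k) 0)"
      by (rule continuous_on_sphere_int(2)[OF mm _ r]) (auto intro!: continuous_intros)
    define pl where "pl = sphere_int x0 r (\<lambda>x. max (x $ k) 0)"
    have "pl = cP * r ^ CARD('n)" using sphere_int_pos_part[OF x0k, of r] r by (simp add: pl_def cP_def)
    then have rpl: "r * pl = (?n + 1) * Pr r" using r by (simp add: Pr_eq add_nonneg_eq_0_iff)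
    have "sphere_int x0 r (\<lambda>x. (norm (x - x0))\<^sup>2 * ((norm (Du x))\<^sup>2 + x $ k * chi_pos u x) - 2 * (Du x \<bullet> (x - x0))\<^sup>2)
       = sphere_int x0 r (\<lambda>x. r\<^sup>2 * q x + (r\<^sup>2 * max (x $ k) 0 + (- 2) * (Du x \<bullet> (x - x0))\<^sup>2))"
      by (rule sphere_int_cong) (use r height_chi_split[OF on] in \<open>auto simp: algebra_simps\<close>)
    also have "\<dots> = sphere_int x0 r (\<lambda>x. r\<^sup>2 * q x) + sphere_int x0 r (\<lambda>x. r\<^sup>2 * max (x $ k) 0 + (- 2) * (Du x \<bullet> (x - x0))\<^sup>2)"
      by (intro sphere_int_add sph_integrable_add sph_integrable_cmult i1 i2 i3) measurable
    also have "sphere_int x0 r (\<lambda>x. r\<^sup>2 * max (x $ k) 0 + (- 2) * (Du x \<bullet> (x - x0))\<^sup>2) =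
        sphere_int x0 r (\<lambda>x. r\<^sup>2 * max (x $ k) 0) + sphere_int x0 r (\<lambda>x. (- 2) * (Du x \<bullet> (x - x0))\<^sup>2)"
      by (intro sphere_int_add sph_integrable_add sph_integrable_cmult i1 i2 i3) measurable
    finally have "r\<^sup>2 * sphere_int x0 r q + (r\<^sup>2 * pl + (- 2) * Ns r) =
        r * (LINT x:ball x0 r|lborel. (?n - 2) * (norm (Du x))\<^sup>2 + (?n + 1) * (x $ k * chi_pos u x))"
      using elim r unfolding sphere_int_cmult pl_def Ns_def by simp
    moreover have "(LINT x:ball x0 r|lborel. (?n - 2) * (norm (Du x))\<^sup>2 + (?n + 1) * (x $ k * chi_pos u x))
       = (?n - 2) * Dr r + (?n + 1) * (Pr r - Vr r)"
    proof -
      have "(LINT x:ball x0 r|lborel. (?n - 2) * (norm (Du x))\<^sup>2 + (?n + 1) * (x $ k * chi_pos u x))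
         = (LINT x:ball x0 r|lborel. (?n - 2) * (norm (Du x))\<^sup>2) + (LINT x:ball x0 r|lborel. (?n + 1) * (x $ k * chi_pos u x))"
        using r by (intro set_integral_add(2) set_integrable_mult_right integrable_smaller_ball) auto
      then show ?thesis using integral_height_chi[of r] r unfolding set_integral_mult_right by (simp add: Dr_def)
    qed
    moreover have "r\<^sup>2 * pl = r * ((?n + 1) * Pr r)" using rpl by (simp add: power2_eq_square mult.assoc)
    ultimately have "r\<^sup>2 * sphere_int x0 r q + (r * ((?n + 1) * Pr r) + (- 2) * Ns r) = r * ((?n - 2) * Dr r + (?n + 1) * (Pr r - Vr r))"
      by (simp only:)
    then have "r\<^sup>2 * sphere_int x0 r q = 2 * Ns r + r * (?n - 2) * Dr r - (?n + 1) * r * Vr r"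
      by (simp add: algebra_simps)
    moreover have "sphere_int x0 r (\<lambda>x. (norm (Du x))\<^sup>2 + x $ k * chi_pos u x) = sphere_int x0 r (\<lambda>x. q x + max (x $ k) 0)"
      by (rule sphere_int_cong) (use r height_chi_split[OF on] in auto)
    moreover have "sphere_int x0 r (\<lambda>x. q x + max (x $ k) 0) = sphere_int x0 r q + pl"
      unfolding pl_def by (intro sphere_int_add i1 i3) measurable
    moreover have "pl = (?n + 1) * Pr r / r" using rpl r by (simp add: field_simps)
    ultimately show "r\<^sup>2 * sphere_int x0 r q = 2 * Ns r + r * (?n - 2) * Dr r - (?n + 1) * r * Vr r \<and>
     sphere_int x0 r (\<lambda>x. (norm (Du x))\<^sup>2 + x $ k * chi_pos u x) = sphere_int x0 r q + (?n + 1) * Pr r / r"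
      by simp
  qed
qed

text \<open>The functional \<open>Phi_bound\<close> at radii in the interval, with its energy
  written as \<open>Dr + Pr - Vr\<close>: a Weiss-type functional for homogeneity 3/2.\<close>

definition Phi :: "real \<Rightarrow> real" where
  "Phi r = r powr (- real CARD('n) - 1) * (Dr r + Pr r - Vr r) + (- 3/2) * (r powr (- real CARD('n) - 2) * Hs r)"

lemma Phi_mono: "mono_on {0<..<R} Phi"
proof -
  let ?n = "real CARD('n)"
  let ?e = "\<lambda>x. (norm (Du x))\<^sup>2 + x $ k * chi_pos u x"
  define a where "a = (\<lambda>s. indicator {0<..<R} s * sphere_int x0 s ?e)"
  define \<alpha>' where "\<alpha>' r = (- ?n - 1) * r powr (- ?n - 2)" for r :: real
  define \<beta>' where "\<beta>' r = (- 3/2) * (((- ?n - 2) * r powr (- ?n - 3)) * Hs r + Hs' r * r powr (- ?n - 2))" for r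
  have em: "?e \<in> borel_measurable borel" by measurable
  have ei: "set_integrable lborel (ball x0 R) ?e" by (intro set_integral_add(1) integrable_ball_basic)
  have ai: "integrable lborel a" unfolding a_def by (rule integrable_indicator_sphere_int[OF em ei])
  have pa: "prim a r = Dr r + Pr r - Vr r" if "r \<in> {0<..<R}" for r
    using prim_sphere_int[OF em ei, of r] integral_energy[of r] that by (simp add: a_def)
  have pw: "((\<lambda>r. r powr c) has_real_derivative c * r powr (c - 1)) (at r)" if "r > 0" for r c :: real
    by (rule has_real_derivative_powr[OF that])
  have "mono_on {0<..<R} (\<lambda>r. r powr (- ?n - 1) * prim a r + (- 3/2) * (r powr (- ?n - 2) * Hs r))"
  proof (rule mono_on_prim_combination[OF ai])
    fix r assume r: "r \<in> {0<..<R}"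
    then have "r > 0" by simp
    show "((\<lambda>r. r powr (- ?n - 1)) has_real_derivative \<alpha>' r) (at r)"
      using pw[OF \<open>r > 0\<close>, of "- ?n - 1"] unfolding \<alpha>'_def diff_diff_add by simp
    have 1: "((\<lambda>r. r powr (- ?n - 2)) has_real_derivative (- ?n - 2) * r powr (- ?n - 3)) (at r)"
      using pw[OF \<open>r > 0\<close>, of "- ?n - 2"] unfolding diff_diff_add by simp
    show "((\<lambda>r. (- 3/2) * (r powr (- ?n - 2) * Hs r)) has_real_derivative \<beta>' r) (at r)"
      unfolding \<beta>'_def by (rule DERIV_cmult[OF DERIV_mult[OF 1 Hs_derivative[OF r]]])
  next
    show "continuous_on {0<..<R} \<alpha>'" unfolding \<alpha>'_def by (intro continuous_intros) auto
    show "continuous_on {0<..<R} \<beta>'" unfolding \<beta>'_def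
      by (intro continuous_intros continuous_on_Hs continuous_on_Hs') auto
    show "AE r in lborel. r \<in> {0<..<R} \<longrightarrow> 0 \<le> r powr (- ?n - 1) * a r + \<alpha>' r * prim a r + \<beta>' r"
      using AE_variation AE_Ms AE_sph_integrable(1) AE_sph_integrable(2)
    proof eventually_elim
      case (elim r)
      show ?case
      proof
        assume r: "r \<in> {0<..<R}"
        then have r0: "r > 0" by simp
        \<comment> \<open>The lowest power of \<open>r\<close> in the derivative; after factoring it
          out only integer powers of \<open>r\<close> remain.\<close>
        define t where "t = r powr (- ?n - 3)"
        have t: "t > 0" using r0 by (simp add: t_def)
        have "1 + (- ?n - 3) = - ?n - 2" "2 + (- ?n - 3) = - ?n - 1" by auto
        then have t2: "r powr (- ?n - 2) = r * t" and t1: "r powr (- ?n - 1) = r\<^sup>2 * t"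
          using powr_add[of r 1 "- ?n - 3"] powr_add[of r 2 "- ?n - 3"] powr_one[of r] powr_numeral[of r "num.Bit0 num.One"] r0
          by (simp_all only: t_def less_imp_le)
        have ar: "r\<^sup>2 * a r = 2 * Ns r + r * (?n - 2) * Dr r - (?n + 1) * r * Vr r + (?n + 1) * r * Pr r"
          using elim(1) r r0 by (simp add: a_def distrib_left) (simp add: field_simps power2_eq_square)
        have rH': "r * Hs' r = (?n - 1) * Hs r + 2 * r * Dr r" using r0 by (simp add: Hs'_def)
        have sq: "sphere_int x0 r (\<lambda>x. (1 * (Du x \<bullet> (x - x0)) - 3/2 * u x)\<^sup>2) = 1\<^sup>2 * Ns r - 2 * 1 * (3/2) * Ms r + (3/2)\<^sup>2 * Hs r"
          unfolding Ns_def Ms_def Hs_def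
          by (rule sphere_int_square) (use elim r sph_integrable_u_sq in auto)
        have nn: "0 \<le> Ns r - 3 * Ms r + 9/4 * Hs r"
          using sphere_int_nonneg[of "\<lambda>x. (1 * (Du x \<bullet> (x - x0)) - 3/2 * u x)\<^sup>2" r x0] r0 unfolding sq
          by (simp add: power2_eq_square)
        have "r powr (- ?n - 1) * a r + \<alpha>' r * prim a r + \<beta>' r =
          t * (r\<^sup>2 * a r - (?n + 1) * r * (Dr r + Pr r - Vr r) + 3/2 * (?n + 2) * Hs r - 3/2 * (r * Hs' r))"
          unfolding \<alpha>'_def \<beta>'_def t1 t2 t_def[symmetric] pa[OF r] by (simp add: algebra_simps)
        \<comment> \<open>All terms with \<open>n\<close>, \<open>Pr\<close> and \<open>Vr\<close>
          cancel. Replacing \<open>r * Dr r\<close> by \<open>Ms r\<close> in the next step turns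
          the bracket into the integral of the square expanded in \<open>sq\<close>.\<close>
        also have "\<dots> = t * (2 * (Ns r - 3 * (r * Dr r) + 9/4 * Hs r))"
          unfolding ar rH' by (simp add: field_simps)
        also have "\<dots> = t * (2 * (Ns r - 3 * Ms r + 9/4 * Hs r))" using elim(2) r by simp
        finally show "0 \<le> r powr (- ?n - 1) * a r + \<alpha>' r * prim a r + \<beta>' r" using nn t by simp
      qed
    qed
  qed
  then show ?thesis unfolding mono_on_def Phi_def using pa by simp
qed

text \<open>By homogeneity the limit value equals \<open>r powr (- n - 1) * Pr r\<close> for every
  \<open>r > 0\<close>, with n the dimension. Subtracting it from \<open>Phi r\<close> removes
  \<open>Pr\<close> exactly, and the remaining inequality is the claim times a positive power of
  \<open>r\<close>.\<close>

lemma frequency_ge: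
  assumes lim: "(Phi \<longlongrightarrow> cP / (real CARD('n) + 1)) (at_right 0)" and r: "r \<in> {0<..<R}"
  shows "3/2 * Hs r \<le> r * (Dr r - Vr r)"
proof -
  let ?n = "real CARD('n)"
  have r0: "r > 0" using r by simp
  have "cP / (?n + 1) \<le> Phi r"
  proof (rule tendsto_upperbound[OF lim])
    have "Phi s \<le> Phi r" if "0 < s" "s < r" for s
      by (rule mono_onD[OF Phi_mono]) (use that r in auto)
    then show "\<forall>\<^sub>F s in at_right 0. Phi s \<le> Phi r"
      using r by (auto simp: eventually_at_right_field intro!: exI[of _ r])
  qed simp
  define t where "t = r powr (- ?n - 2)"
  have t: "t > 0" using r0 by (simp add: t_def)
  have "1 + (- ?n - 2) = - ?n - 1" by auto
  then have t1: "r powr (- ?n - 1) = r * t"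
    using powr_add[of r 1 "- ?n - 2"] powr_one[of r] r0 by (simp only: t_def less_imp_le)
  have "r powr (- ?n - 1) * r ^ (CARD('n) + 1) = 1"
    using r0 by (simp add: powr_realpow[symmetric] powr_add[symmetric] del: power_Suc)
  then have "r * t * Pr r = cP / (?n + 1)" unfolding Pr_eq[OF r0] t1 by (simp add: mult.assoc mult.left_commute)
  then have "0 \<le> r * t * (Dr r - Vr r) - 3/2 * (t * Hs r)"
    using \<open>cP / (?n + 1) \<le> Phi r\<close> unfolding Phi_def t1 t_def[symmetric] by (simp add: algebra_simps)
  also have "\<dots> = t * (r * (Dr r - Vr r) - 3/2 * Hs r)" by (simp add: algebra_simps)
  finally show ?thesis using t by (simp add: zero_le_mult_iff)
qed

definition dF :: "real \<Rightarrow> real" where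
  "dF r = 2 / r * (1 / (Hs r)\<^sup>2) * (Ns r * Hs r - (Ms r)\<^sup>2) + 2 * Vr r / Hs r * (r * Dr r / Hs r - 3/2)"

definition Fr :: "real \<Rightarrow> real" where "Fr r = r * (Dr r - Vr r) / Hs r"

text \<open>The frequency is \<open>r / Hs r\<close>, of class C^1, times the primitive of an
  integrable density. Lebesgue differentiation therefore gives its derivative almost everywhere, and
  the same derivative integrates back to the increments, so its sign decides monotonicity.\<close>

lemma frequency_monotone:
  assumes lim: "(Phi \<longlongrightarrow> cP / (real CARD('n) + 1)) (at_right 0)"
  shows "AE r in lborel. r \<in> {0<..<R} \<longrightarrow> (Fr has_real_derivative dF r) (at r)"
    and "mono_on {0<..<R} Fr" and "\<exists>L. (Fr \<longlongrightarrow> L) (at_right 0) \<and> L \<ge> 3/2"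
proof -
  define a where "a = (\<lambda>s. indicator {0<..<R} s * sphere_int x0 s q)"
  define \<alpha>' where "\<alpha>' r = (Hs r - r * Hs' r) / (Hs r * Hs r)" for r
  have ai: "integrable lborel a" unfolding a_def by (rule integrable_indicator_sphere_int[OF q_measurable q_integrable])
  have pa: "prim a r = Dr r - Vr r" if "r \<in> {0<..<R}" for r
    using prim_sphere_int[OF q_measurable q_integrable, of r] integral_q[of r] that by (simp add: a_def)
  have d\<alpha>: "((\<lambda>r. r / Hs r) has_real_derivative \<alpha>' r) (at r)" if r: "r \<in> {0<..<R}" for r
    using DERIV_divide[OF DERIV_ident Hs_derivative[OF r]] Hs_pos[OF r] by (simp add: \<alpha>'_def)
  have F: "r / Hs r * prim a r = Fr r" if "r \<in> {0<..<R}" for r using pa[OF that] by (simp add: Fr_def)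
  have eq: "AE r in lborel. r \<in> {0<..<R} \<longrightarrow> \<alpha>' r * prim a r + r / Hs r * a r = dF r"
    using AE_variation AE_Ms
  proof eventually_elim
    case (elim r)
    show ?case
    proof
      assume r: "r \<in> {0<..<R}"
      then have "r > 0" by simp
      show "\<alpha>' r * prim a r + r / Hs r * a r = dF r"
        unfolding dF_def \<alpha>'_def pa[OF r]
        by (rule frequency_derivative_algebra[OF \<open>r > 0\<close> Hs_pos[OF r] _ Hs'_def]) (use elim r in \<open>auto simp: a_def\<close>)
    qed
  qed
  show "AE r in lborel. r \<in> {0<..<R} \<longrightarrow> (Fr has_real_derivative dF r) (at r)"
    using eq lebesgue_differentiation_real[OF ai]
  proof eventually_elim
    case (elim r)
    show ?case
    proof
      assume r: "r \<in> {0<..<R}"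
      from DERIV_mult[OF d\<alpha>[OF r] elim(2)]
      have "((\<lambda>s. s / Hs s * prim a s) has_real_derivative dF r) (at r)"
        by (rule DERIV_cong) (use elim(1) r in \<open>simp add: mult.commute\<close>)
      then show "(Fr has_real_derivative dF r) (at r)"
        by (rule has_field_derivative_transform_within_open[where S="{0<..<R}"]) (use r F in auto)
    qed
  qed
  have dF_nonneg: "AE r in lborel. r \<in> {0<..<R} \<longrightarrow> 0 \<le> dF r"
    using AE_sph_integrable(1) AE_sph_integrable(2)
  proof eventually_elim
    case (elim r)
    show ?case
    proof
      assume r: "r \<in> {0<..<R}"
      have H: "Hs r > 0" by (rule Hs_pos[OF r])
      have "(Ms r)\<^sup>2 \<le> Ns r * Hs r"
        unfolding Ms_def Ns_def Hs_def
        by (rule sphere_int_Cauchy_Schwarz) (use elim r sph_integrable_u_sq H in \<open>auto simp: Hs_def\<close>)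
      moreover have "r * Vr r \<ge> 0" using r Vr_nonneg by simp
      \<comment> \<open>\<open>frequency_ge\<close> bounds \<open>r * (Dr r - Vr r)\<close> from
        below; since \<open>Vr\<close> is nonnegative, the bound also holds for
        \<open>r * Dr r\<close>, as the second term of the formula requires.\<close>
      then have "3/2 * Hs r \<le> r * Dr r" using frequency_ge[OF lim r] by (simp add: right_diff_distrib)
      then have "r * Dr r / Hs r - 3/2 \<ge> 0" using H by (simp add: field_simps)
      ultimately show "0 \<le> dF r"
        unfolding dF_def using r H Vr_nonneg[of r] by (intro add_nonneg_nonneg mult_nonneg_nonneg divide_nonneg_nonneg) auto
    qed
  qed
  have "mono_on {0<..<R} (\<lambda>r. r / Hs r * prim a r + 0)"
  proof (rule mono_on_prim_combination[OF ai d\<alpha>])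
    show "continuous_on {0<..<R} \<alpha>'" unfolding \<alpha>'_def
      using Hs_pos by (intro continuous_intros continuous_on_Hs continuous_on_Hs') fastforce
    show "AE r in lborel. r \<in> {0<..<R} \<longrightarrow> 0 \<le> r / Hs r * a r + \<alpha>' r * prim a r + 0"
      using eq dF_nonneg by eventually_elim (auto simp: add.commute)
  qed auto
  then show m: "mono_on {0<..<R} Fr" unfolding mono_on_def using F by simp
  show "\<exists>L. (Fr \<longlongrightarrow> L) (at_right 0) \<and> L \<ge> 3/2"
  proof (rule mono_on_tendsto_at_right[OF m R])
    fix r assume r: "r \<in> {0<..<R}"
    show "3/2 \<le> Fr r" using frequency_ge[OF lim r] Hs_pos[OF r] by (simp add: Fr_def field_simps)
  qed
qed

end

theorem mainTheorem14:
  fixes k :: "'n::finite" and \<Omega> :: "(real^'n) set"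
    and u :: "real^'n \<Rightarrow> real" and Du :: "real^'n \<Rightarrow> real^'n"
    and x0 :: "real^'n" and \<delta> :: real
  assumes "CARD('n) \<ge> 2"
    and "open \<Omega>" and "connected \<Omega>" and "bounded \<Omega>"
    and "\<exists>x\<in>\<Omega>. x $ k = 0"
    and "variational_solution k \<Omega> u Du"
    and "x0 \<in> Sigma_set k \<Omega> u Du"
    and "\<delta> = infdist x0 (frontier \<Omega>) / 2"
  shows
    "(AE r in lborel. r \<in> {0<..<\<delta>} \<longrightarrow>
       (F_freq k u Du x0 has_real_derivative
          (2 / r * (sphere_int x0 r (\<lambda>x. (u x)\<^sup>2)) powi (-2) *
             (sphere_int x0 r (\<lambda>x. (Du x \<bullet> (x - x0))\<^sup>2) * sphere_int x0 r (\<lambda>x. (u x)\<^sup>2)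
              - (sphere_int x0 r (\<lambda>x. u x * (Du x \<bullet> (x - x0))))\<^sup>2)
           + 2 * (LINT x:ball x0 r|lebesgue. max (x $ k) 0 * (1 - chi_pos u x))
               / sphere_int x0 r (\<lambda>x. (u x)\<^sup>2)
             * (r * (LINT x:ball x0 r|lebesgue. (norm (Du x))\<^sup>2)
                  / sphere_int x0 r (\<lambda>x. (u x)\<^sup>2) - 3/2)))
        (at r))
     \<and> mono_on {0<..<\<delta>} (F_freq k u Du x0)
     \<and> (\<exists>L. (F_freq k u Du x0 \<longlongrightarrow> L) (at_right 0) \<and> L \<ge> 3/2)"
proof -
  define P where "P = {x\<in>\<Omega>. u x > 0}"
  have vs: "variational_solution k \<Omega> u Du" and S: "x0 \<in> Sigma_set k \<Omega> u Du" by fact+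
  from vs obtain g H where gH: "\<forall>x\<in>P. (u has_derivative (\<lambda>h. g x \<bullet> h)) (at x)"
      "\<forall>x\<in>P. (g has_derivative H x) (at x)" "\<forall>i j. continuous_on P (\<lambda>x. H x (axis j 1) $ i)"
    unfolding variational_solution_def C2_on_def P_def by blast
  have x0: "x0 \<in> \<Omega>" "x0 $ k = 0" "x0 \<in> closure P"
    and limPhi: "((Phi_bound k u Du x0) \<longlongrightarrow> (LINT x:ball 0 1|lebesgue. max (x $ k) 0)) (at_right 0)"
    using S by (auto simp: Sigma_set_def S_set_def P_def frontier_def)
  have \<Omega>: "open \<Omega>" "bounded \<Omega>" by fact+
  \<comment> \<open>\<open>infdist\<close> to an empty set is 0 by convention, so positivity of
    \<delta> rests on the frontier being nonempty: \<Omega> is nonempty and, being bounded, not the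
    whole space.\<close>
  have fne: "frontier \<Omega> \<noteq> {}"
    using \<Omega> x0 frontier_not_empty[of \<Omega>] not_bounded_UNIV by blast
  have "x0 \<notin> frontier \<Omega>" using x0(1) \<Omega>(1) by (simp add: frontier_def interior_open)
  then have "infdist x0 (frontier \<Omega>) > 0"
    using fne by (simp add: infdist_pos_not_in_closed frontier_closed)
  then have \<delta>: "\<delta> > 0" using assms(8) by simp
  \<comment> \<open>A ball is connected, so if it met both \<Omega> and the complement it would
    contain a frontier point, at no more than half the distance from \<open>x0\<close> to the
    frontier.\<close>
  have sub: "cball x0 \<delta> \<subseteq> \<Omega>"
  proof (rule ccontr)
    assume "\<not> cball x0 \<delta> \<subseteq> \<Omega>"
    then have "cball x0 \<delta> \<inter> frontier \<Omega> \<noteq> {}"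
    proof (intro connected_Int_frontier connected_cball)
      have "x0 \<in> cball x0 \<delta> \<inter> \<Omega>" using x0(1) \<delta> by simp
      then show "cball x0 \<delta> \<inter> \<Omega> \<noteq> {}" by blast
    qed auto
    then obtain y where y: "y \<in> cball x0 \<delta>" "y \<in> frontier \<Omega>" by auto
    have "infdist x0 (frontier \<Omega>) \<le> dist x0 y" by (rule infdist_le[OF y(2)])
    then show False using y(1) \<delta> assms(8) by simp
  qed
  interpret sigma_point k \<Omega> u Du g H P x0 \<delta>
    by unfold_locales (use vs gH x0 \<delta> sub \<Omega> in \<open>auto simp: variational_solution_def P_def\<close>)
  have m1: "(\<lambda>x. (norm (Du x))\<^sup>2) \<in> borel_measurable borel" "(\<lambda>x. max (x $ k) 0 * (1 - chi_pos u x)) \<in> borel_measurable borel"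
    "(\<lambda>x. (norm (Du x))\<^sup>2 + x $ k * chi_pos u x) \<in> borel_measurable borel" "(\<lambda>x::real^'n. max (x $ k) 0) \<in> borel_measurable borel"
    "(\<lambda>x. (norm (Du x))\<^sup>2 + max (x $ k) 0 * (chi_pos u x - 1)) \<in> borel_measurable borel"
    by measurable
  note leb = m1[THEN set_lebesgue_integral_lebesgue_eq_lborel, of "ball _ _", simplified]
  have F: "F_freq k u Du x0 r = Fr r" if "r \<in> {0<..<\<delta>}" for r
    using integral_q[of r] that by (simp add: F_freq_def leb Fr_def q_def Hs_def)
  have Phi: "Phi_bound k u Du x0 r = Phi r" if "r \<in> {0<..<\<delta>}" for r
    using integral_energy[of r] that by (simp add: Phi_bound_def leb Phi_def Hs_def)
  have "(LINT x:ball 0 1|lebesgue. max ((x::real^'n) $ k) 0) = cP / (real CARD('n) + 1)"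
    using integral_pos_part_ball[of "0::real^'n" k 1] by (simp add: leb cP_def)
  moreover have "eventually (\<lambda>r. Phi_bound k u Du x0 r = Phi r) (at_right 0)"
    using Phi \<delta> by (auto simp: eventually_at_right_field intro!: exI[of _ \<delta>])
  ultimately have lim: "(Phi \<longlongrightarrow> cP / (real CARD('n) + 1)) (at_right 0)"
    using limPhi by (simp add: tendsto_cong)
  have pw: "z powi (-2) = 1 / z\<^sup>2" for z :: real by (simp add: power_int_def divide_inverse power_inverse)
  have ev: "eventually (\<lambda>r. F_freq k u Du x0 r = Fr r) (at_right 0)"
    using F \<delta> by (auto simp: eventually_at_right_field intro!: exI[of _ \<delta>])
  have D: "AE r in lborel. r \<in> {0<..<\<delta>} \<longrightarrow> (F_freq k u Du x0 has_real_derivative dF r) (at r)"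
    using frequency_monotone(1)[OF lim]
  proof eventually_elim
    case (elim r)
    show ?case
    proof
      assume r: "r \<in> {0<..<\<delta>}"
      show "(F_freq k u Du x0 has_real_derivative dF r) (at r)"
        by (rule has_field_derivative_transform_within_open[where S="{0<..<\<delta>}", OF elim[rule_format, OF r]])
           (use r F in auto)
    qed
  qed
  have "mono_on {0<..<\<delta>} (F_freq k u Du x0)"
    using frequency_monotone(2)[OF lim] F by (simp add: mono_on_def)
  moreover have "\<exists>L. (F_freq k u Du x0 \<longlongrightarrow> L) (at_right 0) \<and> L \<ge> 3/2"
    using frequency_monotone(3)[OF lim] ev by (simp add: tendsto_cong)
  ultimately show ?thesis
    using D unfolding leb pw dF_def Hs_def Ns_def Ms_def Vr_def Dr_def by (intro conjI)
qed

end
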